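(* Consider the closed-loop system described in the context under the dynamic event-triggered gain scheduler, where $\lambda$ satisfies the Lipschitz assumption with constant $\varphi>0$. If $$\varphi<\frac{\mu^2R(1-R)}{G^2\ln(G)},$$ then the closed-loop system (with Dirichlet or Neumann actuation) is globally exponentially stable. More specifically, there exists a constant $\sigma>0$ such that, for every initial condition $u_0\in L^2(0,1)$, the closed-loop solution satisfies $$\|u[t]\|\le G\exp(-\sigma t)\|u[0]\|\quad\text{for all }t\ge0.$$
   Context: Plant. Let $\varepsilon>0$ and $q\in(-\infty,+\infty]$. Consider, for $x\in[0,1]$, $t\ge 0$, $$u_t(t,x)=\varepsilon u_{xx}(t,x)+\lambda(t,x)u(t,x),\qquad u_x(t,0)=q\,u(t,0),$$ $$u(t,1)=U(t)\ \text{(Dirichlet actuation)}\quad\text{or}\quad u_x(t,1)=U(t)\ \text{(Neumann actuation)},$$ with $u(0,x)=u_0(x)$. When $q=+\infty$ the condition at $x=0$ is interpreted as the Dirichlet condition $u(t,0)=0$. Here $\lambda\in C^0(\mathbb{R}_+\times[0,1])$, $\lambda(t,\cdot)\in C^1([0,1])$ for each $t$, there is $\bar\lambda>0$ with $|\lambda(t,x)|\le\bar\lambda$ for all $t\ge0$, $x\in[0,1]$, and (Lipschitz assumption) there is a constant $\varphi>0$ with $|\lambda(t,x)-\lambda(s,x)|\le\varphi|t-s|$ for all $x\in[0,1]$, $t,s\ge0$. $u[t]$ denotes the profile $x\mapsto u(t,x)$; $\|\cdot\|$ and $\langle\cdot,\cdot\rangle$ are the $L^2(0,1)$ norm and inner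 product. Kernels and control. Let $\bar q=\max\{0,-q\}$ and fix $c\ge\varepsilon\bar q^2$ (Dirichlet actuation) or $c\ge\varepsilon\bar q^2+\varepsilon/2$ (Neumann actuation). Given an event time $t_j$, put $b_j(x)=\lambda(t_j,x)$, and for $t\ge t_j$ put $e_j(t,x)=\lambda(t,x)-b_j(x)$, $f_j(t,x)=e_j(t,x)u(t,x)$. Let $K_j$ be the $C^2$ solution on $\{0\le y\le x\le1\}$ (known to exist) of $$K_{j,xx}-K_{j,yy}=\tfrac{b_j(y)+c}{\varepsilon}K_j,\quad K_{j,y}(x,0)=qK_j(x,0),\quad K_j(x,x)=-\tfrac1{2\varepsilon}\int_0^x(b_j(s)+c)\,ds$$ (with $K_j(x,0)=0$ when $q=+\infty$), and define $(\mathcal{K}_jh)(x)=h(x)-\int_0^xK_j(x,y)h(y)\,dy$ for $h\in L^2(0,1)$. For $t\in(t_j,t_{j+1})$ the control is $U(t)=\int_0^1K_j(1,y)u(t,y)\,dy$ (Dirichlet actuation) or $U(t)=K_j(1,1)u(t,1)+\int_0^1K_{j,x}(1,y)u(t,y)\,dy$ (Neumann actuation). The closed-loop solution is the unique $u\in C^0(\mathbb{R}_+;L^2(0,1))\cap C^1(I;L^2(0,1))$, $I=\mathbb{R}_+\setminus\{t_j\}$, with $u[t]\in H^2(0,1)$ for $t>0$, satisfying the equations for all $t\in I$ and $u[0]=u_0$. Constants. Let $\mu_1$ be the smallest eigenvalue of $h\mapsto-h''$ on the set of $h\in H^2(0,1)$ with $h'(0)=qh(0)$ ($h(0)=0$ if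 $q=+\infty$) and $h(1)=0$ (Dirichlet actuation) or $h'(1)=0$ (Neumann actuation). Let $\mu=c+\varepsilon\mu_1$ and $$G=1+\sqrt{\frac{\bar\lambda+c}{4\varepsilon}\left(\exp\left(\frac{4(\bar\lambda+c)}{\varepsilon}\right)-1\right)}.$$ Dynamic event-triggered gain scheduler. Let $R\in(0,1)$, $\eta\ge2\mu(1-R)$, $\theta>0$ be design parameters. Set $t_0=0$. Given $t_j$, let $u[t]$, $t\ge t_j$, be the solution with the control computed from $K_j$, and let $m$ solve $$\dot m(t)=-\eta m(t)+\mu R\|\mathcal{K}_ju[t]\|^2-\langle\mathcal{K}_ju[t],\mathcal{K}_jf_j[t]\rangle,\quad t\ge t_j,\qquad m(t_j)=0$$ ($m$ is reset to $0$ at each event). Let $S_j=\{t>t_j:\ \langle\mathcal{K}_ju[t],\mathcal{K}_jf_j[t]\rangle-\mu R\|\mathcal{K}_ju[t]\|^2>\tfrac1\theta m(t)\}$. If $S_j=\emptyset$ the set of event times is $\{t_0,\dots,t_j\}$ (so $t_{j+1}=+\infty$); otherwise $t_{j+1}=\inf S_j$. *)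

theory Defs
  imports "HOL-Analysis.Analysis"
begin

section \<open>The space \<open>L\<^sup>2(0,1)\<close> and functions of time with values in it\<close>

text \<open>Elements of \<open>L\<^sup>2(0,1)\<close> are represented by functions on the reals, of which only the values
  on \<open>[0,1]\<close> matter; equality in \<open>L\<^sup>2(0,1)\<close> is equality almost everywhere. A profile-valued
  function \<open>u\<close> is curried, so that \<open>u t\<close> is the profile \<open>u[t]\<close>.\<close>

abbreviation unitM :: "real measure" where
  "unitM \<equiv> lebesgue_on {0..1}"

definition L2 :: "(real \<Rightarrow> real) set" where
  "L2 = {h. h \<in> borel_measurable unitM \<and> integrable unitM (\<lambda>x. (h x)\<^sup>2)}"

definition inner2 :: "(real \<Rightarrow> real) \<Rightarrow> (real \<Rightarrow> real) \<Rightarrow> real" where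
  "inner2 g h = (LINT x|unitM. g x * h x)"

definition norm2 :: "(real \<Rightarrow> real) \<Rightarrow> real" where
  "norm2 h = sqrt (inner2 h h)"

definition C0_L2 :: "real set \<Rightarrow> (real \<Rightarrow> real \<Rightarrow> real) \<Rightarrow> bool" where
  "C0_L2 I u \<longleftrightarrow> (\<forall>t\<in>I. u t \<in> L2) \<and>
     (\<forall>t\<in>I. ((\<lambda>s. norm2 (\<lambda>x. u s x - u t x)) \<longlongrightarrow> 0) (at t within I))"

text \<open>\<open>C1_L2 I u ut\<close>: \<open>u \<in> C\<^sup>1(I; L\<^sup>2(0,1))\<close> with derivative \<open>ut\<close>.\<close>

definition C1_L2 :: "real set \<Rightarrow> (real \<Rightarrow> real \<Rightarrow> real) \<Rightarrow> (real \<Rightarrow> real \<Rightarrow> real) \<Rightarrow> bool" where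
  "C1_L2 I u ut \<longleftrightarrow> (\<forall>t\<in>I. u t \<in> L2) \<and> C0_L2 I ut \<and>
     (\<forall>t\<in>I. ((\<lambda>s. norm2 (\<lambda>x. (u s x - u t x) / (s - t) - ut t x)) \<longlongrightarrow> 0) (at t within I))"

text \<open>\<open>H2 h h' h''\<close>: \<open>h\<close> is the continuously differentiable representative of an element of
  the Sobolev space \<open>H\<^sup>2(0,1)\<close>, with derivatives \<open>h'\<close> (absolutely continuous) and \<open>h''\<close> (in
  \<open>L\<^sup>2(0,1)\<close>). On \<open>[0,1]\<close>, \<open>h'\<close> is determined by \<open>h\<close> everywhere and \<open>h''\<close> almost everywhere;
  the traces of \<open>h\<close> and \<open>h'\<close> at the end points are point values.\<close>

definition H2 :: "(real \<Rightarrow> real) \<Rightarrow> (real \<Rightarrow> real) \<Rightarrow> (real \<Rightarrow> real) \<Rightarrow> bool" where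
  "H2 h h' h'' \<longleftrightarrow> h'' \<in> L2 \<and>
     (\<forall>x\<in>{0..1}. h' x = h' 0 + (LINT s|lebesgue_on {0..x}. h'' s)) \<and>
     (\<forall>x\<in>{0..1}. h x = h 0 + (LINT s|lebesgue_on {0..x}. h' s))"

section \<open>Boundary conditions and the constants\<close>

datatype actuation = Dirichlet | Neumann

text \<open>The condition \<open>h'(0) = q h(0)\<close>, with \<open>a = h(0)\<close> and \<open>a' = h'(0)\<close>.\<close>

definition left_bc :: "ereal \<Rightarrow> real \<Rightarrow> real \<Rightarrow> bool" where
  "left_bc q a a' \<longleftrightarrow> (if q = \<infinity> then a = 0 else a' = real_of_ereal q * a)"

definition qbar :: "ereal \<Rightarrow> real" where
  "qbar q = real_of_ereal (max 0 (- q))"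

definition min_c :: "actuation \<Rightarrow> real \<Rightarrow> ereal \<Rightarrow> real" where
  "min_c act \<epsilon> q = (case act of
     Dirichlet \<Rightarrow> \<epsilon> * (qbar q)\<^sup>2
   | Neumann \<Rightarrow> \<epsilon> * (qbar q)\<^sup>2 + \<epsilon> / 2)"

definition eigenvalue :: "actuation \<Rightarrow> ereal \<Rightarrow> real \<Rightarrow> bool" where
  "eigenvalue act q \<nu> \<longleftrightarrow> (\<exists>h h' h''. H2 h h' h'' \<and>
     left_bc q (h 0) (h' 0) \<and>
     (case act of Dirichlet \<Rightarrow> h 1 = 0 | Neumann \<Rightarrow> h' 1 = 0) \<and>
     (\<exists>x\<in>{0..1}. h x \<noteq> 0) \<and>
     (AE x in unitM. - h'' x = \<nu> * h x))"

definition smallest_eigenvalue :: "actuation \<Rightarrow> ereal \<Rightarrow> real \<Rightarrow> bool" where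
  "smallest_eigenvalue act q \<nu> \<longleftrightarrow> eigenvalue act q \<nu> \<and> (\<forall>\<nu>'. eigenvalue act q \<nu>' \<longrightarrow> \<nu> \<le> \<nu>')"

definition gainG :: "real \<Rightarrow> real \<Rightarrow> real \<Rightarrow> real" where
  "gainG \<epsilon> lbar c = 1 + sqrt ((lbar + c) / (4 * \<epsilon>) * (exp (4 * (lbar + c) / \<epsilon>) - 1))"

section \<open>Kernels and control\<close>

definition triangle :: "(real \<times> real) set" where
  "triangle = {(x, y). 0 \<le> y \<and> y \<le> x \<and> x \<le> 1}"

text \<open>\<open>F\<close> is \<open>C\<^sup>1\<close> on the closed triangle with partial derivatives \<open>Fx\<close>, \<open>Fy\<close>. Derivatives
  within the triangle are unique, as it is convex with nonempty interior.\<close>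

definition C1_triangle ::
  "(real \<times> real \<Rightarrow> real) \<Rightarrow> (real \<times> real \<Rightarrow> real) \<Rightarrow> (real \<times> real \<Rightarrow> real) \<Rightarrow> bool" where
  "C1_triangle F Fx Fy \<longleftrightarrow> continuous_on triangle Fx \<and> continuous_on triangle Fy \<and>
     (\<forall>p\<in>triangle. (F has_derivative (\<lambda>(h, k). Fx p * h + Fy p * k)) (at p within triangle))"

definition kernel ::
  "real \<Rightarrow> ereal \<Rightarrow> real \<Rightarrow> (real \<Rightarrow> real) \<Rightarrow> (real \<times> real \<Rightarrow> real) \<Rightarrow> (real \<times> real \<Rightarrow> real) \<Rightarrow> bool"
where
  "kernel \<epsilon> q c b K Kx \<longleftrightarrow> (\<exists>Ky Kxx Kxy Kyx Kyy.
     C1_triangle K Kx Ky \<and> C1_triangle Kx Kxx Kxy \<and> C1_triangle Ky Kyx Kyy \<and>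
     (\<forall>(x, y)\<in>triangle. Kxx (x, y) - Kyy (x, y) = (b y + c) / \<epsilon> * K (x, y)) \<and>
     (\<forall>x\<in>{0..1}. left_bc q (K (x, 0)) (Ky (x, 0))) \<and>
     (\<forall>x\<in>{0..1}. K (x, x) = - 1 / (2 * \<epsilon>) * (LINT s|lebesgue_on {0..x}. b s + c)))"

definition backstep :: "(real \<times> real \<Rightarrow> real) \<Rightarrow> (real \<Rightarrow> real) \<Rightarrow> real \<Rightarrow> real" where
  "backstep K h x = h x - (LINT y|lebesgue_on {0..x}. K (x, y) * h y)"

text \<open>The profile \<open>h \<in> H\<^sup>2(0,1)\<close> satisfies the actuated boundary condition at \<open>x = 1\<close> under the
  feedback law with kernel \<open>K\<close>; \<open>Kx\<close> is the derivative of \<open>K\<close> in its first argument.\<close>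

definition feedback_bc ::
  "actuation \<Rightarrow> (real \<times> real \<Rightarrow> real) \<Rightarrow> (real \<times> real \<Rightarrow> real) \<Rightarrow> (real \<Rightarrow> real) \<Rightarrow> bool" where
  "feedback_bc act K Kx h \<longleftrightarrow> (\<exists>h' h''. H2 h h' h'' \<and>
     (case act of
        Dirichlet \<Rightarrow> h 1 = (LINT y|unitM. K (1, y) * h y)
      | Neumann \<Rightarrow> h' 1 = K (1, 1) * h 1 + (LINT y|unitM. Kx (1, y) * h y)))"

section \<open>Plant and closed loop\<close>

text \<open>Smoothness in time, the differential equation and the boundary condition at \<open>x = 0\<close>, for
  times in \<open>I\<close>.\<close>

definition plant_on ::
  "real \<Rightarrow> ereal \<Rightarrow> (real \<Rightarrow> real \<Rightarrow> real) \<Rightarrow> real set \<Rightarrow> (real \<Rightarrow> real \<Rightarrow> real) \<Rightarrow> bool" where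
  "plant_on \<epsilon> q lam I u \<longleftrightarrow> (\<exists>ut. C1_L2 I u ut \<and>
     (\<forall>t\<in>I. \<exists>ux uxx. H2 (u t) ux uxx \<and>
        (AE x in unitM. ut t x = \<epsilon> * uxx x + lam t x * u t x) \<and>
        left_bc q (u t 0) (ux 0)))"

text \<open>A solution on \<open>[T,\<infinity>)\<close> with the control computed from one fixed kernel.\<close>

definition fixed_gain_solution ::
  "actuation \<Rightarrow> real \<Rightarrow> ereal \<Rightarrow> (real \<Rightarrow> real \<Rightarrow> real) \<Rightarrow> (real \<times> real \<Rightarrow> real) \<Rightarrow>
   (real \<times> real \<Rightarrow> real) \<Rightarrow> real \<Rightarrow> (real \<Rightarrow> real \<Rightarrow> real) \<Rightarrow> bool" where
  "fixed_gain_solution act \<epsilon> q lam K Kx T v \<longleftrightarrow>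
     C0_L2 {T..} v \<and> plant_on \<epsilon> q lam {T<..} v \<and> (\<forall>t>T. feedback_bc act K Kx (v t))"

text \<open>\<open>\<langle>\<K>\<^sub>j u[t], \<K>\<^sub>j f\<^sub>j[t]\<rangle> - \<mu> R \<parallel>\<K>\<^sub>j u[t]\<parallel>\<^sup>2\<close> for \<open>u = v\<close> and \<open>t\<^sub>j = T\<close>.\<close>

definition trigger ::
  "(real \<Rightarrow> real \<Rightarrow> real) \<Rightarrow> real \<Rightarrow> real \<Rightarrow> (real \<times> real \<Rightarrow> real) \<Rightarrow> real \<Rightarrow>
   (real \<Rightarrow> real \<Rightarrow> real) \<Rightarrow> real \<Rightarrow> real" where
  "trigger lam \<mu> R K T v t =
     inner2 (backstep K (v t)) (backstep K (\<lambda>x. (lam t x - lam T x) * v t x))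
     - \<mu> * R * (norm2 (backstep K (v t)))\<^sup>2"

definition trigger_state ::
  "(real \<Rightarrow> real \<Rightarrow> real) \<Rightarrow> real \<Rightarrow> real \<Rightarrow> real \<Rightarrow> (real \<times> real \<Rightarrow> real) \<Rightarrow> real \<Rightarrow>
   (real \<Rightarrow> real \<Rightarrow> real) \<Rightarrow> (real \<Rightarrow> real) \<Rightarrow> bool" where
  "trigger_state lam \<mu> R \<eta> K T v m \<longleftrightarrow> m T = 0 \<and>
     (\<forall>t\<ge>T. (m has_real_derivative (- \<eta> * m t - trigger lam \<mu> R K T v t)) (at t within {T..}))"

text \<open>The event times are the finite values of \<open>\<tau>\<close>; a value \<open>\<infinity>\<close> (the infimum of the empty set)
  means that no further event occurs. \<open>K j\<close> is the kernel used from \<open>\<tau> j\<close> on. The scheduler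
  decides on \<open>\<tau> (Suc j)\<close> by means of the solution \<open>v j\<close> on \<open>[\<tau> j,\<infinity>)\<close> that keeps this kernel forever,
  and \<open>u\<close> follows \<open>v j\<close> until \<open>\<tau> (Suc j)\<close>.\<close>

definition scheduled ::
  "actuation \<Rightarrow> real \<Rightarrow> ereal \<Rightarrow> (real \<Rightarrow> real \<Rightarrow> real) \<Rightarrow> real \<Rightarrow> real \<Rightarrow> real \<Rightarrow> real \<Rightarrow> real \<Rightarrow>
   (real \<Rightarrow> real \<Rightarrow> real) \<Rightarrow> (nat \<Rightarrow> ereal) \<Rightarrow> (nat \<Rightarrow> real \<times> real \<Rightarrow> real) \<Rightarrow>
   (nat \<Rightarrow> real \<times> real \<Rightarrow> real) \<Rightarrow> bool" where
  "scheduled act \<epsilon> q lam c \<mu> R \<eta> \<theta> u \<tau> K Kx \<longleftrightarrow>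
     \<tau> 0 = 0 \<and> (\<forall>j. \<tau> j = \<infinity> \<longrightarrow> \<tau> (Suc j) = \<infinity>) \<and>
     (\<forall>j T. \<tau> j = ereal T \<longrightarrow>
        kernel \<epsilon> q c (lam T) (K j) (Kx j) \<and>
        (\<exists>v m. fixed_gain_solution act \<epsilon> q lam (K j) (Kx j) T v \<and>
           trigger_state lam \<mu> R \<eta> (K j) T v m \<and>
           \<tau> (Suc j) = (INF t\<in>{t. t > T \<and> trigger lam \<mu> R (K j) T v t > 1 / \<theta> * m t}. ereal t) \<and>
           (\<forall>t\<ge>T. ereal t \<le> \<tau> (Suc j) \<longrightarrow> (AE x in unitM. u t x = v t x))))"

text \<open>Absence of accumulation of event times is not part of the definition.\<close>

definition closed_loop_solution ::
  "actuation \<Rightarrow> real \<Rightarrow> ereal \<Rightarrow> (real \<Rightarrow> real \<Rightarrow> real) \<Rightarrow> real \<Rightarrow> real \<Rightarrow> real \<Rightarrow> real \<Rightarrow> real \<Rightarrow>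
   (real \<Rightarrow> real) \<Rightarrow> (real \<Rightarrow> real \<Rightarrow> real) \<Rightarrow> bool" where
  "closed_loop_solution act \<epsilon> q lam c \<mu> R \<eta> \<theta> u0 u \<longleftrightarrow> (\<exists>\<tau> K Kx.
     scheduled act \<epsilon> q lam c \<mu> R \<eta> \<theta> u \<tau> K Kx \<and>
     C0_L2 {0..} u \<and>
     (AE x in unitM. u 0 x = u0 x) \<and>
     (\<forall>t>0. \<exists>ux uxx. H2 (u t) ux uxx) \<and>
     plant_on \<epsilon> q lam {t. t \<ge> 0 \<and> ereal t \<notin> range \<tau>} u \<and>
     (\<forall>j t. \<tau> j < ereal t \<and> ereal t < \<tau> (Suc j) \<longrightarrow> feedback_bc act (K j) (Kx j) (u t)))"

end

theory Submission
  imports Defs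
begin

text \<open>On an interval between two events, \<open>w = \<K>\<^sub>j u\<close> solves the heat equation with reaction term \<open>- c\<close>,
  perturbed by \<open>\<K>\<^sub>j f\<^sub>j\<close>. The spectral bound given by \<open>\<mu>\<^sub>1\<close> (Picone's identity for a positive ground
  state, so that no eigenfunction expansion is needed) makes \<open>\<parallel>w\<parallel>\<^sup>2 / 2 + m\<close> decay at rate \<open>2 \<mu> (1 - R)\<close>,
  because the trigger keeps \<open>m\<close> nonnegative. The kernel is bounded along characteristics. The inverse transform is
  bounded without its kernel: standing waves \<open>u\<close> solve a wave equation that can be solved sideways, with
  \<open>x\<close> as time, and d'Alembert's formula compares \<open>u\<close> with \<open>\<K>\<^sub>j u\<close>. Both norms are at most
  \<open>\<kappa> = 1 + M e\<^sup>s\<^sup>+\<^sup>M\<^sup>/\<^sup>3 / 4\<close> with \<open>M = (lbar + c) / \<epsilon>\<close>, \<open>s = \<surd>M\<close>, and \<open>\<kappa>\<^sup>2 \<le> G\<close>. Hence events are at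
  least \<open>\<delta> = \<mu> R / (\<phi> G)\<close> apart, each interval contributes a factor of at most \<open>G e\<^sup>-\<^sup>\<mu>\<^sup>(\<^sup>1\<^sup>-\<^sup>R\<^sup>)\<^sup>\<delta>\<close>, and the
  hypothesis on \<open>\<phi>\<close> makes that factor less than \<open>1\<close>.\<close>

section \<open>Integration on subintervals and on the triangle\<close>

text \<open>The hypothesis fixes \<open>G\<close> in advance, so the norms of the transform and of
  its inverse must be explicit: their product enters both the loss per event and the dwell time, and
  it has to stay below \<open>G\<close> for every \<open>q\<close>. The Robin parameter is harmless
  because \<open>\<epsilon> * (qbar q)\<^sup>2 <= c\<close> gives \<open>qbar q <= s\<close>; a
  boundary that feeds energy in costs at most the factor \<open>exp s\<close>. The inverse is needed
  only on \<open>H2\<close> profiles that satisfy the condition at \<open>x = 0\<close>, which the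
  solution provides at every time after an event; the forward bound holds on all of
  \<open>L2\<close> and so applies to rough initial data. On such profiles the inverse is reached by
  density: at each frequency the transform exchanges the perturbed and the free oscillator with the
  same Cauchy data at \<open>x = 0\<close>, and sums of these pairs approximate every admissible
  profile uniformly. Crude constants of the approximation multiply only an error that tends to
  \<open>0\<close>. As second derivatives are merely in \<open>L2\<close>, derivatives of Volterra
  integrals are obtained in integrated form, through Fubini on the triangle.\<close>

lemma lebesgue_on_eq_lborel:
  fixes f g :: "real \<Rightarrow> real"
  assumes g: "g \<in> borel_measurable borel" and S: "S \<in> sets borel"
    and ae: "AE y in lborel. g y = (if y \<in> S then f y else 0)"
  shows "f \<in> borel_measurable (lebesgue_on S)"
    and "integrable lborel g \<Longrightarrow> integrable (lebesgue_on S) f"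
    and "integral\<^sup>L (lebesgue_on S) f = integral\<^sup>L lborel g"
proof -
  have Sl: "S \<in> sets lebesgue" using S by auto
  have gl: "g \<in> borel_measurable lebesgue" using g by (simp add: measurable_completion)
  have ael: "AE y in lebesgue. g y = (if y \<in> S then f y else 0)"
    using AE_completion[OF ae] .
  have fl: "(\<lambda>y. if y \<in> S then f y else 0) \<in> borel_measurable lebesgue"
    using borel_measurable_AE[OF gl ael] .
  then show "f \<in> borel_measurable (lebesgue_on S)"
    using borel_measurable_if[OF Sl] by blast
  show "integrable (lebesgue_on S) f" if "integrable lborel g"
  proof -
    have "integrable lebesgue g" using that g by (simp add: integrable_completion)
    then have "integrable lebesgue (\<lambda>y. if y \<in> S then f y else 0)"
      using integrable_cong_AE[OF gl fl ael] by simp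
    then show ?thesis using Lebesgue_Measure.integrable_restrict_UNIV[OF Sl] by blast
  qed
  have "integral\<^sup>L (lebesgue_on S) f = integral\<^sup>L lebesgue (\<lambda>y. if y \<in> S then f y else 0)"
    using Lebesgue_Measure.integral_restrict_UNIV[OF Sl, of f] by simp
  also have "\<dots> = integral\<^sup>L lebesgue g"
    using integral_cong_AE[OF gl fl ael] by simp
  also have "\<dots> = integral\<^sup>L lborel g" using g by (simp add: integral_completion)
  finally show "integral\<^sup>L (lebesgue_on S) f = integral\<^sup>L lborel g" .
qed

text \<open>Fubini is applied to Borel functions on \<open>lborel\<close>, whereas profiles are
  Lebesgue measurable on an interval. A Borel version of the zero extension, fed into
  \<open>lebesgue_on_eq_lborel\<close>, moves measurability, integrability and integrals between the
  two settings.\<close>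

lemma lebesgue_on_borel_version:
  fixes h :: "real \<Rightarrow> real"
  assumes h: "integrable (lebesgue_on S) h" and S: "S \<in> sets borel"
  obtains g where "g \<in> borel_measurable borel" "integrable lborel g"
    "AE y in lborel. g y = (if y \<in> S then h y else 0)"
proof -
  have Sl: "S \<in> sets lebesgue" using S by auto
  have hl: "integrable lebesgue (\<lambda>y. if y \<in> S then h y else 0)"
    using h Lebesgue_Measure.integrable_restrict_UNIV[OF Sl] by blast
  then obtain g where g: "g \<in> borel_measurable lborel"
    and ae: "AE y in lborel. (if y \<in> S then h y else 0) = g y"
    using completion_ex_borel_measurable_real[OF borel_measurable_integrable] by blast
  have gb: "g \<in> borel_measurable borel" using g by simp
  have "integrable lebesgue g"
    using integrable_cong_AE[OF borel_measurable_integrable[OF hl] measurable_completion[OF g] AE_completion[OF ae]]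
      hl by simp
  then have "integrable lborel g" using g by (simp add: integrable_completion)
  moreover have "AE y in lborel. g y = (if y \<in> S then h y else 0)"
    using ae by eventually_elim simp
  ultimately show ?thesis using that gb by blast
qed

lemma compact_triangle: "compact triangle"
proof -
  have "triangle = ({0..1} \<times> {0..1}) \<inter> {p. snd p \<le> fst p}"
    by (auto simp: triangle_def)
  moreover have "closed {p::real \<times> real. snd p \<le> fst p}"
    by (intro closed_Collect_le continuous_intros)
  ultimately show ?thesis
    by (metis compact_Int_closed compact_Times compact_Icc)
qed

lemma continuous_on_triangle_bounded:
  fixes A :: "real \<times> real \<Rightarrow> real"
  assumes "continuous_on triangle A"
  obtains C where "C > 0" "\<And>x y. 0 \<le> y \<Longrightarrow> y \<le> x \<Longrightarrow> x \<le> 1 \<Longrightarrow> \<bar>A (x, y)\<bar> \<le> C"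
proof -
  have "bounded (A ` triangle)"
    by (intro compact_imp_bounded compact_continuous_image assms compact_triangle)
  then obtain C where "C > 0" "\<And>p. p \<in> triangle \<Longrightarrow> norm (A p) \<le> C"
    by (metis bounded_pos imageI)
  then show ?thesis using that[of C] by (auto simp: triangle_def)
qed

text \<open>The exchange of integrals behind the Leibniz rule and the integration by parts below.
  The kernel is bounded on the compact triangle, so a multiple of \<open>|h|\<close> on the unit
  square dominates the integrand.\<close>

lemma triangle_Fubini:
  fixes A :: "real \<times> real \<Rightarrow> real" and h :: "real \<Rightarrow> real"
  assumes A: "continuous_on triangle A" and h: "integrable unitM h" and x: "x \<in> {0..1}"
  shows "integrable (lebesgue_on {0..x}) (\<lambda>s. LINT y|lebesgue_on {0..s}. A (s, y) * h y)"
    and "(LINT s|lebesgue_on {0..x}. LINT y|lebesgue_on {0..s}. A (s, y) * h y)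
       = (LINT y|lebesgue_on {0..x}. (LINT s|lebesgue_on {y..x}. A (s, y)) * h y)"
proof -
  obtain C where C: "C > 0" "\<And>x y. 0 \<le> y \<Longrightarrow> y \<le> x \<Longrightarrow> x \<le> 1 \<Longrightarrow> \<bar>A (x, y)\<bar> \<le> C"
    using continuous_on_triangle_bounded[OF A] by blast
  obtain g where g[measurable]: "g \<in> borel_measurable borel" and gi: "integrable lborel g"
    and gh: "AE y in lborel. g y = (if y \<in> {0..1} then h y else 0)"
    using lebesgue_on_borel_version[OF h] by auto
  \<comment> \<open>Extension by zero makes the kernel Borel on the whole plane. The function
    \<open>f\<close> below cuts it at \<open>x\<close>, and its two iterated integrals are the two
    sides of the claim.\<close>
  define B where "B = (\<lambda>p. indicator triangle p *\<^sub>R A p)"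
  have B[measurable]: "B \<in> borel_measurable (borel \<Otimes>\<^sub>M borel)"
    unfolding B_def borel_prod
    by (intro borel_measurable_continuous_on_indicator A borel_closed compact_imp_closed compact_triangle)
  define f where "f = (\<lambda>s y. indicator {0..x} s * B (s, y) * g y)"
  have fm[measurable]: "case_prod f \<in> borel_measurable (lborel \<Otimes>\<^sub>M lborel)"
    unfolding f_def by measurable
  have fi: "integrable (lborel \<Otimes>\<^sub>M lborel) (case_prod f)"
  proof (rule Bochner_Integration.integrable_bound)
    show "integrable (lborel \<Otimes>\<^sub>M lborel) (\<lambda>(s, y). C * indicator {0..1::real} s * \<bar>g y\<bar>)"
    proof (rule lborel_pair.Fubini_integrable)
      show "(\<lambda>(s, y). C * indicator {0..1::real} s * \<bar>g y\<bar>) \<in> borel_measurable (lborel \<Otimes>\<^sub>M lborel)"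
      proof -
        have m1: "(\<lambda>p::real \<times> real. \<bar>g (snd p)\<bar>) \<in> borel_measurable (lborel \<Otimes>\<^sub>M lborel)"
          by (intro borel_measurable_abs measurable_compose[OF measurable_snd]) simp
        have m2: "(\<lambda>p::real \<times> real. indicator {0..1} (fst p) :: real) \<in> borel_measurable (lborel \<Otimes>\<^sub>M lborel)"
          by (intro measurable_compose[OF measurable_fst]) simp
        show ?thesis unfolding split_beta'
          by (intro borel_measurable_times borel_measurable_const m1 m2)
      qed
      have "integrable lborel (\<lambda>s. indicator {0..1::real} s * (C * (\<integral>y. \<bar>g y\<bar> \<partial>lborel)))"
        by (intro integrable_mult_left integrable_real_indicator) auto
      moreover have "(\<lambda>s. \<integral>y. norm (case (s, y) of (s, y) \<Rightarrow> C * indicator {0..1::real} s * \<bar>g y\<bar>) \<partial>lborel)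
          = (\<lambda>s. indicator {0..1::real} s * (C * (\<integral>y. \<bar>g y\<bar> \<partial>lborel)))"
      proof
        fix s :: real
        have "(\<lambda>y. norm (case (s, y) of (s, y) \<Rightarrow> C * indicator {0..1::real} s * \<bar>g y\<bar>))
          = (\<lambda>y. (C * indicator {0..1} s) * \<bar>g y\<bar>)" using C(1) by (auto simp: abs_mult)
        then show "(\<integral>y. norm (case (s, y) of (s, y) \<Rightarrow> C * indicator {0..1::real} s * \<bar>g y\<bar>) \<partial>lborel)
          = indicator {0..1::real} s * (C * (\<integral>y. \<bar>g y\<bar> \<partial>lborel))"
          by (simp add: mult_ac)
      qed
      ultimately show "integrable lborel (\<lambda>s. \<integral>y. norm (case (s, y) of (s, y) \<Rightarrow> C * indicator {0..1::real} s * \<bar>g y\<bar>) \<partial>lborel)"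
        by (simp only:)
      show "AE s in lborel. integrable lborel (\<lambda>y. case (s, y) of (s, y) \<Rightarrow> C * indicator {0..1::real} s * \<bar>g y\<bar>)"
        using gi by simp
    qed
    show "AE p in lborel \<Otimes>\<^sub>M lborel. norm (case_prod f p) \<le> norm (case p of (s, y) \<Rightarrow> C * indicator {0..1::real} s * \<bar>g y\<bar>)"
    proof (rule AE_I2)
      fix p :: "real \<times> real"
      obtain s y where p: "p = (s, y)" by (cases p)
      have "\<bar>indicator {0..x} s * B (s, y)\<bar> \<le> C * indicator {0..1} s"
        using C x by (auto simp: B_def triangle_def indicator_def)
      then show "norm (case_prod f p) \<le> norm (case p of (s, y) \<Rightarrow> C * indicator {0..1::real} s * \<bar>g y\<bar>)"
        using C(1) by (auto simp: p f_def abs_mult intro!: mult_right_mono)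
    qed
  qed (use fm in auto)
  have inner1: "(\<integral>y. f s y \<partial>lborel) = (if s \<in> {0..x} then (LINT y|lebesgue_on {0..s}. A (s, y) * h y) else 0)" for s
  proof (cases "s \<in> {0..x}")
    case True
    have "(LINT y|lebesgue_on {0..s}. A (s, y) * h y) = (\<integral>y. f s y \<partial>lborel)"
    proof (rule lebesgue_on_eq_lborel(3))
      show "f s \<in> borel_measurable borel" unfolding f_def by measurable
      show "AE y in lborel. f s y = (if y \<in> {0..s} then A (s, y) * h y else 0)"
        using gh by eventually_elim (use True x in \<open>auto simp: f_def B_def triangle_def indicator_def\<close>)
    qed simp
    then show ?thesis using True by simp
  qed (auto simp: f_def)
  have inner2: "(\<integral>s. f s y \<partial>lborel) = (if y \<in> {0..x} then (LINT s|lebesgue_on {y..x}. A (s, y)) * g y else 0)" for y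
  proof (cases "y \<in> {0..x}")
    case True
    have "(LINT s|lebesgue_on {y..x}. A (s, y)) = (\<integral>s. indicator {0..x} s * B (s, y) \<partial>lborel)"
    proof (rule lebesgue_on_eq_lborel(3))
      show "(\<lambda>s. indicator {0..x} s * B (s, y)) \<in> borel_measurable borel" by measurable
      show "AE s in lborel. indicator {0..x} s * B (s, y) = (if s \<in> {y..x} then A (s, y) else 0)"
        using True x by (auto simp: B_def triangle_def indicator_def)
    qed simp
    then show ?thesis using True by (simp add: f_def)
  next
    case False
    then have "f s y = 0" for s by (auto simp: f_def B_def triangle_def indicator_def)
    then show ?thesis by (subst if_not_P[OF False]) simp
  qed
  have m1: "(\<lambda>s. \<integral>y. f s y \<partial>lborel) \<in> borel_measurable borel"
    using lborel.borel_measurable_lebesgue_integral[of "f" lborel] fm by simp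
  have i1: "integrable lborel (\<lambda>s. \<integral>y. f s y \<partial>lborel)"
    using lborel_pair.integrable_fst[of f] fi by simp
  show "integrable (lebesgue_on {0..x}) (\<lambda>s. LINT y|lebesgue_on {0..s}. A (s, y) * h y)"
    by (rule lebesgue_on_eq_lborel(2)[OF m1 _ _ i1]) (auto simp: inner1)
  have e1: "(LINT s|lebesgue_on {0..x}. LINT y|lebesgue_on {0..s}. A (s, y) * h y) = (\<integral>s. \<integral>y. f s y \<partial>lborel \<partial>lborel)"
    by (rule lebesgue_on_eq_lborel(3)[OF m1]) (auto simp: inner1)
  have m2: "(\<lambda>y. \<integral>s. f s y \<partial>lborel) \<in> borel_measurable borel"
    using borel_measurable_integrable[OF lborel_pair.integrable_snd[OF fi]] by simp
  have e2: "(LINT y|lebesgue_on {0..x}. (LINT s|lebesgue_on {y..x}. A (s, y)) * h y) = (\<integral>y. \<integral>s. f s y \<partial>lborel \<partial>lborel)"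
  proof (rule lebesgue_on_eq_lborel(3)[OF m2])
    show "AE y in lborel. (\<integral>s. f s y \<partial>lborel) = (if y \<in> {0..x} then (LINT s|lebesgue_on {y..x}. A (s, y)) * h y else 0)"
      using gh by eventually_elim (use x in \<open>auto simp: inner2\<close>)
  qed simp
  show "(LINT s|lebesgue_on {0..x}. LINT y|lebesgue_on {0..s}. A (s, y) * h y)
       = (LINT y|lebesgue_on {0..x}. (LINT s|lebesgue_on {y..x}. A (s, y)) * h y)"
    unfolding e1 e2 using lborel_pair.Fubini_integral[OF fi] by simp
qed

section \<open>Membership in \<open>L2\<close>, primitives, and profiles in
  \<open>H2\<close>\<close>

lemma L2_measurable: "h \<in> L2 \<Longrightarrow> h \<in> borel_measurable unitM"
  by (simp add: L2_def)

lemma integrable_const_unitM: "integrable unitM (\<lambda>x. c::real)"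
  by simp

lemma continuous_on_Icc_bounded:
  fixes f :: "real \<Rightarrow> real"
  assumes "continuous_on {a..b} f"
  obtains C where "\<And>x. x \<in> {a..b} \<Longrightarrow> \<bar>f x\<bar> \<le> C"
proof -
  have "bounded (f ` {a..b})" by (intro compact_imp_bounded compact_continuous_image assms compact_Icc)
  then have "\<exists>C. \<forall>x\<in>{a..b}. \<bar>f x\<bar> \<le> C" unfolding bounded_iff by simp
  then show ?thesis using that by blast
qed

lemma L2_mult_integrable:
  assumes "g \<in> L2" "h \<in> L2"
  shows "integrable unitM (\<lambda>x. g x * h x)"
proof (rule Bochner_Integration.integrable_bound)
  show "integrable unitM (\<lambda>x. (g x)\<^sup>2 + (h x)\<^sup>2)"
    using assms by (intro Bochner_Integration.integrable_add) (auto simp: L2_def)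
  show "(\<lambda>x. g x * h x) \<in> borel_measurable unitM"
    using assms by (intro borel_measurable_times) (auto simp: L2_def)
  have "\<bar>a * b\<bar> \<le> a\<^sup>2 + b\<^sup>2" for a b :: real
  proof -
    have "2 * (\<bar>a\<bar> * \<bar>b\<bar>) \<le> a\<^sup>2 + b\<^sup>2"
      using sum_squares_bound[of "\<bar>a\<bar>" "\<bar>b\<bar>"] by (simp add: mult.assoc)
    moreover have "0 \<le> \<bar>a\<bar> * \<bar>b\<bar>" by simp
    ultimately show ?thesis unfolding abs_mult by linarith
  qed
  then show "AE x in unitM. norm (g x * h x) \<le> norm ((g x)\<^sup>2 + (h x)\<^sup>2)" by simp
qed

lemma L2_I:
  assumes "h \<in> borel_measurable unitM" "\<And>x. x \<in> {0..1} \<Longrightarrow> \<bar>h x\<bar> \<le> C"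
  shows "h \<in> L2"
proof -
  have "integrable unitM (\<lambda>x. (h x)\<^sup>2)"
  proof (rule Bochner_Integration.integrable_bound)
    show "integrable unitM (\<lambda>x. C\<^sup>2)" by (rule integrable_const_unitM)
    show "(\<lambda>x. (h x)\<^sup>2) \<in> borel_measurable unitM" using assms by simp
    show "AE x in unitM. norm ((h x)\<^sup>2) \<le> norm (C\<^sup>2)"
      by (rule AE_I2) (use assms(2) in \<open>auto simp: abs_le_square_iff[symmetric] intro: order_trans[OF _ abs_ge_self]\<close>)
  qed
  then show ?thesis using assms by (simp add: L2_def)
qed

lemma continuous_L2: "continuous_on {0..1} h \<Longrightarrow> h \<in> L2"
proof -
  assume h: "continuous_on {0..1} h"
  obtain C where "\<And>x. x \<in> {0..1} \<Longrightarrow> \<bar>h x\<bar> \<le> C" using continuous_on_Icc_bounded[OF h] by blast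
  moreover have "h \<in> borel_measurable unitM"
    by (rule continuous_imp_measurable_on_sets_lebesgue[OF h]) auto
  ultimately show "h \<in> L2" by (rule L2_I[rotated])
qed

lemma L2_add: "g \<in> L2 \<Longrightarrow> h \<in> L2 \<Longrightarrow> (\<lambda>x. g x + h x) \<in> L2"
proof -
  assume g: "g \<in> L2" and h: "h \<in> L2"
  have "(\<lambda>x. (g x + h x)\<^sup>2) = (\<lambda>x. (g x)\<^sup>2 + 2 * (g x * h x) + (h x)\<^sup>2)"
    by (auto simp: power2_eq_square algebra_simps)
  moreover have "integrable unitM (\<lambda>x. (g x)\<^sup>2 + 2 * (g x * h x) + (h x)\<^sup>2)"
    using L2_mult_integrable[OF g h] g h
    by (intro Bochner_Integration.integrable_add integrable_mult_right) (auto simp: L2_def)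
  ultimately show ?thesis unfolding L2_def
    using borel_measurable_add[OF L2_measurable[OF g] L2_measurable[OF h]] by simp
qed

lemma L2_bounded_mult:
  assumes "a \<in> borel_measurable unitM" "\<And>x. x \<in> {0..1} \<Longrightarrow> \<bar>a x\<bar> \<le> C" "h \<in> L2"
  shows "(\<lambda>x. a x * h x) \<in> L2"
proof -
  have "integrable unitM (\<lambda>x. (a x * h x)\<^sup>2)"
  proof (rule Bochner_Integration.integrable_bound)
    show "integrable unitM (\<lambda>x. C\<^sup>2 * (h x)\<^sup>2)" using assms by (simp add: L2_def)
    show "(\<lambda>x. (a x * h x)\<^sup>2) \<in> borel_measurable unitM"
      by (intro borel_measurable_power borel_measurable_times assms L2_measurable)
    have "(a x)\<^sup>2 \<le> C\<^sup>2" if "x \<in> {0..1}" for x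
      using assms(2)[OF that] by (metis abs_ge_zero abs_le_square_iff abs_of_nonneg order_trans)
    then show "AE x in unitM. norm ((a x * h x)\<^sup>2) \<le> norm (C\<^sup>2 * (h x)\<^sup>2)"
      by (intro AE_I2) (auto simp: power_mult_distrib intro!: mult_right_mono)
  qed
  then show ?thesis unfolding L2_def
    using borel_measurable_times[OF assms(1) L2_measurable[OF assms(3)]] by blast
qed

lemma L2_cmult: "h \<in> L2 \<Longrightarrow> (\<lambda>x. a * h x) \<in> L2"
  by (rule L2_bounded_mult[where C="\<bar>a\<bar>"]) auto

lemma L2_diff: "g \<in> L2 \<Longrightarrow> h \<in> L2 \<Longrightarrow> (\<lambda>x. g x - h x) \<in> L2"
  using L2_add[of g "\<lambda>x. (-1) * h x"] L2_cmult[of h "-1"] by simp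

lemma L2_integrable: "h \<in> L2 \<Longrightarrow> integrable unitM h"
  using L2_mult_integrable[of h "\<lambda>_. 1"] continuous_L2[of "\<lambda>_. 1"] by simp

lemma L2_continuous_mult:
  assumes "continuous_on {0..1} a" "h \<in> L2"
  shows "(\<lambda>x. a x * h x) \<in> L2"
proof -
  obtain C where "\<And>x. x \<in> {0..1} \<Longrightarrow> \<bar>a x\<bar> \<le> C" using continuous_on_Icc_bounded[OF assms(1)] by blast
  moreover have "a \<in> borel_measurable unitM"
    by (rule continuous_imp_measurable_on_sets_lebesgue[OF assms(1)]) auto
  ultimately show ?thesis using L2_bounded_mult assms(2) by blast
qed

lemma integrable_unitM_subset:
  fixes h :: "real \<Rightarrow> real"
  shows "integrable unitM h \<Longrightarrow> x \<in> {0..1} \<Longrightarrow> integrable (lebesgue_on {0..x}) h"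
  using Equivalence_Lebesgue_Henstock_Integration.integrable_subinterval[of 0 1 h 0 x] by simp

lemma integrable_continuous_mult:
  fixes h a :: "real \<Rightarrow> real"
  assumes a: "continuous_on {0..x} a" and h: "integrable unitM h" and x: "x \<in> {0..1}"
  shows "integrable (lebesgue_on {0..x}) (\<lambda>y. a y * h y)"
proof -
  obtain C where C: "\<And>y. y \<in> {0..x} \<Longrightarrow> \<bar>a y\<bar> \<le> C" using continuous_on_Icc_bounded[OF a] by blast
  have i: "integrable (lebesgue_on {0..x}) h" using integrable_unitM_subset[OF h x] .
  show ?thesis
  proof (rule Bochner_Integration.integrable_bound)
    show "integrable (lebesgue_on {0..x}) (\<lambda>y. C * h y)" using i by simp
    have "a \<in> borel_measurable (lebesgue_on {0..x})"
      by (rule continuous_imp_measurable_on_sets_lebesgue[OF a]) auto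
    then show "(\<lambda>y. a y * h y) \<in> borel_measurable (lebesgue_on {0..x})" using i by simp
    show "AE y in lebesgue_on {0..x}. norm (a y * h y) \<le> norm (C * h y)"
    proof (rule AE_I2)
      fix y assume "y \<in> space (lebesgue_on {0..x})"
      then have "\<bar>a y\<bar> \<le> \<bar>C\<bar>" using C[of y] by auto
      then show "norm (a y * h y) \<le> norm (C * h y)" by (simp add: abs_mult mult_right_mono)
    qed
  qed
qed

lemma LINT_continuous_eq_integral:
  fixes f :: "real \<Rightarrow> real"
  assumes "continuous_on {a..b} f"
  shows "integral\<^sup>L (lebesgue_on {a..b}) f = integral {a..b} f"
  using lebesgue_integral_eq_integral[OF continuous_imp_integrable_real[OF assms]] by simp

lemma LINT_FTC:
  fixes g :: "real \<Rightarrow> real"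
  assumes "a \<le> b" "continuous_on {a..b} g'"
    and "\<And>y. y \<in> {a..b} \<Longrightarrow> (g has_real_derivative g' y) (at y within {a..b})"
  shows "(LINT y|lebesgue_on {a..b}. g' y) = g b - g a"
  using LINT_continuous_eq_integral[OF assms(2)]
    integral_unique[OF fundamental_theorem_of_calculus[OF assms(1), of g g']]
    assms(3) by (simp add: has_real_derivative_iff_has_vector_derivative)

lemma LINT_singleton [simp]: "(LINT y|lebesgue_on {a::real}. f y :: real) = 0"
  using LINT_continuous_eq_integral[of a a f] by simp

lemma integral_cong_on:
  fixes f g :: "real \<Rightarrow> real"
  assumes "\<And>y. y \<in> {a..b} \<Longrightarrow> f y = g y"
  shows "(LINT y|lebesgue_on {a..b}. f y) = (LINT y|lebesgue_on {a..b}. g y)"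
  by (rule Bochner_Integration.integral_cong) (use assms in auto)

text \<open>A primitive of an integrable function is continuous; hence \<open>h'\<close> is
  continuous and \<open>h\<close> is differentiable at every point of the interval, one-sidedly at
  the ends.\<close>

lemma H2D:
  assumes "H2 h h' h''"
  shows "continuous_on {0..1} h'" "continuous_on {0..1} h" "h'' \<in> L2"
    "\<And>x. x \<in> {0..1} \<Longrightarrow> (h has_real_derivative h' x) (at x within {0..1})"
    "\<And>x. x \<in> {0..1} \<Longrightarrow> h' x = h' 0 + (LINT s|lebesgue_on {0..x}. h'' s)"
    "\<And>x. x \<in> {0..1} \<Longrightarrow> h x = h 0 + (LINT s|lebesgue_on {0..x}. h' s)"
proof -
  show L: "h'' \<in> L2" and e1: "\<And>x. x \<in> {0..1} \<Longrightarrow> h' x = h' 0 + (LINT s|lebesgue_on {0..x}. h'' s)"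
    and e0: "\<And>x. x \<in> {0..1} \<Longrightarrow> h x = h 0 + (LINT s|lebesgue_on {0..x}. h' s)"
    using assms unfolding H2_def by blast+
  have "continuous_on {0..1} (\<lambda>x. h' 0 + (LINT s|lebesgue_on {0..x}. h'' s))"
    by (intro continuous_intros indefinite_integral_continuous_real L2_integrable L)
  then show c: "continuous_on {0..1} h'"
    by (subst continuous_on_cong[OF refl e1])
  show d: "(h has_real_derivative h' x) (at x within {0..1})" if x: "x \<in> {0..1}" for x
  proof -
    have "((\<lambda>x. h 0 + integral {0..x} h') has_real_derivative h' x) (at x within {0..1})"
      using integral_has_real_derivative[OF c x] by (auto intro!: derivative_eq_intros)
    moreover have "h 0 + integral {0..z} h' = h z" if "z \<in> {0..1}" for z
      
    proof -
      have "continuous_on {0..z} h'" by (rule continuous_on_subset[OF c]) (use that in auto)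
      then show ?thesis using e0[OF that] LINT_continuous_eq_integral[of 0 z h'] by argo
    qed
    ultimately show ?thesis
      by (rule has_field_derivative_transform_within[where d=1, OF _ zero_less_one x]) assumption
  qed
  show "continuous_on {0..1} h"
    using d by (meson DERIV_continuous continuous_on_eq_continuous_within)
qed

text \<open>By Fubini on a triangle, since \<open>v\<close> is only absolutely continuous.\<close>

lemma LINT_by_parts:
  fixes g v :: "real \<Rightarrow> real"
  assumes x: "x \<in> {0..1}" and g': "continuous_on {0..x} g'"
    and g: "\<And>y. y \<in> {0..x} \<Longrightarrow> (g has_real_derivative g' y) (at y within {0..x})"
    and v': "integrable unitM v'"
    and v: "\<And>y. y \<in> {0..1} \<Longrightarrow> v y = v 0 + (LINT s|lebesgue_on {0..y}. v' s)"
  shows "(LINT y|lebesgue_on {0..x}. g y * v' y)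
       = g x * v x - g 0 * v 0 - (LINT y|lebesgue_on {0..x}. g' y * v y)"
proof -
  \<comment> \<open>The kernel is \<open>g'\<close> of the outer variable. The \<open>min\<close>
    only makes it continuous on the whole triangle, as \<open>g'\<close> is controlled on
    \<open>{0..x}\<close> alone; the two orders of integration then give the two sides.\<close>
  define A where "A = (\<lambda>p::real \<times> real. g' (min (fst p) x))"
  have A: "continuous_on triangle A"
    unfolding A_def by (rule continuous_on_compose2[OF g']) (use x in \<open>auto intro!: continuous_intros simp: triangle_def\<close>)
  have gc: "continuous_on {0..x} g"
    using g by (meson DERIV_continuous continuous_on_eq_continuous_within)
  have vc: "continuous_on {0..1} v"
  proof -
    have "continuous_on {0..1} (\<lambda>x. v 0 + (LINT s|lebesgue_on {0..x}. v' s))"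
      by (intro continuous_intros indefinite_integral_continuous_real v')
    then show ?thesis by (subst continuous_on_cong[OF refl v])
  qed
  have i1: "integrable (lebesgue_on {0..x}) (\<lambda>y. g y * v' y)"
    by (rule integrable_continuous_mult[OF gc v' x])
  have i2: "integrable (lebesgue_on {0..x}) v'" by (rule integrable_unitM_subset[OF v' x])
  have vx: "(LINT s|lebesgue_on {0..x}. v' s) = v x - v 0" using v[OF x] by linarith
  have ftc: "(LINT s|lebesgue_on {y..x}. g' s) = g x - g y" if "y \<in> {0..x}" for y
    by (rule LINT_FTC) (use that in \<open>auto intro: continuous_on_subset[OF g'] DERIV_subset[OF g]\<close>)
  have "(LINT y|lebesgue_on {0..x}. (LINT s|lebesgue_on {y..x}. A (s, y)) * v' y)
      = (LINT y|lebesgue_on {0..x}. g x * v' y - g y * v' y)"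
  proof (rule integral_cong_on)
    fix y assume y: "y \<in> {0..x}"
    have "(LINT s|lebesgue_on {y..x}. A (s, y)) = (LINT s|lebesgue_on {y..x}. g' s)"
      by (rule integral_cong_on) (auto simp: A_def)
    then show "(LINT s|lebesgue_on {y..x}. A (s, y)) * v' y = g x * v' y - g y * v' y"
      by (simp only: ftc[OF y] left_diff_distrib)
  qed
  also have "\<dots> = g x * (v x - v 0) - (LINT y|lebesgue_on {0..x}. g y * v' y)"
    using i1 i2 by (simp add: vx)
  finally have e1: "(LINT y|lebesgue_on {0..x}. (LINT s|lebesgue_on {y..x}. A (s, y)) * v' y) = \<dots>" .
  have "(LINT s|lebesgue_on {0..x}. LINT y|lebesgue_on {0..s}. A (s, y) * v' y)
      = (LINT s|lebesgue_on {0..x}. g' s * v s - v 0 * g' s)"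
  proof (rule integral_cong_on)
    fix s assume s: "s \<in> {0..x}"
    then have s1: "s \<in> {0..1}" using x by auto
    have "(LINT y|lebesgue_on {0..s}. A (s, y) * v' y) = g' s * (LINT y|lebesgue_on {0..s}. v' y)"
      using s by (simp add: A_def)
    also have "\<dots> = g' s * (v s - v 0)"
    proof -
      have "(LINT y|lebesgue_on {0..s}. v' y) = v s - v 0" using v[OF s1] by linarith
      then show ?thesis by simp
    qed
    finally show "(LINT y|lebesgue_on {0..s}. A (s, y) * v' y) = g' s * v s - v 0 * g' s"
      by (simp add: algebra_simps)
  qed
  also have "\<dots> = (LINT y|lebesgue_on {0..x}. g' y * v y) - v 0 * (g x - g 0)"
  proof -
    have "integrable (lebesgue_on {0..x}) (\<lambda>s. g' s * v s)"
      by (intro continuous_imp_integrable_real continuous_intros g' continuous_on_subset[OF vc]) (use x in auto)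
    moreover have "integrable (lebesgue_on {0..x}) g'" by (rule continuous_imp_integrable_real[OF g'])
    ultimately show ?thesis using ftc[of 0] x by simp
  qed
  finally have e2: "(LINT s|lebesgue_on {0..x}. LINT y|lebesgue_on {0..s}. A (s, y) * v' y) = \<dots>" .
  show ?thesis using triangle_Fubini(2)[OF A v' x] e1 e2 by (simp add: algebra_simps)
qed

section \<open>Differentiation along curves in the triangle and of Volterra integrals\<close>

lemma C1_triangleD:
  assumes "C1_triangle F Fx Fy"
  shows "continuous_on triangle Fx" "continuous_on triangle Fy" "continuous_on triangle F"
    "\<And>p. p \<in> triangle \<Longrightarrow> (F has_derivative (\<lambda>(h, k). Fx p * h + Fy p * k)) (at p within triangle)"
proof -
  show "continuous_on triangle Fx" "continuous_on triangle Fy"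
    and d: "\<And>p. p \<in> triangle \<Longrightarrow> (F has_derivative (\<lambda>(h, k). Fx p * h + Fy p * k)) (at p within triangle)"
    using assms by (auto simp: C1_triangle_def)
  show "continuous_on triangle F"
    using d by (meson has_derivative_continuous continuous_on_eq_continuous_within)
qed

text \<open>Derivatives are taken within the parameter set, so one statement serves coordinate
  lines, the diagonal and characteristics, including their end points on the boundary of the
  triangle.\<close>

lemma C1_triangle_curve:
  fixes \<alpha> \<beta> :: "real \<Rightarrow> real"
  assumes F: "C1_triangle F Fx Fy"
    and S: "\<And>s. s \<in> S \<Longrightarrow> 0 \<le> \<beta> s \<and> \<beta> s \<le> \<alpha> s \<and> \<alpha> s \<le> 1"
    and s: "s \<in> S"
    and \<alpha>: "(\<alpha> has_real_derivative a) (at s within S)" and \<beta>: "(\<beta> has_real_derivative b) (at s within S)"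
  shows "((\<lambda>s. F (\<alpha> s, \<beta> s)) has_real_derivative Fx (\<alpha> s, \<beta> s) * a + Fy (\<alpha> s, \<beta> s) * b) (at s within S)"
proof -
  have "((\<lambda>s. (\<alpha> s, \<beta> s)) has_derivative (\<lambda>h. (a * h, b * h))) (at s within S)"
    using \<alpha> \<beta> unfolding has_field_derivative_def by (intro has_derivative_Pair)
  moreover have "(F has_derivative (\<lambda>(h, k). Fx (\<alpha> s, \<beta> s) * h + Fy (\<alpha> s, \<beta> s) * k))
      (at (\<alpha> s, \<beta> s) within (\<lambda>s. (\<alpha> s, \<beta> s)) ` S)"
    by (rule has_derivative_subset[OF C1_triangleD(4)[OF F]]) (use S s in \<open>auto simp: triangle_def\<close>)
  ultimately have "((\<lambda>s. F (\<alpha> s, \<beta> s)) has_derivative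
      (\<lambda>h. (\<lambda>(h, k). Fx (\<alpha> s, \<beta> s) * h + Fy (\<alpha> s, \<beta> s) * k) (a * h, b * h))) (at s within S)"
    by (rule has_derivative_in_compose)
  moreover have "(\<lambda>h. (\<lambda>(h, k). Fx (\<alpha> s, \<beta> s) * h + Fy (\<alpha> s, \<beta> s) * k) (a * h, b * h))
      = (*) (Fx (\<alpha> s, \<beta> s) * a + Fy (\<alpha> s, \<beta> s) * b)"
    by (auto simp: algebra_simps)
  ultimately show ?thesis unfolding has_field_derivative_def by simp
qed

lemma continuous_on_triangle_curve:
  assumes "continuous_on triangle F" "continuous_on S \<alpha>" "continuous_on S \<beta>"
    and "\<And>s. s \<in> S \<Longrightarrow> 0 \<le> \<beta> s \<and> \<beta> s \<le> \<alpha> s \<and> \<alpha> s \<le> 1"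
  shows "continuous_on S (\<lambda>s. F (\<alpha> s, \<beta> s))"
  by (rule continuous_on_compose2[OF assms(1)]) (use assms in \<open>auto intro!: continuous_intros simp: triangle_def\<close>)

text \<open>Leibniz's rule in integrated form, since \<open>h\<close> is too rough for a derivative
  at every point: write \<open>F (x, y)\<close> as its diagonal value plus the integral of
  \<open>Fx\<close> over \<open>{y..x}\<close> and exchange the integrals.\<close>

lemma Volterra_Leibniz:
  assumes F: "C1_triangle F Fx Fy" and h: "integrable unitM h" and x: "x \<in> {0..1}"
  shows "(LINT y|lebesgue_on {0..x}. F (x, y) * h y)
       = (LINT s|lebesgue_on {0..x}. F (s, s) * h s + (LINT y|lebesgue_on {0..s}. Fx (s, y) * h y))"
    and "integrable (lebesgue_on {0..x}) (\<lambda>s. F (s, s) * h s)"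
    and "integrable (lebesgue_on {0..x}) (\<lambda>s. LINT y|lebesgue_on {0..s}. Fx (s, y) * h y)"
proof -
  note FD = C1_triangleD[OF F]
  show i1: "integrable (lebesgue_on {0..x}) (\<lambda>s. F (s, s) * h s)"
    by (rule integrable_continuous_mult[OF _ h x], rule continuous_on_triangle_curve[OF FD(3)])
      (use x in \<open>auto intro!: continuous_intros\<close>)
  show i2: "integrable (lebesgue_on {0..x}) (\<lambda>s. LINT y|lebesgue_on {0..s}. Fx (s, y) * h y)"
    by (rule triangle_Fubini(1)[OF FD(1) h x])
  have i3: "integrable (lebesgue_on {0..x}) (\<lambda>y. F (x, y) * h y)"
    by (rule integrable_continuous_mult[OF _ h x], rule continuous_on_triangle_curve[OF FD(3)])
      (use x in \<open>auto intro!: continuous_intros\<close>)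
  have "(LINT y|lebesgue_on {0..x}. (LINT s|lebesgue_on {y..x}. Fx (s, y)) * h y)
      = (LINT y|lebesgue_on {0..x}. F (x, y) * h y - F (y, y) * h y)"
  proof (rule integral_cong_on)
    fix y assume y: "y \<in> {0..x}"
    have "(LINT s|lebesgue_on {y..x}. Fx (s, y)) = F (x, y) - F (y, y)"
    proof (rule LINT_FTC)
      show "continuous_on {y..x} (\<lambda>s. Fx (s, y))"
        by (rule continuous_on_triangle_curve[OF FD(1)]) (use x y in \<open>auto intro!: continuous_intros\<close>)
      show "((\<lambda>s. F (s, y)) has_real_derivative Fx (s, y)) (at s within {y..x})" if "s \<in> {y..x}" for s
        using C1_triangle_curve[OF F, of "{y..x}" "\<lambda>_. y" "\<lambda>s. s" s 1 0] x y that by (auto intro: derivative_eq_intros)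
    qed (use y in auto)
    then show "(LINT s|lebesgue_on {y..x}. Fx (s, y)) * h y = F (x, y) * h y - F (y, y) * h y"
      by (simp only: left_diff_distrib)
  qed
  also have "\<dots> = (LINT y|lebesgue_on {0..x}. F (x, y) * h y) - (LINT y|lebesgue_on {0..x}. F (y, y) * h y)"
    using i1 i3 by simp
  finally show "(LINT y|lebesgue_on {0..x}. F (x, y) * h y)
       = (LINT s|lebesgue_on {0..x}. F (s, s) * h s + (LINT y|lebesgue_on {0..s}. Fx (s, y) * h y))"
    using triangle_Fubini(2)[OF FD(1) h x] i1 i2 by simp
qed

lemma Volterra_integrable:
  fixes K :: "real \<times> real \<Rightarrow> real" and h :: "real \<Rightarrow> real"
  assumes K: "continuous_on triangle K" and h: "integrable unitM h" and x: "x \<in> {0..1}"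
  shows "integrable (lebesgue_on {0..x}) (\<lambda>y. K (x, y) * h y)"
  by (rule integrable_continuous_mult[OF _ h x], rule continuous_on_triangle_curve[OF K])
    (use x in \<open>auto intro!: continuous_intros\<close>)

lemma AE_unitM_subset:
  assumes "AE y in unitM. P y" "x \<in> {0..1}"
  shows "AE y in lebesgue_on {0..x}. P y"
proof -
  have "AE y in lebesgue. y \<in> {0..1} \<longrightarrow> P y"
    using assms(1) by (simp add: AE_restrict_space_iff)
  then have "AE y in lebesgue. y \<in> {0..x} \<longrightarrow> P y"
    by eventually_elim (use assms(2) in auto)
  then show ?thesis by (simp add: AE_restrict_space_iff)
qed

section \<open>The backstepping transform\<close>

lemma backstep_cong_AE:
  assumes K: "continuous_on triangle K" and g: "integrable unitM g" and h: "integrable unitM h"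
    and ae: "AE y in unitM. g y = h y"
  shows "AE x in unitM. backstep K g x = backstep K h x"
proof -
  have eq: "(LINT y|lebesgue_on {0..x}. K (x, y) * g y) = (LINT y|lebesgue_on {0..x}. K (x, y) * h y)"
    if x: "x \<in> {0..1}" for x
    using AE_unitM_subset[OF ae x]
    by (intro integral_cong_AE borel_measurable_integrable Volterra_integrable K g h x)
      (auto elim: eventually_mono)
  show ?thesis
    unfolding backstep_def using ae AE_space[of unitM] by eventually_elim (simp add: eq)
qed

lemma backstep_linear:
  assumes K: "continuous_on triangle K" and g: "integrable unitM g" and h: "integrable unitM h"
    and x: "x \<in> {0..1}"
  shows "backstep K (\<lambda>y. r * g y + s * h y) x = r * backstep K g x + s * backstep K h x"
proof -
  have "(LINT y|lebesgue_on {0..x}. K (x, y) * (r * g y + s * h y))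
      = (LINT y|lebesgue_on {0..x}. r * (K (x, y) * g y) + s * (K (x, y) * h y))"
    by (rule integral_cong_on) (simp add: algebra_simps)
  also have "\<dots> = r * (LINT y|lebesgue_on {0..x}. K (x, y) * g y) + s * (LINT y|lebesgue_on {0..x}. K (x, y) * h y)"
    using Volterra_integrable[OF K g x] Volterra_integrable[OF K h x] by simp
  finally show ?thesis by (simp add: backstep_def algebra_simps)
qed

lemma Volterra_abs_le:
  fixes K :: "real \<times> real \<Rightarrow> real" and h :: "real \<Rightarrow> real"
  assumes K: "continuous_on triangle K" and h: "integrable unitM h" and x: "x \<in> {0..1}"
    and C: "\<And>y. y \<in> {0..x} \<Longrightarrow> \<bar>K (x, y)\<bar> \<le> C"
  shows "\<bar>LINT y|lebesgue_on {0..x}. K (x, y) * h y\<bar> \<le> C * (LINT y|lebesgue_on {0..x}. \<bar>h y\<bar>)"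
proof -
  have i: "integrable (lebesgue_on {0..x}) (\<lambda>y. \<bar>h y\<bar>)"
    using integrable_unitM_subset[OF h x] by simp
  have "\<bar>LINT y|lebesgue_on {0..x}. K (x, y) * h y\<bar> \<le> (LINT y|lebesgue_on {0..x}. \<bar>K (x, y) * h y\<bar>)"
    by (rule integral_abs_bound)
  also have "\<dots> \<le> (LINT y|lebesgue_on {0..x}. C * \<bar>h y\<bar>)"
  proof (rule integral_mono)
    show "integrable (lebesgue_on {0..x}) (\<lambda>y. \<bar>K (x, y) * h y\<bar>)"
      using Volterra_integrable[OF K h x] by simp
    show "integrable (lebesgue_on {0..x}) (\<lambda>y. C * \<bar>h y\<bar>)" using i by simp
    show "\<bar>K (x, y) * h y\<bar> \<le> C * \<bar>h y\<bar>" if "y \<in> space (lebesgue_on {0..x})" for y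
      using C[of y] that by (simp add: abs_mult mult_right_mono)
  qed
  finally show ?thesis by simp
qed

lemma backstep_L2:
  assumes K: "continuous_on triangle K" and h: "h \<in> L2"
  shows "backstep K h \<in> L2"
proof -
  have hi: "integrable unitM h" by (rule L2_integrable[OF h])
  obtain C where C: "C > 0" "\<And>x y. 0 \<le> y \<Longrightarrow> y \<le> x \<Longrightarrow> x \<le> 1 \<Longrightarrow> \<bar>K (x, y)\<bar> \<le> C"
    using continuous_on_triangle_bounded[OF K] by blast
  have "(\<lambda>x. LINT y|lebesgue_on {0..x}. K (x, y) * h y) \<in> L2"
  proof (rule L2_I)
    show "(\<lambda>x. LINT y|lebesgue_on {0..x}. K (x, y) * h y) \<in> borel_measurable unitM"
      using triangle_Fubini(1)[OF K hi, of 1] by (intro borel_measurable_integrable) simp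
    show "\<bar>LINT y|lebesgue_on {0..x}. K (x, y) * h y\<bar> \<le> C * (LINT y|unitM. \<bar>h y\<bar>)" if x: "x \<in> {0..1}" for x
    proof -
      have "\<bar>LINT y|lebesgue_on {0..x}. K (x, y) * h y\<bar> \<le> C * (LINT y|lebesgue_on {0..x}. \<bar>h y\<bar>)"
        by (rule Volterra_abs_le[OF K hi x]) (use C x in auto)
      also have "(LINT y|lebesgue_on {0..x}. \<bar>h y\<bar>) \<le> (LINT y|unitM. \<bar>h y\<bar>)"
        by (rule integral_mono_lebesgue_on_AE)
          (use hi x in auto)
      finally show ?thesis using C(1) by simp
    qed
  qed
  then show ?thesis unfolding backstep_def using L2_diff[OF h] by simp
qed

locale backstepping =
  fixes \<epsilon> c :: real and q :: ereal and b :: "real \<Rightarrow> real"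
    and K Kx Ky Kxx Kxy Kyx Kyy :: "real \<times> real \<Rightarrow> real"
  assumes eps: "\<epsilon> > 0"
    and b: "continuous_on {0..1} b"
    and K: "C1_triangle K Kx Ky" and Kx: "C1_triangle Kx Kxx Kxy" and Ky: "C1_triangle Ky Kyx Kyy"
    and pde: "\<And>x y. (x, y) \<in> triangle \<Longrightarrow> Kxx (x, y) - Kyy (x, y) = (b y + c) / \<epsilon> * K (x, y)"
    and bc: "\<And>x. x \<in> {0..1} \<Longrightarrow> left_bc q (K (x, 0)) (Ky (x, 0))"
    and diag: "\<And>x. x \<in> {0..1} \<Longrightarrow> K (x, x) = - 1 / (2 * \<epsilon>) * (LINT s|lebesgue_on {0..x}. b s + c)"

lemma kernel_backstepping:
  assumes "kernel \<epsilon> q c b K Kx" "\<epsilon> > 0" "continuous_on {0..1} b"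
  obtains Ky Kxx Kxy Kyx Kyy where "backstepping \<epsilon> c q b K Kx Ky Kxx Kxy Kyx Kyy"
proof -
  obtain Ky Kxx Kxy Kyx Kyy where k: "C1_triangle K Kx Ky" "C1_triangle Kx Kxx Kxy" "C1_triangle Ky Kyx Kyy"
     "\<forall>(x, y)\<in>triangle. Kxx (x, y) - Kyy (x, y) = (b y + c) / \<epsilon> * K (x, y)"
     "\<forall>x\<in>{0..1}. left_bc q (K (x, 0)) (Ky (x, 0))"
     "\<forall>x\<in>{0..1}. K (x, x) = - 1 / (2 * \<epsilon>) * (LINT s|lebesgue_on {0..x}. b s + c)"
    using assms(1) unfolding kernel_def by blast
  have "backstepping \<epsilon> c q b K Kx Ky Kxx Kxy Kyx Kyy"
    by unfold_locales (use k assms in auto)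
  then show ?thesis by (rule that)
qed

context backstepping
begin

definition B :: "real \<Rightarrow> real" where "B y = (b y + c) / \<epsilon>"

lemma B_cont: "continuous_on {0..1} B"
  unfolding B_def by (intro continuous_intros b) (use eps in auto)

lemmas KD = C1_triangleD[OF K] and KxD = C1_triangleD[OF Kx] and KyD = C1_triangleD[OF Ky]

lemma diag_deriv:
  assumes s: "s \<in> {0..1}"
  shows "((\<lambda>s. K (s, s)) has_real_derivative (- B s / 2)) (at s within {0..1})"
proof -
  have bc: "continuous_on {0..1} (\<lambda>s. b s + c)" by (intro continuous_intros b)
  have "((\<lambda>x. - 1 / (2 * \<epsilon>) * integral {0..x} (\<lambda>s. b s + c)) has_real_derivative - 1 / (2 * \<epsilon>) * (b s + c)) (at s within {0..1})"
    using integral_has_real_derivative[OF bc s] by (rule DERIV_cmult)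
  moreover have "- 1 / (2 * \<epsilon>) * integral {0..x} (\<lambda>s. b s + c) = K (x, x)" if "x \<in> {0..1}" for x
    using diag[OF that] LINT_continuous_eq_integral[OF continuous_on_subset[OF bc], of 0 x] that by simp
  ultimately have "((\<lambda>s. K (s, s)) has_real_derivative - 1 / (2 * \<epsilon>) * (b s + c)) (at s within {0..1})"
    by (rule has_field_derivative_transform_within[where d=1, OF _ zero_less_one s])
  then show ?thesis by (simp add: B_def field_simps)
qed

text \<open>The diagonal condition differentiated along the diagonal. It cancels boundary terms in
  the intertwining relation and is the starting value on characteristics in
  \<open>kernel_bound\<close>.\<close>

lemma diag_sum:
  assumes s: "s \<in> {0..1}"
  shows "Kx (s, s) + Ky (s, s) = - B s / 2"
proof -
  have "((\<lambda>s. K (s, s)) has_real_derivative (Kx (s, s) * 1 + Ky (s, s) * 1)) (at s within {0..1})"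
    by (rule C1_triangle_curve[OF K _ s]) (auto intro!: derivative_eq_intros)
  then show ?thesis
    using vector_derivative_unique_within_closed_interval[of 0 1 s "\<lambda>s. K (s, s)" "- B s / 2" "Kx (s, s) + Ky (s, s)"]
      diag_deriv[OF s] s by (simp add: has_real_derivative_iff_has_vector_derivative)
qed

lemma diag_0: "K (0, 0) = 0"
  using diag[of 0] by simp

text \<open>The kernel equations are made for this relation: the transform carries
  \<open>u'' + B u\<close> to the second derivative of the transform of \<open>u\<close>. Two
  integrations by parts move the derivatives of \<open>u\<close> onto the kernel; the wave equation
  of the kernel then matches the integrals, \<open>diag_sum\<close> the terms on the diagonal, and
  the two conditions at \<open>0\<close> remove the terms at \<open>y = 0\<close>.\<close>

theorem backstep_intertwines:
  assumes u: "H2 u u' u''" and lbc: "left_bc q (u 0) (u' 0)"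
  defines "w \<equiv> backstep K u"
    and "w' \<equiv> \<lambda>x. u' x - K (x, x) * u x - (LINT y|lebesgue_on {0..x}. Kx (x, y) * u y)"
    and "w'' \<equiv> backstep K (\<lambda>y. u'' y + B y * u y)"
  shows "H2 w w' w''" "w 0 = u 0" "w' 0 = u' 0"
proof -
  note uD = H2D[OF u]
  show w0: "w 0 = u 0" by (simp add: w_def backstep_def)
  show w'0: "w' 0 = u' 0" by (simp add: w'_def diag_0)
  have ui: "integrable unitM u" by (rule continuous_imp_integrable_real[OF uD(2)])
  have u'i: "integrable unitM u'" by (rule continuous_imp_integrable_real[OF uD(1)])
  have u''i: "integrable unitM u''" by (rule L2_integrable[OF uD(3)])
  have BuL: "(\<lambda>y. B y * u y) \<in> L2" by (rule L2_continuous_mult[OF B_cont continuous_L2[OF uD(2)]])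
  have Bui: "integrable unitM (\<lambda>y. B y * u y)" by (rule L2_integrable[OF BuL])
  have w''L: "w'' \<in> L2"
    unfolding w''_def by (rule backstep_L2[OF KD(3) L2_add[OF uD(3) BuL]])
  have e1: "w x = w 0 + (LINT s|lebesgue_on {0..x}. w' s)" if x: "x \<in> {0..1}" for x
  proof -
    note V = Volterra_Leibniz[OF K ui x]
    have "(LINT s|lebesgue_on {0..x}. w' s)
        = (LINT s|lebesgue_on {0..x}. u' s - (K (s, s) * u s + (LINT y|lebesgue_on {0..s}. Kx (s, y) * u y)))"
      by (rule integral_cong_on) (simp add: w'_def)
    also have "\<dots> = (LINT s|lebesgue_on {0..x}. u' s) - (LINT s|lebesgue_on {0..x}. K (s, s) * u s + (LINT y|lebesgue_on {0..s}. Kx (s, y) * u y))"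
      using V(2,3) integrable_unitM_subset[OF u'i x] by (intro Bochner_Integration.integral_diff Bochner_Integration.integrable_add)
    also have "\<dots> = w x - u 0"
      using uD(6)[OF x] unfolding w_def backstep_def V(1) by linarith
    finally show ?thesis using w0 by simp
  qed
  \<comment> \<open>The left side is the formal derivative of \<open>w'\<close>; its term
    \<open>B s / 2\<close> comes from the derivative of \<open>K (s, s)\<close>.\<close>
  have key: "u'' s + B s / 2 * u s - K (s, s) * u' s - Kx (s, s) * u s - (LINT y|lebesgue_on {0..s}. Kxx (s, y) * u y) = w'' s"
    if s: "s \<in> {0..1}" for s
  proof -
    have c: "continuous_on {0..s} (\<lambda>y. F (s, y))" if "continuous_on triangle F" for F :: "real \<times> real \<Rightarrow> real"
      by (rule continuous_on_triangle_curve[OF that]) (use s in \<open>auto intro!: continuous_intros\<close>)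
    have d: "((\<lambda>y. F (s, y)) has_real_derivative Fy (s, y)) (at y within {0..s})"
      if "C1_triangle F Fx Fy" "y \<in> {0..s}" for F Fx Fy :: "real \<times> real \<Rightarrow> real" and y
      using C1_triangle_curve[OF that(1), of "{0..s}" "\<lambda>y. y" "\<lambda>_. s" y 0 1] s that(2) by (auto intro: derivative_eq_intros)
    have p1: "(LINT y|lebesgue_on {0..s}. K (s, y) * u'' y)
       = K (s, s) * u' s - K (s, 0) * u' 0 - (LINT y|lebesgue_on {0..s}. Ky (s, y) * u' y)"
      by (rule LINT_by_parts[OF s c[OF KD(2)] d[OF K] u''i uD(5)])
    have p2: "(LINT y|lebesgue_on {0..s}. Ky (s, y) * u' y)
       = Ky (s, s) * u s - Ky (s, 0) * u 0 - (LINT y|lebesgue_on {0..s}. Kyy (s, y) * u y)"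
      by (rule LINT_by_parts[OF s c[OF KyD(2)] d[OF Ky] u'i uD(6)])
    \<comment> \<open>For \<open>q = \<infinity>\<close> both sides vanish, because
      \<open>K (s, 0)\<close> and \<open>u 0\<close> do; otherwise both equal
      \<open>q * K (s, 0) * u 0\<close>.\<close>
    have p3: "K (s, 0) * u' 0 = Ky (s, 0) * u 0"
      using bc[OF s] lbc by (auto simp: left_bc_def split: if_splits)
    have "(LINT y|lebesgue_on {0..s}. K (s, y) * (u'' y + B y * u y))
        = (LINT y|lebesgue_on {0..s}. K (s, y) * u'' y + (Kxx (s, y) * u y - Kyy (s, y) * u y))"
    proof (rule integral_cong_on)
      fix y assume "y \<in> {0..s}"
      then have "Kxx (s, y) - Kyy (s, y) = B y * K (s, y)"
        using pde[of s y] s by (auto simp: B_def triangle_def)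
      then have "B y * K (s, y) * u y = (Kxx (s, y) - Kyy (s, y)) * u y" by simp
      then show "K (s, y) * (u'' y + B y * u y) = K (s, y) * u'' y + (Kxx (s, y) * u y - Kyy (s, y) * u y)"
        by (simp add: algebra_simps)
    qed
    also have "\<dots> = (LINT y|lebesgue_on {0..s}. K (s, y) * u'' y) +
       ((LINT y|lebesgue_on {0..s}. Kxx (s, y) * u y) - (LINT y|lebesgue_on {0..s}. Kyy (s, y) * u y))"
      using Volterra_integrable[OF KD(3) u''i s] Volterra_integrable[OF KxD(1) ui s] Volterra_integrable[OF KyD(2) ui s]
      by simp
    finally have p4: "(LINT y|lebesgue_on {0..s}. K (s, y) * (u'' y + B y * u y)) = \<dots>" .
    have "B s / 2 * u s - Kx (s, s) * u s = (B s + Ky (s, s)) * u s"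
    proof -
      have "B s / 2 - Kx (s, s) = B s + Ky (s, s)" using diag_sum[OF s] by linarith
      then show ?thesis by (metis left_diff_distrib)
    qed
    then show ?thesis
      unfolding w''_def backstep_def p4 p1 p2 p3 by (simp add: algebra_simps)
  qed
  have e2: "w' x = w' 0 + (LINT s|lebesgue_on {0..x}. w'' s)" if x: "x \<in> {0..1}" for x
  proof -
    note V = Volterra_Leibniz[OF Kx ui x]
    have sub: "{0..x} \<subseteq> {0..1}" using x by auto
    have cK: "continuous_on {0..x} (\<lambda>s. F (s, s))" if "continuous_on triangle F" for F :: "real \<times> real \<Rightarrow> real"
      by (rule continuous_on_triangle_curve[OF that]) (use x in \<open>auto intro!: continuous_intros\<close>)
    \<comment> \<open>The product of the diagonal value with \<open>u\<close> is continuously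
      differentiable and is integrated classically; only the Volterra term needs
      \<open>Volterra_Leibniz\<close>, now for \<open>Kx\<close>.\<close>
    have cd: "continuous_on {0..x} (\<lambda>s. - B s / 2 * u s + K (s, s) * u' s)"
      by (intro continuous_intros cK KD(3) continuous_on_subset[OF B_cont sub]
          continuous_on_subset[OF uD(1) sub] continuous_on_subset[OF uD(2) sub]) auto
    have d: "(LINT s|lebesgue_on {0..x}. - B s / 2 * u s + K (s, s) * u' s) = K (x, x) * u x - K (0, 0) * u 0"
    proof (rule LINT_FTC[OF _ cd])
      fix s assume s: "s \<in> {0..x}"
      have "((\<lambda>s. K (s, s) * u s) has_real_derivative - B s / 2 * u s + u' s * K (s, s)) (at s within {0..1})"
        using DERIV_mult[OF diag_deriv uD(4)] s x by simp
      then show "((\<lambda>s. K (s, s) * u s) has_real_derivative - B s / 2 * u s + K (s, s) * u' s) (at s within {0..x})"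
        using DERIV_subset[OF _ sub] by (simp add: mult.commute)
    qed (use x in auto)
    have i0: "integrable (lebesgue_on {0..x}) (\<lambda>s. - B s / 2 * u s + K (s, s) * u' s)"
      by (rule continuous_imp_integrable_real[OF cd])
    have "(LINT s|lebesgue_on {0..x}. w'' s) = (LINT s|lebesgue_on {0..x}.
        u'' s - (- B s / 2 * u s + K (s, s) * u' s) - (Kx (s, s) * u s + (LINT y|lebesgue_on {0..s}. Kxx (s, y) * u y)))"
    proof (rule integral_cong_on)
      fix s assume "s \<in> {0..x}"
      then have "s \<in> {0..1}" using x by auto
      from key[OF this, symmetric]
      show "w'' s = u'' s - (- B s / 2 * u s + K (s, s) * u' s) - (Kx (s, s) * u s + (LINT y|lebesgue_on {0..s}. Kxx (s, y) * u y))"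
        by linarith
    qed
    also have "\<dots> = (LINT s|lebesgue_on {0..x}. u'' s) - (LINT s|lebesgue_on {0..x}. - B s / 2 * u s + K (s, s) * u' s)
        - (LINT s|lebesgue_on {0..x}. Kx (s, s) * u s + (LINT y|lebesgue_on {0..s}. Kxx (s, y) * u y))"
      using i0 V(2,3) integrable_unitM_subset[OF u''i x]
      by (simp only: Bochner_Integration.integral_diff Bochner_Integration.integrable_diff Bochner_Integration.integrable_add)
    also have "\<dots> = w' x - u' 0"
      using uD(5)[OF x] unfolding w'_def V(1) d diag_0 by linarith
    finally show ?thesis using w'0 by linarith
  qed
  show "H2 w w' w''"
    unfolding H2_def using w''L e1 e2 by blast
qed

end

section \<open>Coercivity from positive supersolutions\<close>

lemma H2_classical:
  assumes "\<And>x. x \<in> {0..1} \<Longrightarrow> (h has_real_derivative h' x) (at x within {0..1})"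
    and "\<And>x. x \<in> {0..1} \<Longrightarrow> (h' has_real_derivative h'' x) (at x within {0..1})"
    and "continuous_on {0..1} h''"
  shows "H2 h h' h''"
proof -
  have c: "continuous_on {0..1} h'"
    using assms(2) by (meson DERIV_continuous continuous_on_eq_continuous_within)
  have "(LINT s|lebesgue_on {0..x}. h'' s) = h' x - h' 0" if "x \<in> {0..1}" for x
    by (rule LINT_FTC) (use that in \<open>auto intro!: continuous_on_subset[OF assms(3)] DERIV_subset[OF assms(2)]\<close>)
  moreover have "(LINT s|lebesgue_on {0..x}. h' s) = h x - h 0" if "x \<in> {0..1}" for x
    by (rule LINT_FTC) (use that in \<open>auto intro!: continuous_on_subset[OF c] DERIV_subset[OF assms(1)]\<close>)
  ultimately show ?thesis
    unfolding H2_def using continuous_L2[OF assms(3)] by auto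
qed

definition right_bc :: "actuation \<Rightarrow> real \<Rightarrow> real \<Rightarrow> bool" where
  "right_bc act a a' \<longleftrightarrow> (case act of Dirichlet \<Rightarrow> a = 0 | Neumann \<Rightarrow> a' = 0)"

definition coercive :: "actuation \<Rightarrow> ereal \<Rightarrow> real \<Rightarrow> bool" where
  "coercive act q \<nu> \<longleftrightarrow> (\<forall>h h' h''. H2 h h' h'' \<and> left_bc q (h 0) (h' 0) \<and> right_bc act (h 1) (h' 1) \<longrightarrow>
     (LINT x|unitM. h x * h'' x) \<le> - \<nu> * (LINT x|unitM. (h x)\<^sup>2))"

text \<open>The Riccati inequality makes the derivative of \<open>F\<close> at least the square of
  \<open>h' - p * h\<close>. The point \<open>1\<close> is left out, and a limit assumed instead,
  because under the Dirichlet condition the logarithmic derivative of a ground state blows up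
  there.\<close>

lemma Picone:
  fixes p p' :: "real \<Rightarrow> real"
  assumes h: "H2 h h' h''"
    and p: "\<And>x. 0 \<le> x \<Longrightarrow> x < 1 \<Longrightarrow> (p has_real_derivative p' x) (at x)"
    and p': "\<And>x. 0 \<le> x \<Longrightarrow> x < 1 \<Longrightarrow> p' x \<le> - \<nu> - (p x)\<^sup>2"
    and lim: "((\<lambda>x. p x * (h x)\<^sup>2) \<longlongrightarrow> 0) (at_left 1)"
  shows "\<nu> * (LINT x|unitM. (h x)\<^sup>2) - p 0 * (h 0)\<^sup>2 \<le> (LINT x|unitM. (h' x)\<^sup>2)"
proof -
  note hD = H2D[OF h]
  define g where "g = (\<lambda>x. (h' x)\<^sup>2 - \<nu> * (h x)\<^sup>2)"
  have gc: "continuous_on {0..1} g" unfolding g_def by (intro continuous_intros hD)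
  define F where "F = (\<lambda>x. integral {0..x} g - p x * (h x)\<^sup>2)"
  have ge: "- p 0 * (h 0)\<^sup>2 \<le> F x" if x: "0 < x" "x < 1" for x
  proof -
    have "F 0 \<le> F x"
    proof (rule DERIV_nonneg_imp_increasing_open[where f=F])
      have "continuous_on {0..x} (\<lambda>x. integral {0..x} g)"
        by (rule indefinite_integral_continuous_1[OF integrable_continuous_real])
          (rule continuous_on_subset[OF gc], use x in auto)
      moreover have "continuous_on {0..x} p"
        by (rule DERIV_continuous_on[of _ p p']) (use p x in \<open>auto intro: has_field_derivative_at_within\<close>)
      moreover have "continuous_on {0..x} h" by (rule continuous_on_subset[OF hD(2)]) (use x in auto)
      ultimately show "continuous_on {0..x} F"
        unfolding F_def by (intro continuous_on_diff continuous_on_mult continuous_on_power)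
      fix y assume y: "0 < y" "y < x"
      then have y1: "y \<in> {0..1}" "y \<in> interior {0..1}" using x by auto
      have i: "((\<lambda>x. integral {0..x} g) has_real_derivative g y) (at y)"
        using integral_has_real_derivative[OF gc y1(1)] at_within_interior[OF y1(2)] by simp
      have hd: "(h has_real_derivative h' y) (at y)"
        using hD(4)[OF y1(1)] at_within_interior[OF y1(2)] by simp
      have "(F has_real_derivative g y - (p' y * (h y)\<^sup>2 + p y * (2 * h y * h' y))) (at y)"
        unfolding F_def using p[of y] y x
        by (auto intro!: derivative_eq_intros i hd)
      moreover have "0 \<le> g y - (p' y * (h y)\<^sup>2 + p y * (2 * h y * h' y))"
      proof -
        have "p' y * (h y)\<^sup>2 \<le> (- \<nu> - (p y)\<^sup>2) * (h y)\<^sup>2"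
          using p'[of y] y x by (intro mult_right_mono) auto
        moreover have "g y - ((- \<nu> - (p y)\<^sup>2) * (h y)\<^sup>2 + p y * (2 * h y * h' y)) = (h' y - p y * h y)\<^sup>2"
          by (simp add: g_def power2_eq_square algebra_simps)
        moreover have "0 \<le> (h' y - p y * h y)\<^sup>2" by simp
        ultimately show ?thesis by linarith
      qed
      ultimately show "\<exists>d. DERIV F y :> d \<and> 0 \<le> d" by blast
    qed (use x in auto)
    then show ?thesis by (simp add: F_def)
  qed
  have "((\<lambda>x. integral {0..x} g) \<longlongrightarrow> integral {0..1} g) (at_left 1)"
  proof -
    have "continuous_on {0..1} (\<lambda>x. integral {0..x} g)"
      by (rule indefinite_integral_continuous_1[OF integrable_continuous_real[OF gc]])
    then have "((\<lambda>x. integral {0..x} g) \<longlongrightarrow> integral {0..1} g) (at 1 within {0..1})"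
      by (simp add: continuous_on_def)
    then show ?thesis by (simp add: at_within_Icc_at_left)
  qed
  then have "(F \<longlongrightarrow> integral {0..1} g - 0) (at_left 1)"
    unfolding F_def by (intro tendsto_diff lim)
  moreover have "eventually (\<lambda>x. - p 0 * (h 0)\<^sup>2 \<le> F x) (at_left 1)"
    by (rule eventually_mono[OF eventually_at_left_real[of 0 1]]) (use ge in auto)
  ultimately have "- p 0 * (h 0)\<^sup>2 \<le> integral {0..1} g - 0"
    by (rule tendsto_lowerbound) simp
  moreover have "integral {0..1} g = (LINT x|unitM. (h' x)\<^sup>2) - \<nu> * (LINT x|unitM. (h x)\<^sup>2)"
  proof -
    have "continuous_on {0..1} (\<lambda>x. (h' x)\<^sup>2)" "continuous_on {0..1} (\<lambda>x. (h x)\<^sup>2)"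
      by (intro continuous_intros hD)+
    note * = this[THEN continuous_imp_integrable_real]
    have "(LINT x|unitM. g x) = (LINT x|unitM. (h' x)\<^sup>2) - \<nu> * (LINT x|unitM. (h x)\<^sup>2)"
      unfolding g_def using * by simp
    then show ?thesis using LINT_continuous_eq_integral[OF gc] by simp
  qed
  ultimately show ?thesis by simp
qed

lemma H2_energy:
  assumes h: "H2 h h' h''"
  shows "(LINT x|unitM. h x * h'' x) = h 1 * h' 1 - h 0 * h' 0 - (LINT x|unitM. (h' x)\<^sup>2)"
proof -
  note hD = H2D[OF h]
  have "(LINT x|unitM. h x * h'' x) = h 1 * h' 1 - h 0 * h' 0 - (LINT x|unitM. h' x * h' x)"
    by (rule LINT_by_parts[OF _ hD(1) hD(4) L2_integrable[OF hD(3)] hD(5)]) simp_all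
  then show ?thesis by (simp add: power2_eq_square)
qed

text \<open>Picone's identity with \<open>p = \<psi>' / \<psi>\<close>.\<close>

lemma coercive_supersolution:
  fixes \<psi> \<psi>' :: "real \<Rightarrow> real"
  assumes d1: "\<And>x. (\<psi> has_real_derivative \<psi>' x) (at x)"
    and d2: "\<And>x. (\<psi>' has_real_derivative - \<nu> * \<psi> x) (at x)"
    and pos: "\<And>x. 0 \<le> x \<Longrightarrow> x < 1 \<Longrightarrow> \<psi> x > 0"
    and left: "q = \<infinity> \<or> \<psi>' 0 \<le> real_of_ereal q * \<psi> 0"
    and right: "case act of Dirichlet \<Rightarrow> \<psi> 1 \<noteq> 0 \<or> \<psi>' 1 \<noteq> 0 | Neumann \<Rightarrow> \<psi> 1 \<noteq> 0 \<and> \<psi>' 1 = 0"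
  shows "coercive act q \<nu>"
  unfolding coercive_def
proof (intro allI impI, elim conjE)
  fix h h' h'' assume h: "H2 h h' h''" and l: "left_bc q (h 0) (h' 0)" and r: "right_bc act (h 1) (h' 1)"
  note hD = H2D[OF h]
  define p where "p = (\<lambda>x. \<psi>' x / \<psi> x)"
  have tl: "(f \<longlongrightarrow> f 1) (at_left 1)" if "\<And>x. isCont f x" for f :: "real \<Rightarrow> real"
    using that[of 1] by (auto simp: isCont_def intro: tendsto_within_subset)
  have c\<psi>: "(\<psi> \<longlongrightarrow> \<psi> 1) (at_left 1)" by (rule tl[OF DERIV_isCont[OF d1]])
  have c\<psi>': "(\<psi>' \<longlongrightarrow> \<psi>' 1) (at_left 1)" by (rule tl[OF DERIV_isCont[OF d2]])
  have ch: "(h \<longlongrightarrow> h 1) (at_left 1)"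
    using hD(2) by (auto simp: continuous_on_def at_within_Icc_at_left dest: bspec[where x=1])
  have "((\<lambda>x. p x * (h x)\<^sup>2) \<longlongrightarrow> 0) (at_left 1)"
  proof (cases "\<psi> 1 = 0")
    case False
    then have "((\<lambda>x. p x * (h x)\<^sup>2) \<longlongrightarrow> \<psi>' 1 / \<psi> 1 * (h 1)\<^sup>2) (at_left 1)"
      unfolding p_def by (intro tendsto_intros c\<psi> c\<psi>' ch)
    moreover have "\<psi>' 1 / \<psi> 1 * (h 1)\<^sup>2 = 0"
      using right r by (auto simp: right_bc_def split: actuation.splits)
    ultimately show ?thesis by (simp only:)
  next
    case True
    \<comment> \<open>\<open>\<psi>\<close> vanishes to first order at \<open>1\<close>, so
      \<open>p\<close> has a simple pole there; \<open>h\<close> vanishes as well, and its square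
      wins. Both are compared with \<open>x - 1\<close>.\<close>
    then have D: "act = Dirichlet" and n: "\<psi>' 1 \<noteq> 0" and h1: "h 1 = 0"
      using right r by (auto simp: right_bc_def split: actuation.splits)
    have q1: "((\<lambda>x. \<psi> x / (x - 1)) \<longlongrightarrow> \<psi>' 1) (at_left 1)"
      using d1[of 1] True unfolding has_field_derivative_iff by (auto intro: tendsto_within_subset)
    have "(h has_real_derivative h' 1) (at_left 1)"
      using hD(4)[of 1] by (simp add: at_within_Icc_at_left)
    then have q2: "((\<lambda>x. h x / (x - 1)) \<longlongrightarrow> h' 1) (at_left 1)"
      using h1 unfolding has_field_derivative_iff by simp
    have "((\<lambda>x. \<psi>' x / (\<psi> x / (x - 1)) * (h x / (x - 1)) * h x) \<longlongrightarrow> \<psi>' 1 / \<psi>' 1 * h' 1 * h 1) (at_left 1)"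
      by (intro tendsto_intros q1 q2 c\<psi>' ch n)
    moreover have "\<psi>' x / (\<psi> x / (x - 1)) * (h x / (x - 1)) * h x = p x * (h x)\<^sup>2" if "x < 1" for x
      using that by (simp add: p_def power2_eq_square)
    then have "eventually (\<lambda>x. \<psi>' x / (\<psi> x / (x - 1)) * (h x / (x - 1)) * h x = p x * (h x)\<^sup>2) (at_left 1)"
      by (auto simp: eventually_at_filter)
    ultimately show ?thesis using h1 by (simp add: tendsto_cong)
  qed
  then have P: "\<nu> * (LINT x|unitM. (h x)\<^sup>2) - p 0 * (h 0)\<^sup>2 \<le> (LINT x|unitM. (h' x)\<^sup>2)"
  proof (rule Picone[OF h, rotated 2])
    fix x :: real assume x: "0 \<le> x" "x < 1"
    have n: "\<psi> x \<noteq> 0" using pos[OF x] by simp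
    show "(p has_real_derivative (- \<nu> * \<psi> x * \<psi> x - \<psi>' x * \<psi>' x) / (\<psi> x * \<psi> x)) (at x)"
      unfolding p_def by (rule DERIV_divide[OF d2 d1 n])
    show "(- \<nu> * \<psi> x * \<psi> x - \<psi>' x * \<psi>' x) / (\<psi> x * \<psi> x) \<le> - \<nu> - (p x)\<^sup>2"
      using n by (simp add: p_def power2_eq_square field_simps)
  qed
  \<comment> \<open>With \<open>p 0\<close> at most \<open>q\<close>, the term that Picone's
    identity leaves at \<open>0\<close> is dominated by the boundary term \<open>h 0 * h' 0\<close>
    of the energy.\<close>
  have p0: "q = \<infinity> \<or> p 0 \<le> real_of_ereal q" using left pos[of 0] by (auto simp: p_def field_simps)
  have "p 0 * (h 0)\<^sup>2 \<le> h 0 * h' 0"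
  proof (cases "q = \<infinity>")
    case True
    then show ?thesis using l by (simp add: left_bc_def)
  next
    case False
    then have "p 0 * (h 0)\<^sup>2 \<le> real_of_ereal q * (h 0)\<^sup>2" using p0 by (intro mult_right_mono) auto
    then show ?thesis using l False by (simp add: left_bc_def power2_eq_square mult_ac)
  qed
  moreover have "h 1 * h' 1 = 0" using r by (auto simp: right_bc_def split: actuation.splits)
  ultimately show "(LINT x|unitM. h x * h'' x) \<le> - \<nu> * (LINT x|unitM. (h x)\<^sup>2)"
    using P unfolding H2_energy[OF h] by linarith
qed

lemma coercive_mono:
  assumes "coercive act q \<nu>" "\<nu>' \<le> \<nu>"
  shows "coercive act q \<nu>'"
  unfolding coercive_def
proof (intro allI impI)
  fix h h' h'' assume a: "H2 h h' h'' \<and> left_bc q (h 0) (h' 0) \<and> right_bc act (h 1) (h' 1)"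
  have "\<nu>' * (LINT x|unitM. (h x)\<^sup>2) \<le> \<nu> * (LINT x|unitM. (h x)\<^sup>2)"
    using assms(2) by (intro mult_right_mono) auto
  moreover have "(LINT x|unitM. h x * h'' x) \<le> - \<nu> * (LINT x|unitM. (h x)\<^sup>2)"
    using a assms(1) unfolding coercive_def by blast
  ultimately show "(LINT x|unitM. h x * h'' x) \<le> - \<nu>' * (LINT x|unitM. (h x)\<^sup>2)" by linarith
qed

text \<open>For \<open>q = \<infinity>\<close> the ground state vanishes at \<open>0\<close>, where
  \<open>coercive_supersolution\<close> asks for positivity. Slightly smaller values of
  \<open>\<nu>\<close> have a solution that is positive at \<open>0\<close>, and the bound passes to
  the limit.\<close>

lemma coercive_limit:
  assumes "a < \<nu>" "\<And>\<nu>'. a < \<nu>' \<Longrightarrow> \<nu>' < \<nu> \<Longrightarrow> coercive act q \<nu>'"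
  shows "coercive act q \<nu>"
  unfolding coercive_def
proof (intro allI impI)
  fix h h' h'' assume a: "H2 h h' h'' \<and> left_bc q (h 0) (h' 0) \<and> right_bc act (h 1) (h' 1)"
  define y where "y = (LINT x|unitM. h x * h'' x)"
  define z where "z = (LINT x|unitM. (h x)\<^sup>2)"
  have "((\<lambda>\<nu>'. - \<nu>' * z) \<longlongrightarrow> - \<nu> * z) (at_left \<nu>)" by (intro tendsto_intros)
  moreover have "eventually (\<lambda>\<nu>'. y \<le> - \<nu>' * z) (at_left \<nu>)"
  proof (rule eventually_mono[OF eventually_at_left_real[OF assms(1)]])
    fix \<nu>' assume "\<nu>' \<in> {a<..<\<nu>}"
    then have "coercive act q \<nu>'" using assms(2) by auto
    then show "y \<le> - \<nu>' * z" using a unfolding coercive_def y_def z_def by blast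
  qed
  ultimately show "y \<le> - \<nu> * z"
    by (rule tendsto_lowerbound) simp
qed

text \<open>Coercivity is tested with an eigenfunction. Together with \<open>coercive_min_c\<close>
  this yields \<open>0 <= \<mu>\<close>.\<close>

lemma coercive_le_eigenvalue:
  assumes "coercive act q \<nu>" "eigenvalue act q \<mu>"
  shows "\<nu> \<le> \<mu>"
proof -
  obtain h h' h'' where h: "H2 h h' h''" and l: "left_bc q (h 0) (h' 0)"
    and r: "right_bc act (h 1) (h' 1)" and nz: "\<exists>x\<in>{0..1}. h x \<noteq> 0"
    and ae: "AE x in unitM. - h'' x = \<mu> * h x"
    using assms(2) unfolding eigenvalue_def right_bc_def by blast
  note hD = H2D[OF h]
  have c: "continuous_on {0..1} (\<lambda>x. (h x)\<^sup>2)" by (intro continuous_intros hD)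
  have "(LINT x|unitM. h x * h'' x) = (LINT x|unitM. - \<mu> * (h x)\<^sup>2)"
  proof (rule integral_cong_AE)
    show "(\<lambda>x. h x * h'' x) \<in> borel_measurable unitM"
      using L2_mult_integrable[OF continuous_L2[OF hD(2)] hD(3)] by (rule borel_measurable_integrable)
    show "(\<lambda>x. - \<mu> * (h x)\<^sup>2) \<in> borel_measurable unitM"
      using continuous_imp_integrable_real[OF c] by (intro borel_measurable_times borel_measurable_const borel_measurable_integrable)
    show "AE x in unitM. h x * h'' x = - \<mu> * (h x)\<^sup>2"
      using ae
    proof eventually_elim
      case (elim x)
      then have "h'' x = - \<mu> * h x" by linarith
      then show ?case by (simp add: power2_eq_square)
    qed
  qed
  then have "- \<mu> * (LINT x|unitM. (h x)\<^sup>2) \<le> - \<nu> * (LINT x|unitM. (h x)\<^sup>2)"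
    using assms(1) h l r unfolding coercive_def by fastforce
  moreover have "(LINT x|unitM. (h x)\<^sup>2) > 0"
  proof -
    have "(LINT x|unitM. (h x)\<^sup>2) \<noteq> 0"
      using integralL_eq_0_iff[OF c] nz by auto
    moreover have "(LINT x|unitM. (h x)\<^sup>2) \<ge> 0" by simp
    ultimately show ?thesis by linarith
  qed
  ultimately show ?thesis by simp
qed

section \<open>Explicit ground states and a lower bound for the spectrum\<close>

lemma sinh_ge_self: "0 \<le> x \<Longrightarrow> x \<le> sinh x" for x :: real
proof -
  assume x: "0 \<le> x"
  have "sinh 0 - 0 \<le> sinh x - x"
  proof (rule DERIV_nonneg_imp_nondecreasing[OF x])
    fix t :: real
    have "((\<lambda>x. sinh x - x) has_real_derivative cosh t - 1) (at t)" by (auto intro!: derivative_eq_intros)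
    then show "\<exists>y. ((\<lambda>x. sinh x - x) has_real_derivative y) (at t) \<and> 0 \<le> y"
      using cosh_real_ge_1[of t] by (intro exI[of _ "cosh t - 1"]) auto
  qed
  then show "x \<le> sinh x" by simp
qed

lemma cosh_ge_quadratic: "0 \<le> x \<Longrightarrow> 1 + x\<^sup>2 / 2 \<le> cosh x" for x :: real
proof -
  assume x: "0 \<le> x"
  have "cosh 0 - (1 + 0\<^sup>2 / 2) \<le> cosh x - (1 + x\<^sup>2 / 2)"
  proof (rule DERIV_nonneg_imp_nondecreasing[OF x])
    fix t :: real assume "0 \<le> t"
    have "((\<lambda>x. cosh x - (1 + x\<^sup>2 / 2)) has_real_derivative sinh t - t) (at t)" by (auto intro!: derivative_eq_intros)
    then show "\<exists>y. ((\<lambda>x. cosh x - (1 + x\<^sup>2 / 2)) has_real_derivative y) (at t) \<and> 0 \<le> y"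
      using sinh_ge_self[OF \<open>0 \<le> t\<close>] by (intro exI[of _ "sinh t - t"]) auto
  qed
  then show ?thesis by simp
qed

lemma eigenvalueI:
  fixes \<psi> \<psi>' :: "real \<Rightarrow> real"
  assumes d1: "\<And>x. (\<psi> has_real_derivative \<psi>' x) (at x)"
    and d2: "\<And>x. (\<psi>' has_real_derivative - \<nu> * \<psi> x) (at x)"
    and "left_bc q (\<psi> 0) (\<psi>' 0)" "right_bc act (\<psi> 1) (\<psi>' 1)"
    and "x \<in> {0..1}" "\<psi> x \<noteq> 0"
  shows "eigenvalue act q \<nu>"
proof -
  have "continuous_on {0..1} \<psi>" by (rule DERIV_continuous_on[of _ \<psi> \<psi>']) (rule has_field_derivative_at_within[OF d1])
  then have "continuous_on {0..1} (\<lambda>x. - \<nu> * \<psi> x)" by (intro continuous_intros)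
  then have "H2 \<psi> \<psi>' (\<lambda>x. - \<nu> * \<psi> x)"
    by (rule H2_classical[OF has_field_derivative_at_within[OF d1] has_field_derivative_at_within[OF d2]])
  moreover have "AE x in unitM. - (- \<nu> * \<psi> x) = \<nu> * \<psi> x" by simp
  ultimately show ?thesis using assms(3-6) unfolding eigenvalue_def right_bc_def by blast
qed

lemma ground_stateI:
  fixes \<psi> \<psi>' :: "real \<Rightarrow> real"
  assumes "\<And>x. (\<psi> has_real_derivative \<psi>' x) (at x)"
    and "\<And>x. (\<psi>' has_real_derivative - \<nu> * \<psi> x) (at x)"
    and "\<And>x. 0 \<le> x \<Longrightarrow> x < 1 \<Longrightarrow> \<psi> x > 0"
    and "\<psi>' 0 = r * \<psi> 0" "right_bc act (\<psi> 1) (\<psi>' 1)" "\<psi> 1 \<noteq> 0 \<or> \<psi>' 1 \<noteq> 0"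
  shows "eigenvalue act (ereal r) \<nu> \<and> coercive act (ereal r) \<nu>"
proof
  have "\<psi> 0 \<noteq> 0" using assms(3)[of 0] by simp
  then show "eigenvalue act (ereal r) \<nu>"
    using assms by (intro eigenvalueI[of \<psi> \<psi>' \<nu> _ _ 0]) (auto simp: left_bc_def)
  show "coercive act (ereal r) \<nu>"
    using assms by (intro coercive_supersolution[of \<psi> \<psi>']) (auto simp: right_bc_def split: actuation.splits)
qed

text \<open>The eigenfunction \<open>sin (pi * x)\<close> proves the first half but vanishes at
  \<open>0\<close>. Coercivity is taken from \<open>sin (k * (1 - x))\<close> with
  \<open>k < pi\<close>, which is positive on the half-open interval; the Neumann case below is
  analogous with \<open>cos\<close>.\<close>

lemma ground_state_Dirichlet_infinity:
  "eigenvalue Dirichlet \<infinity> (pi\<^sup>2) \<and> coercive Dirichlet \<infinity> (pi\<^sup>2)"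
proof
  show "eigenvalue Dirichlet \<infinity> (pi\<^sup>2)"
    by (rule eigenvalueI[of "\<lambda>x. sin (pi * x)" "\<lambda>x. pi * cos (pi * x)" _ _ _ "1/2"])
      (auto intro!: derivative_eq_intros simp: left_bc_def right_bc_def power2_eq_square)
  show "coercive Dirichlet \<infinity> (pi\<^sup>2)"
  proof (rule coercive_limit[of 0])
    fix \<nu> :: real assume \<nu>: "0 < \<nu>" "\<nu> < pi\<^sup>2"
    define k where "k = sqrt \<nu>"
    have k: "0 < k" "k < pi" "k\<^sup>2 = \<nu>" using \<nu> by (auto simp: k_def real_less_lsqrt)
    show "coercive Dirichlet \<infinity> \<nu>"
    proof (rule coercive_supersolution[of "\<lambda>x. sin (k * (1 - x))" "\<lambda>x. - k * cos (k * (1 - x))"])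
      fix x :: real
      show "((\<lambda>x. sin (k * (1 - x))) has_real_derivative - k * cos (k * (1 - x))) (at x)"
        by (auto intro!: derivative_eq_intros)
      show "((\<lambda>x. - k * cos (k * (1 - x))) has_real_derivative - \<nu> * sin (k * (1 - x))) (at x)"
        using k(3) by (auto intro!: derivative_eq_intros simp: power2_eq_square)
      assume x: "0 \<le> x" "x < 1"
      have "0 < k * (1 - x)" "k * (1 - x) \<le> k * 1" using x k by (auto intro!: mult_left_mono)
      then show "0 < sin (k * (1 - x))" using k by (intro sin_gt_zero) linarith+
    qed (use k in auto)
  qed simp
qed

lemma ground_state_Neumann_infinity:
  "eigenvalue Neumann \<infinity> ((pi / 2)\<^sup>2) \<and> coercive Neumann \<infinity> ((pi / 2)\<^sup>2)"
proof
  show "eigenvalue Neumann \<infinity> ((pi / 2)\<^sup>2)"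
    by (rule eigenvalueI[of "\<lambda>x. sin (pi / 2 * x)" "\<lambda>x. pi / 2 * cos (pi / 2 * x)" _ _ _ "1"])
      (auto intro!: derivative_eq_intros simp: left_bc_def right_bc_def power2_eq_square)
  show "coercive Neumann \<infinity> ((pi / 2)\<^sup>2)"
  proof (rule coercive_limit[of 0])
    fix \<nu> :: real assume \<nu>: "0 < \<nu>" "\<nu> < (pi / 2)\<^sup>2"
    define k where "k = sqrt \<nu>"
    have k: "0 < k" "k\<^sup>2 = \<nu>" using \<nu> by (auto simp: k_def)
    have k2: "k < pi / 2" by (rule power2_less_imp_less) (use k \<nu> in simp_all)
    show "coercive Neumann \<infinity> \<nu>"
    proof (rule coercive_supersolution[of "\<lambda>x. cos (k * (1 - x))" "\<lambda>x. k * sin (k * (1 - x))"])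
      fix x :: real
      show "((\<lambda>x. cos (k * (1 - x))) has_real_derivative k * sin (k * (1 - x))) (at x)"
        by (auto intro!: derivative_eq_intros)
      show "((\<lambda>x. k * sin (k * (1 - x))) has_real_derivative - \<nu> * cos (k * (1 - x))) (at x)"
        using k(2) by (auto intro!: derivative_eq_intros simp: power2_eq_square)
      assume x: "0 \<le> x" "x < 1"
      have "k * (1 - x) \<le> k * 1" "0 \<le> k * (1 - x)" using x k by (auto intro!: mult_left_mono)
      then show "0 < cos (k * (1 - x))" using k2 pi_gt_zero by (intro cos_gt_zero_pi) linarith+
    qed (use k in auto)
  qed simp
qed

text \<open>Solutions are anchored at \<open>x = 1\<close>, so that the right condition holds
  automatically and the left one becomes a scalar equation for \<open>k\<close>;
  \<open>k < pi\<close> keeps the solution positive.\<close>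

lemma ground_state_sin:
  assumes k: "0 < k" "k < pi" and r: "k * cos k + r * sin k = 0"
  shows "eigenvalue Dirichlet (ereal r) (k\<^sup>2) \<and> coercive Dirichlet (ereal r) (k\<^sup>2)"
proof (rule ground_stateI[of "\<lambda>x. sin (k * (1 - x))" "\<lambda>x. - k * cos (k * (1 - x))"])
  fix x :: real
  show "((\<lambda>x. sin (k * (1 - x))) has_real_derivative - k * cos (k * (1 - x))) (at x)"
    by (auto intro!: derivative_eq_intros)
  show "((\<lambda>x. - k * cos (k * (1 - x))) has_real_derivative - k\<^sup>2 * sin (k * (1 - x))) (at x)"
    by (auto intro!: derivative_eq_intros simp: power2_eq_square)
  assume x: "0 \<le> x" "x < 1"
  have "0 < k * (1 - x)" "k * (1 - x) \<le> k * 1" using x k by (auto intro!: mult_left_mono)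
  then show "0 < sin (k * (1 - x))" using k by (intro sin_gt_zero) linarith+
qed (use k r in \<open>auto simp: right_bc_def\<close>)

text \<open>The smallest eigenvalue changes sign at \<open>r = -1\<close>: the ground state is a
  sine above, linear at, and a hyperbolic sine below this value. The frequency comes from the
  intermediate value theorem; the brackets must exclude the trivial root
  \<open>k = 0\<close>.\<close>

lemma ground_state_Dirichlet:
  "\<exists>\<nu>. eigenvalue Dirichlet (ereal r) \<nu> \<and> coercive Dirichlet (ereal r) \<nu>"
proof -
  consider "r \<ge> 0" | "-1 < r" "r < 0" | "r = -1" | "r < -1" by linarith
  then show ?thesis
  proof cases
    case 1
    have "\<exists>k\<ge>pi / 2. k \<le> pi \<and> k * cos k + r * sin k = 0"
      by (rule IVT2) (use 1 pi_gt_zero in \<open>auto intro!: continuous_intros\<close>)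
    then obtain k where k: "pi / 2 \<le> k" "k \<le> pi" "k * cos k + r * sin k = 0" by blast
    moreover have "k \<noteq> pi" using k(3) pi_gt_zero by auto
    ultimately show ?thesis using ground_state_sin[of k r] pi_gt_zero by (metis half_gt_zero less_le less_le_trans)
  next
    case 2
    \<comment> \<open>To third order \<open>k * cos k + r * sin k\<close> is bounded below by
      \<open>k * (1 + r - k\<^sup>2 / 2)\<close> for these \<open>r\<close>, and at
      \<open>k = \<delta>\<close> this equals \<open>\<delta> * (1 + r) / 2 > 0\<close>. So the
      bracket can start at \<open>\<delta>\<close> instead of \<open>0\<close>.\<close>
    define \<delta> where "\<delta> = sqrt (1 + r)"
    have \<delta>: "0 < \<delta>" "\<delta> < 1" "\<delta>\<^sup>2 = 1 + r" using 2 by (auto simp: \<delta>_def)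
    have "\<delta> * (1 - \<delta>\<^sup>2 / 2) \<le> \<delta> * cos \<delta>"
    proof (rule mult_left_mono)
      have "(sin (\<delta> / 2))\<^sup>2 \<le> (\<delta> / 2)\<^sup>2"
        using abs_sin_x_le_abs_x[of "\<delta> / 2"] by (simp only: abs_le_square_iff)
      then show "1 - \<delta>\<^sup>2 / 2 \<le> cos \<delta>"
        using cos_double_sin[of "\<delta> / 2"] by (simp add: power_divide)
    qed (use \<delta> in simp)
    moreover have "r * \<delta> \<le> r * sin \<delta>" using sin_x_le_x[of \<delta>] \<delta> 2 by (intro mult_left_mono_neg) auto
    moreover have "\<delta> * (1 - \<delta>\<^sup>2 / 2) + r * \<delta> = \<delta> * ((1 + r) / 2)" unfolding \<delta>(3) by (simp add: field_simps)
    moreover have "\<delta> * ((1 + r) / 2) > 0" using \<delta> 2 by simp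
    ultimately have pos: "0 \<le> \<delta> * cos \<delta> + r * sin \<delta>" by linarith
    have "\<exists>k\<ge>\<delta>. k \<le> pi \<and> k * cos k + r * sin k = 0"
      by (rule IVT2) (use pos \<delta> pi_gt3 in \<open>auto intro!: continuous_intros\<close>)
    then obtain k where k: "\<delta> \<le> k" "k \<le> pi" "k * cos k + r * sin k = 0" by blast
    moreover have "k \<noteq> pi" using k(3) pi_gt_zero by auto
    ultimately show ?thesis using ground_state_sin[of k r] \<delta>(1) by (metis less_le less_le_trans)
  next
    case 3
    have "eigenvalue Dirichlet (ereal r) 0 \<and> coercive Dirichlet (ereal r) 0"
      by (rule ground_stateI[of "\<lambda>x. 1 - x" "\<lambda>x. -1"])
        (use 3 in \<open>auto intro!: derivative_eq_intros simp: right_bc_def\<close>)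
    then show ?thesis by blast
  next
    case 4
    \<comment> \<open>The bracket starts where \<open>cosh a = - r\<close>: there the function
      equals \<open>(- r) * (a - sinh a)\<close>, which is at most \<open>0\<close>, and
      \<open>a\<close> is positive because \<open>- r > 1\<close>.\<close>
    have "- r \<le> cosh (- r)"
    proof -
      have "- r \<le> 1 + (- r)\<^sup>2 / 2" using zero_le_power2[of "1 + r"] by (simp add: power2_eq_square algebra_simps)
      then show ?thesis using cosh_ge_quadratic[of "- r"] 4 by linarith
    qed
    then have "\<exists>a\<ge>0. a \<le> - r \<and> cosh a = - r"
      using 4 by (intro IVT) (auto intro!: continuous_intros)
    then obtain a where a: "0 \<le> a" "a \<le> - r" and ca: "cosh a = - r" by blast
    have a0: "0 < a" using a ca 4 by (cases "a = 0") auto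
    have "a * cosh a + r * sinh a \<le> 0"
    proof -
      have "a * cosh a + r * sinh a = (- r) * (a - sinh a)" unfolding ca by (simp add: algebra_simps)
      also have "\<dots> \<le> 0" using sinh_ge_self[of a] a0 4 by (intro mult_nonneg_nonpos) auto
      finally show ?thesis .
    qed
    moreover have "0 \<le> (- r) * cosh (- r) + r * sinh (- r)"
    proof -
      have "0 \<le> (- r) * (cosh (- r) - sinh (- r))"
        using 4 by (intro mult_nonneg_nonneg) (auto simp: cosh_plus_sinh)
      then show ?thesis by (simp add: algebra_simps)
    qed
    ultimately have "\<exists>k\<ge>a. k \<le> - r \<and> k * cosh k + r * sinh k = 0"
      using \<open>a \<le> - r\<close> by (intro IVT) (auto intro!: continuous_intros)
    then obtain k where k: "a \<le> k" "k * cosh k + r * sinh k = 0" by blast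
    have k0: "0 < k" using k a0 by simp
    have "eigenvalue Dirichlet (ereal r) (- k\<^sup>2) \<and> coercive Dirichlet (ereal r) (- k\<^sup>2)"
    proof (rule ground_stateI[of "\<lambda>x. sinh (k * (1 - x))" "\<lambda>x. - k * cosh (k * (1 - x))"])
      fix x :: real
      show "((\<lambda>x. sinh (k * (1 - x))) has_real_derivative - k * cosh (k * (1 - x))) (at x)"
        by (auto intro!: derivative_eq_intros)
      show "((\<lambda>x. - k * cosh (k * (1 - x))) has_real_derivative - (- k\<^sup>2) * sinh (k * (1 - x))) (at x)"
        by (auto intro!: derivative_eq_intros simp: power2_eq_square)
      assume x: "0 \<le> x" "x < 1"
      then show "0 < sinh (k * (1 - x))" using k0 by simp
    qed (use k k0 in \<open>auto simp: right_bc_def\<close>)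
    then show ?thesis by blast
  qed
qed

text \<open>The sign of \<open>r\<close> decides between \<open>cos\<close> and \<open>cosh\<close>.
  Here \<open>k = 0\<close> is a genuine solution, the constant for \<open>r = 0\<close>, so the
  brackets may start at \<open>0\<close>.\<close>

lemma ground_state_Neumann:
  "\<exists>\<nu>. eigenvalue Neumann (ereal r) \<nu> \<and> coercive Neumann (ereal r) \<nu>"
proof (cases "r \<ge> 0")
  case True
  have "\<exists>k\<ge>0. k \<le> pi / 2 \<and> k * sin k - r * cos k = 0"
    by (rule IVT) (use True pi_gt_zero in \<open>auto intro!: continuous_intros\<close>)
  then obtain k where k: "0 \<le> k" "k \<le> pi / 2" "k * sin k - r * cos k = 0" by blast
  have "k \<noteq> pi / 2"
  proof
    assume "k = pi / 2"
    with k(3) have "pi / 2 * sin (pi / 2) - r * cos (pi / 2) = 0" by metis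
    then show False using pi_gt_zero by simp
  qed
  with k have k2: "k < pi / 2" by simp
  have "eigenvalue Neumann (ereal r) (k\<^sup>2) \<and> coercive Neumann (ereal r) (k\<^sup>2)"
  proof (rule ground_stateI[of "\<lambda>x. cos (k * (1 - x))" "\<lambda>x. k * sin (k * (1 - x))"])
    fix x :: real
    show "((\<lambda>x. cos (k * (1 - x))) has_real_derivative k * sin (k * (1 - x))) (at x)"
      by (auto intro!: derivative_eq_intros)
    show "((\<lambda>x. k * sin (k * (1 - x))) has_real_derivative - k\<^sup>2 * cos (k * (1 - x))) (at x)"
      by (auto intro!: derivative_eq_intros simp: power2_eq_square)
    assume x: "0 \<le> x" "x < 1"
    have "k * (1 - x) \<le> k * 1" by (rule mult_left_mono) (use x k in auto)
    moreover have "0 \<le> k * (1 - x)" using x k by simp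
    ultimately show "0 < cos (k * (1 - x))" using k2 pi_gt_zero by (intro cos_gt_zero_pi) linarith+
  qed (use k in \<open>auto simp: right_bc_def\<close>)
  then show ?thesis by blast
next
  case False
  \<comment> \<open>At \<open>k = 1 - r\<close> the function reduces to
    \<open>sinh (1 - r) + r * exp (- (1 - r))\<close>, and \<open>sinh y >= y\<close> makes this at
    least \<open>1\<close>; so \<open>1 - r\<close> can serve as the upper end.\<close>
  have pos: "0 \<le> (1 - r) * sinh (1 - r) + r * cosh (1 - r)"
  proof -
    have e: "cosh (1 - r) = sinh (1 - r) + exp (- (1 - r))" using cosh_minus_sinh[of "1 - r"] by linarith
    have "r * 1 \<le> r * exp (- (1 - r))" using False by (intro mult_left_mono_neg) auto
    moreover have "1 - r \<le> sinh (1 - r)" using False by (intro sinh_ge_self) auto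
    moreover have "(1 - r) * sinh (1 - r) + r * cosh (1 - r) = sinh (1 - r) + r * exp (- (1 - r))"
      unfolding e by (simp add: algebra_simps)
    ultimately show ?thesis using False by linarith
  qed
  have "\<exists>k\<ge>0. k \<le> 1 - r \<and> k * sinh k + r * cosh k = 0"
    by (rule IVT) (use False pos in \<open>auto intro!: continuous_intros\<close>)
  then obtain k where k: "0 \<le> k" "k * sinh k + r * cosh k = 0" by blast
  have "eigenvalue Neumann (ereal r) (- k\<^sup>2) \<and> coercive Neumann (ereal r) (- k\<^sup>2)"
  proof (rule ground_stateI[of "\<lambda>x. cosh (k * (1 - x))" "\<lambda>x. - k * sinh (k * (1 - x))"])
    fix x :: real
    show "((\<lambda>x. cosh (k * (1 - x))) has_real_derivative - k * sinh (k * (1 - x))) (at x)"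
      by (auto intro!: derivative_eq_intros)
    show "((\<lambda>x. - k * sinh (k * (1 - x))) has_real_derivative - (- k\<^sup>2) * cosh (k * (1 - x))) (at x)"
      by (auto intro!: derivative_eq_intros simp: power2_eq_square)
  qed (use k in \<open>auto simp: right_bc_def\<close>)
  then show ?thesis by blast
qed

text \<open>The minimal eigenvalue is at most the explicit ground-state value, for which coercivity
  is known, and coercivity is monotone. Nothing else about the spectrum has to be known.\<close>

lemma smallest_eigenvalue_coercive:
  assumes "smallest_eigenvalue act q \<mu>" "q > - \<infinity>"
  shows "coercive act q \<mu>"
proof -
  obtain \<nu> where \<nu>: "eigenvalue act q \<nu>" "coercive act q \<nu>"
  proof (cases q)
    case (real r)
    then show ?thesis using that ground_state_Dirichlet[of r] ground_state_Neumann[of r] by (cases act) blast+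
  next
    case PInf
    then show ?thesis using that ground_state_Dirichlet_infinity ground_state_Neumann_infinity by (cases act) blast+
  qed (use assms in auto)
  have "\<mu> \<le> \<nu>" using assms(1) \<nu>(1) by (simp add: smallest_eigenvalue_def)
  then show ?thesis by (rule coercive_mono[OF \<nu>(2)])
qed

lemma qbar_nonneg: "0 \<le> qbar q"
  by (simp add: qbar_def real_of_ereal_pos)

lemma qbar_ge: "q > - \<infinity> \<Longrightarrow> q \<noteq> \<infinity> \<Longrightarrow> - qbar q \<le> real_of_ereal q"
  by (cases q) (auto simp: qbar_def max_def)

text \<open>\<open>exp (- r * x)\<close> for Dirichlet and \<open>cosh (k * (1 - x))\<close> for
  Neumann actuation are positive solutions whose slope at \<open>0\<close> is admissible.
  \<open>min_c\<close> is taken at \<open>\<epsilon> = 1\<close> since it is linear in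
  \<open>\<epsilon>\<close>.\<close>

lemma coercive_min_c:
  assumes q: "q > - \<infinity>"
  shows "coercive act q (- min_c act 1 q)"
proof (cases act)
  case Dirichlet
  define r where "r = qbar q"
  have "coercive Dirichlet q (- r\<^sup>2)"
    by (rule coercive_supersolution[of "\<lambda>x. exp (- r * x)" "\<lambda>x. - r * exp (- r * x)"])
      (use qbar_ge[OF q] in \<open>auto intro!: derivative_eq_intros simp: power2_eq_square r_def\<close>)
  then show ?thesis using Dirichlet by (simp add: min_c_def r_def)
next
  case Neumann
  define r where "r = qbar q"
  have r0: "0 \<le> r" by (simp add: r_def qbar_nonneg)
  \<comment> \<open>The slope condition asks for \<open>r * cosh k <= k * sinh k\<close>. After
    squaring, the summand \<open>1 / 2\<close> is exactly what
    \<open>2 * k\<^sup>2 <= (cosh k)\<^sup>2\<close> pays for.\<close>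
  define k where "k = sqrt (r\<^sup>2 + 1 / 2)"
  have k: "0 \<le> k" "k\<^sup>2 = r\<^sup>2 + 1 / 2" by (auto simp: k_def)
  have le: "r * cosh k \<le> k * sinh k"
  proof (rule power2_le_imp_le)
    have "(1 + k\<^sup>2 / 2)\<^sup>2 \<le> (cosh k)\<^sup>2"
      by (intro power_mono cosh_ge_quadratic k) auto
    moreover have "(1 + k\<^sup>2 / 2)\<^sup>2 - 2 * k\<^sup>2 = (1 - k\<^sup>2 / 2)\<^sup>2" by (simp add: power2_eq_square field_simps)
    ultimately have "2 * k\<^sup>2 \<le> (cosh k)\<^sup>2" using zero_le_power2[of "1 - k\<^sup>2 / 2"] by linarith
    then have "(k\<^sup>2 - 1 / 2) * (cosh k)\<^sup>2 \<le> k\<^sup>2 * ((cosh k)\<^sup>2 - 1)" by (simp add: algebra_simps)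
    then show "(r * cosh k)\<^sup>2 \<le> (k * sinh k)\<^sup>2"
      using k(2) by (simp add: power_mult_distrib sinh_square_eq)
    show "0 \<le> k * sinh k" using k by simp
  qed
  have "q = \<infinity> \<or> - k * sinh k \<le> real_of_ereal q * cosh k"
  proof (cases "q = \<infinity>")
    case False
    have "- r * cosh k \<le> real_of_ereal q * cosh k"
      using qbar_ge[OF q False] by (intro mult_right_mono) (auto simp: r_def)
    then show ?thesis using le by auto
  qed simp
  then have "coercive Neumann q (- k\<^sup>2)"
    by (intro coercive_supersolution[of "\<lambda>x. cosh (k * (1 - x))" "\<lambda>x. - k * sinh (k * (1 - x))"])
      (auto intro!: derivative_eq_intros simp: power2_eq_square)
  then show ?thesis using Neumann k(2) by (simp add: min_c_def r_def)
qed

section \<open>A bound for the kernel\<close>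

text \<open>Expanding \<open>x - z\<close> leaves two ordinary primitives, so nothing is
  differentiated under the integral sign.\<close>

lemma integral_convolution_derivative:
  fixes \<phi> :: "real \<Rightarrow> real"
  assumes \<phi>: "continuous_on {0..1} \<phi>" and x: "x \<in> {0..1}"
  shows "((\<lambda>x. integral {0..x} (\<lambda>z. (x - z) * \<phi> z)) has_real_derivative integral {0..x} \<phi>) (at x within {0..1})"
proof -
  have c: "continuous_on {0..1} (\<lambda>z. z * \<phi> z)" by (intro continuous_intros \<phi>)
  have "((\<lambda>x. x * integral {0..x} \<phi> - integral {0..x} (\<lambda>z. z * \<phi> z)) has_real_derivative integral {0..x} \<phi>) (at x within {0..1})"
    using integral_has_real_derivative[OF \<phi> x] integral_has_real_derivative[OF c x]
    by (auto intro!: derivative_eq_intros)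
  moreover have "y * integral {0..y} \<phi> - integral {0..y} (\<lambda>z. z * \<phi> z) = integral {0..y} (\<lambda>z. (y - z) * \<phi> z)"
    if y: "y \<in> {0..1}" for y
  proof -
    have s: "{0..y} \<subseteq> {0..1}" using y by auto
    have "(\<lambda>z. y * \<phi> z) integrable_on {0..y}" "(\<lambda>z. z * \<phi> z) integrable_on {0..y}"
      by (intro integrable_continuous_real continuous_on_mult continuous_on_const continuous_on_id continuous_on_subset[OF \<phi> s])+
    from Henstock_Kurzweil_Integration.integral_diff[OF this]
    have "integral {0..y} (\<lambda>z. y * \<phi> z - z * \<phi> z) = y * integral {0..y} \<phi> - integral {0..y} (\<lambda>z. z * \<phi> z)"
      by simp
    then show ?thesis by (simp add: left_diff_distrib)
  qed
  ultimately show ?thesis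
    by (rule has_field_derivative_transform_within[where d=1, OF _ zero_less_one x])
qed

lemma mono_on_unit_interval:
  fixes f :: "real \<Rightarrow> real"
  assumes "\<And>x. x \<in> {0..1} \<Longrightarrow> (f has_real_derivative f' x) (at x within {0..1})"
    and "\<And>x. x \<in> {0..1} \<Longrightarrow> 0 \<le> f' x" and x: "0 \<le> x" "x \<le> y" "y \<le> 1"
  shows "f x \<le> f y"
proof (rule DERIV_nonneg_imp_increasing_open[of x y f])
  show "continuous_on {x..y} f"
    by (rule continuous_on_subset[of "{0..1}"], rule DERIV_continuous_on[OF assms(1)]) (use x in auto)
  fix t assume t: "x < t" "t < y"
  then have "t \<in> interior {0..1}" "t \<in> {0..1}" using x by auto
  then show "\<exists>d. DERIV f t :> d \<and> 0 \<le> d"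
    using assms(1)[of t] assms(2)[of t] by (metis at_within_interior)
qed (use x in auto)

text \<open>The profile \<open>a x exp (M x\<^sup>2 / 6)\<close> is a supersolution of \<open>\<psi> = a x + M \<integral>\<^sub>0\<^sup>x (x - z) \<psi>(z) dz\<close>,
  whose exact solution is \<open>a sinh (\<surd>M x) / \<surd>M\<close>.\<close>

definition growth :: "real \<Rightarrow> real \<Rightarrow> real \<Rightarrow> real" where
  "growth a M x = a * x * exp (M * x\<^sup>2 / 6)"

lemma growth_cont: "continuous_on S (growth a M)"
  unfolding growth_def by (intro continuous_intros) auto

text \<open>Both sides vanish at \<open>0\<close> with slope \<open>a\<close>. The second derivative
  of \<open>growth\<close> exceeds \<open>M * growth\<close> by the nonnegative term visible in
  \<open>d2\<close>, and two integrations give the claim.\<close>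

lemma growth_supersolution:
  assumes a: "0 \<le> a" and M: "0 \<le> M" and x: "x \<in> {0..1}"
  shows "a * x + M * integral {0..x} (\<lambda>z. (x - z) * growth a M z) \<le> growth a M x"
proof -
  let ?e = "\<lambda>x::real. exp (M * x\<^sup>2 / 6)"
  let ?I = "\<lambda>x. integral {0..x} (growth a M)"
  have d1: "(growth a M has_real_derivative a * (1 + M * x\<^sup>2 / 3) * ?e x) (at x within S)" for x S
    unfolding growth_def by (auto intro!: derivative_eq_intros simp: power2_eq_square field_simps)
  have d2: "((\<lambda>x. a * (1 + M * x\<^sup>2 / 3) * ?e x) has_real_derivative M * growth a M x + a * M\<^sup>2 * x ^ 3 / 9 * ?e x) (at x within S)" for x S
    unfolding growth_def by (auto intro!: derivative_eq_intros simp: power2_eq_square power3_eq_cube field_simps)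
  have p1: "0 \<le> a * (1 + M * x\<^sup>2 / 3) * ?e x - a - M * ?I x" if x: "x \<in> {0..1}" for x
  proof -
    have "a * (1 + M * 0\<^sup>2 / 3) * ?e 0 - a - M * ?I 0 \<le> a * (1 + M * x\<^sup>2 / 3) * ?e x - a - M * ?I x"
    proof (rule mono_on_unit_interval[where f="\<lambda>x. a * (1 + M * x\<^sup>2 / 3) * ?e x - a - M * ?I x" and x=0])
      fix t :: real assume t: "t \<in> {0..1}"
      show "((\<lambda>x. a * (1 + M * x\<^sup>2 / 3) * ?e x - a - M * ?I x) has_real_derivative
          (M * growth a M t + a * M\<^sup>2 * t ^ 3 / 9 * ?e t) - 0 - M * growth a M t) (at t within {0..1})"
        by (intro DERIV_diff d2 DERIV_const DERIV_cmult integral_has_real_derivative growth_cont t)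
      show "0 \<le> (M * growth a M t + a * M\<^sup>2 * t ^ 3 / 9 * ?e t) - 0 - M * growth a M t"
        using a t by simp
    qed (use x in auto)
    then show ?thesis by simp
  qed
  have "growth a M 0 - a * 0 - M * integral {0..0} (\<lambda>z. (0 - z) * growth a M z)
      \<le> growth a M x - a * x - M * integral {0..x} (\<lambda>z. (x - z) * growth a M z)"
  proof (rule mono_on_unit_interval[where f="\<lambda>x. growth a M x - a * x - M * integral {0..x} (\<lambda>z. (x - z) * growth a M z)" and x=0])
    fix t :: real assume t: "t \<in> {0..1}"
    show "((\<lambda>x. growth a M x - a * x - M * integral {0..x} (\<lambda>z. (x - z) * growth a M z)) has_real_derivative
        a * (1 + M * t\<^sup>2 / 3) * ?e t - a - M * ?I t) (at t within {0..1})"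
      by (intro DERIV_diff d1 DERIV_cmult_Id DERIV_cmult integral_convolution_derivative growth_cont t)
    show "0 \<le> a * (1 + M * t\<^sup>2 / 3) * ?e t - a - M * ?I t" by (rule p1[OF t])
  qed (use x in auto)
  then show ?thesis by (simp add: growth_def)
qed

text \<open>\<open>f\<close> depends on further coordinates, and nothing is known about the
  regularity of its supremum at fixed \<open>\<xi>\<close>; so \<open>step\<close> is fed continuous
  majorants only. The excess over the supersolution starts as the crude bound \<open>Q\<close>, and
  after \<open>n\<close> rounds it is a term of an exponential series, which tends to
  \<open>0\<close>.\<close>

lemma iterated_Gronwall:
  fixes f :: "'p \<Rightarrow> real" and \<xi> :: "'p \<Rightarrow> real"
  assumes \<xi>: "\<And>p. p \<in> P \<Longrightarrow> \<xi> p \<in> {0..1}" and Q: "\<And>p. p \<in> P \<Longrightarrow> f p \<le> Q"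
    and a: "0 \<le> a" and M: "0 \<le> M"
    and step: "\<And>\<phi> p. continuous_on {0..1} \<phi> \<Longrightarrow> (\<And>x. x \<in> {0..1} \<Longrightarrow> 0 \<le> \<phi> x) \<Longrightarrow>
        (\<And>p. p \<in> P \<Longrightarrow> f p \<le> \<phi> (\<xi> p)) \<Longrightarrow> p \<in> P \<Longrightarrow>
        f p \<le> a * \<xi> p + M * integral {0..\<xi> p} (\<lambda>z. (\<xi> p - z) * \<phi> z)"
    and p: "p \<in> P"
  shows "f p \<le> growth a M (\<xi> p)"
proof -
  define Q' where "Q' = max Q 0"
  let ?c = "\<lambda>n x. Q' * ((M * x) ^ n / fact n)"
  have g0: "0 \<le> growth a M x" if "x \<in> {0..1}" for x using that a by (simp add: growth_def)
  have bound: "f p \<le> growth a M (\<xi> p) + ?c n (\<xi> p)" if "p \<in> P" for n p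
    using that
  proof (induction n arbitrary: p)
    case 0
    then show ?case using Q[of p] g0[OF \<xi>, of p] by (simp add: Q'_def max_def)
  next
    case (Suc n)
    let ?\<phi> = "\<lambda>x. growth a M x + ?c n x"
    let ?x = "\<xi> p"
    have x: "?x \<in> {0..1}" using \<xi> Suc.prems by blast
    have "f p \<le> a * ?x + M * integral {0..?x} (\<lambda>z. (?x - z) * ?\<phi> z)"
    proof (rule step[OF _ _ Suc.IH Suc.prems])
      show "continuous_on {0..1} ?\<phi>" by (intro continuous_intros growth_cont) auto
      show "0 \<le> ?\<phi> x" if "x \<in> {0..1}" for x
        using g0[OF that] that M by (simp add: Q'_def)
    qed
    also have "integral {0..?x} (\<lambda>z. (?x - z) * ?\<phi> z)
        = integral {0..?x} (\<lambda>z. (?x - z) * growth a M z) + integral {0..?x} (\<lambda>z. (?x - z) * ?c n z)"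
      by (subst integral_add[symmetric])
        (auto intro!: integrable_continuous_real continuous_intros growth_cont simp: algebra_simps)
    also have "M * (\<dots>) \<le> M * integral {0..?x} (\<lambda>z. (?x - z) * growth a M z) + ?c (Suc n) ?x"
    proof -
      \<comment> \<open>The crude estimate \<open>x - z <= 1\<close> suffices: one integration
        already advances the series by one index.\<close>
      have "integral {0..?x} (\<lambda>z. (?x - z) * ?c n z) \<le> integral {0..?x} (\<lambda>z. ?c n z)"
      proof (rule integral_le)
        fix z assume z: "z \<in> {0..?x}"
        have "(?x - z) * ?c n z \<le> 1 * ?c n z"
          using z x M by (intro mult_right_mono) (auto simp: Q'_def)
        then show "(?x - z) * ?c n z \<le> ?c n z" by simp
      qed (auto intro!: integrable_continuous_real continuous_intros)
      also have "integral {0..?x} (\<lambda>z. ?c n z) = Q' * M ^ n * ?x ^ Suc n / fact (Suc n)"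
      proof (rule integral_unique)
        have "((\<lambda>z. ?c n z) has_integral (Q' * M ^ n * ?x ^ Suc n / fact (Suc n) - Q' * M ^ n * 0 ^ Suc n / fact (Suc n))) {0..?x}"
        proof (rule fundamental_theorem_of_calculus)
          fix z assume "z \<in> {0..?x}"
          have "((\<lambda>z. Q' * M ^ n * z ^ Suc n / fact (Suc n)) has_real_derivative Q' * M ^ n * (real (Suc n) * z ^ n) / fact (Suc n)) (at z within {0..?x})"
            by (auto intro!: derivative_eq_intros simp del: power_Suc fact_Suc)
          moreover have "Q' * M ^ n * (real (Suc n) * z ^ n) / fact (Suc n) = ?c n z"
            by (simp add: power_mult_distrib del: of_nat_Suc)
          ultimately show "((\<lambda>z. Q' * M ^ n * z ^ Suc n / fact (Suc n)) has_vector_derivative ?c n z) (at z within {0..?x})"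
            by (simp only: has_real_derivative_iff_has_vector_derivative)
        qed (use x in auto)
        then show "((\<lambda>z. ?c n z) has_integral Q' * M ^ n * ?x ^ Suc n / fact (Suc n)) {0..?x}" by simp
      qed
      finally have "M * integral {0..?x} (\<lambda>z. (?x - z) * ?c n z) \<le> M * (Q' * M ^ n * ?x ^ Suc n / fact (Suc n))"
        by (rule mult_left_mono[OF _ M])
      also have "\<dots> = ?c (Suc n) ?x" by (simp add: power_mult_distrib)
      finally show ?thesis by (simp add: distrib_left)
    qed
    finally show ?case using growth_supersolution[OF a M x] by linarith
  qed
  have "(\<lambda>n. (M * \<xi> p) ^ n / fact n) \<longlonglongrightarrow> 0"
    using summable_LIMSEQ_zero[OF summable_exp[of "M * \<xi> p"]] by (simp add: divide_inverse mult.commute)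
  then have "(\<lambda>n. growth a M (\<xi> p) + ?c n (\<xi> p)) \<longlonglongrightarrow> growth a M (\<xi> p) + Q' * 0"
    by (intro tendsto_intros)
  then show ?thesis
    using bound[OF p] by (intro LIMSEQ_le_const[of _ _ "f p"]) auto
qed

context backstepping
begin

lemma K_deriv_x:
  assumes "C1_triangle F Fx Fy" "0 \<le> y" "y < x" "x < 1"
  shows "((\<lambda>x. F (x, y)) has_real_derivative Fx (x, y)) (at x)"
  using C1_triangle_curve[OF assms(1), of "{y<..<1}" "\<lambda>_. y" "\<lambda>x. x" x 1 0] assms(2-)
  by (auto simp: at_within_open[of _ "{y<..<1}"])

lemma K_deriv_y:
  assumes "C1_triangle F Fx Fy" "0 < y" "y < x" "x \<le> 1"
  shows "((\<lambda>y. F (x, y)) has_real_derivative Fy (x, y)) (at y)"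
  using C1_triangle_curve[OF assms(1), of "{0<..<x}" "\<lambda>y. y" "\<lambda>_. x" y 0 1] assms(2-)
  by (auto simp: at_within_open[of _ "{0<..<x}"])

text \<open>Schwarz's theorem by two mean value theorems for the double difference over a small
  square. The kernel is specified with separate \<open>Kxy\<close> and \<open>Kyx\<close>, which
  must cancel along characteristics.\<close>

lemma mixed_derivatives_eq:
  assumes xy: "0 < y" "y < x" "x < 1"
  shows "Kxy (x, y) = Kyx (x, y)"
proof (rule ccontr)
  assume ne: "Kxy (x, y) \<noteq> Kyx (x, y)"
  define e where "e = \<bar>Kxy (x, y) - Kyx (x, y)\<bar> / 2"
  have e: "e > 0" using ne by (simp add: e_def)
  have tr: "(x, y) \<in> triangle" using xy by (simp add: triangle_def)
  obtain \<delta>1 where d1: "\<delta>1 > 0" "\<And>p. p \<in> triangle \<Longrightarrow> dist p (x, y) < \<delta>1 \<Longrightarrow> dist (Kxy p) (Kxy (x, y)) < e"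
    using KxD(2) tr e unfolding continuous_on_iff by blast
  obtain \<delta>2 where d2: "\<delta>2 > 0" "\<And>p. p \<in> triangle \<Longrightarrow> dist p (x, y) < \<delta>2 \<Longrightarrow> dist (Kyx p) (Kyx (x, y)) < e"
    using KyD(1) tr e unfolding continuous_on_iff by blast
  define h where "h = min (min (\<delta>1 / 2) (\<delta>2 / 2)) (min ((x - y) / 2) ((1 - x) / 2))"
  have h: "0 < h" "2 * h \<le> \<delta>1" "2 * h \<le> \<delta>2" "y + h < x" "x + h < 1"
    using d1(1) d2(1) xy by (auto simp: h_def min_def field_simps)
  have near: "(s, t) \<in> triangle \<and> dist (s, t) (x, y) < 2 * h" if "x < s" "s < x + h" "y < t" "t < y + h" for s t
  proof -
    have "dist (s, t) (x, y) \<le> \<bar>s - x\<bar> + \<bar>t - y\<bar>"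
      by (simp add: dist_Pair_Pair dist_real_def sqrt_sum_squares_le_sum_abs)
    then show ?thesis using that h xy by (auto simp: triangle_def)
  qed
  define D where "D = (K (x + h, y + h) - K (x + h, y)) - (K (x, y + h) - K (x, y))"
  obtain s t where st: "x < s" "s < x + h" "y < t" "t < y + h" "D = h * (h * Kxy (s, t))"
  proof -
    have "\<exists>s. x < s \<and> s < x + h \<and> (K (x + h, y + h) - K (x + h, y)) - (K (x, y + h) - K (x, y))
        = (x + h - x) * (Kx (s, y + h) - Kx (s, y))"
      by (rule MVT2) (use h xy in \<open>auto intro!: DERIV_diff K_deriv_x[OF K]\<close>)
    then obtain s where s: "x < s" "s < x + h" "D = h * (Kx (s, y + h) - Kx (s, y))" by (auto simp: D_def)
    have "\<exists>t. y < t \<and> t < y + h \<and> Kx (s, y + h) - Kx (s, y) = (y + h - y) * Kxy (s, t)"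
      by (rule MVT2) (use h xy s in \<open>auto intro!: K_deriv_y[OF Kx]\<close>)
    then show ?thesis using that s by auto
  qed
  obtain s' t' where st': "x < s'" "s' < x + h" "y < t'" "t' < y + h" "D = h * (h * Kyx (s', t'))"
  proof -
    have "\<exists>t. y < t \<and> t < y + h \<and> (K (x + h, y + h) - K (x, y + h)) - (K (x + h, y) - K (x, y))
        = (y + h - y) * (Ky (x + h, t) - Ky (x, t))"
      by (rule MVT2) (use h xy in \<open>auto intro!: DERIV_diff K_deriv_y[OF K]\<close>)
    then obtain t where t: "y < t" "t < y + h" "D = h * (Ky (x + h, t) - Ky (x, t))" by (auto simp: D_def)
    have "\<exists>s. x < s \<and> s < x + h \<and> Ky (x + h, t) - Ky (x, t) = (x + h - x) * Kyx (s, t)"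
      by (rule MVT2) (use h xy t in \<open>auto intro!: K_deriv_x[OF Ky]\<close>)
    then show ?thesis using that t by auto
  qed
  have "Kxy (s, t) = Kyx (s', t')" using st(5) st'(5) h(1) by auto
  moreover have "dist (Kxy (s, t)) (Kxy (x, y)) < e" using near[OF st(1-4)] h d1(2) by auto
  moreover have "dist (Kyx (s', t')) (Kyx (x, y)) < e" using near[OF st'(1-4)] h d2(2) by auto
  ultimately show False unfolding dist_real_def e_def abs_real_def by (auto split: if_splits)
qed

text \<open>In the direction \<open>(1, -1)\<close> the derivative of \<open>Kx + Ky\<close> is
  \<open>B * K\<close>, starting from \<open>diag_sum\<close> on the diagonal. In the direction
  \<open>(1, 1)\<close> the derivative of \<open>K\<close> is \<open>Kx + Ky\<close>, starting from
  the edge \<open>y = 0\<close>, where the left condition determines \<open>K\<close>. The resulting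
  Volterra inequality is closed by \<open>iterated_Gronwall\<close>.\<close>

lemma kernel_bound:
  assumes M: "\<And>y. y \<in> {0..1} \<Longrightarrow> \<bar>B y\<bar> \<le> M"
    and s: "0 \<le> s" "q \<noteq> \<infinity> \<Longrightarrow> - s \<le> real_of_ereal q"
    and xy: "(x, y) \<in> triangle"
  shows "\<bar>K (x, y)\<bar> \<le> exp (s * x) * growth (M / 2) M x"
proof -
  have M0: "0 \<le> M" using M[of 0] by simp
  obtain C where C: "C > 0" "\<And>x y. 0 \<le> y \<Longrightarrow> y \<le> x \<Longrightarrow> x \<le> 1 \<Longrightarrow> \<bar>K (x, y)\<bar> \<le> C"
    using continuous_on_triangle_bounded[OF KD(3)] by blast
  \<comment> \<open>The weight absorbs the exponential growth along the edge \<open>y = 0\<close>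
    that a negative \<open>q\<close> can cause.\<close>
  define f where "f = (\<lambda>p. \<bar>K p\<bar> * exp (- (s * fst p)))"
  have "f (x, y) \<le> growth (M / 2) M (fst (x, y))"
  proof (rule iterated_Gronwall[where P=triangle and \<xi>=fst and Q=C and f=f])
    fix p assume "p \<in> triangle"
    then obtain x y where p: "p = (x, y)" "0 \<le> y" "y \<le> x" "x \<le> 1" by (auto simp: triangle_def)
    have "\<bar>K (x, y)\<bar> * exp (- (s * x)) \<le> C * 1"
      using C p s(1) by (intro mult_mono) auto
    then show "f p \<le> C" by (simp add: f_def p)
    show "fst p \<in> {0..1}" using p by auto
  next
    fix \<phi> :: "real \<Rightarrow> real" and p :: "real \<times> real"
    assume \<phi>: "continuous_on {0..1} \<phi>" and \<phi>0: "\<And>x. x \<in> {0..1} \<Longrightarrow> 0 \<le> \<phi> x"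
      and f\<phi>: "\<And>p. p \<in> triangle \<Longrightarrow> f p \<le> \<phi> (fst p)" and p: "p \<in> triangle"
    have K\<phi>: "\<bar>K (x, y)\<bar> \<le> exp (s * x) * \<phi> x" if "0 \<le> y" "y \<le> x" "x \<le> 1" for x y
    proof -
      have "\<bar>K (x, y)\<bar> * exp (- (s * x)) \<le> \<phi> x" using f\<phi>[of "(x, y)"] that by (auto simp: f_def triangle_def)
      then show ?thesis by (simp add: exp_minus field_simps)
    qed
    \<comment> \<open>Up to the weight, \<open>Q\<close> is to bound \<open>K\<close> and its
      derivative \<open>q1\<close> is to bound \<open>Kx + Ky\<close>; \<open>q1 0 = M / 2\<close>
      is the bound on the diagonal.\<close>
    define q1 where "q1 = (\<lambda>r. M / 2 + M * integral {0..r} \<phi>)"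
    define Q where "Q = (\<lambda>r. M / 2 * r + M * integral {0..r} (\<lambda>z. (r - z) * \<phi> z))"
    have Q': "(Q has_real_derivative q1 r) (at r within {0..1})" if "r \<in> {0..1}" for r
      unfolding Q_def q1_def by (intro DERIV_add DERIV_cmult_Id DERIV_cmult integral_convolution_derivative \<phi> that)
    have q1': "(q1 has_real_derivative M * \<phi> r) (at r within {0..1})" if "r \<in> {0..1}" for r
      using integral_has_real_derivative[OF \<phi> that] unfolding q1_def by (auto intro!: derivative_eq_intros)
    have Qc: "continuous_on {0..1} Q" by (rule DERIV_continuous_on[OF Q'])
    have q1c: "continuous_on {0..1} q1" by (rule DERIV_continuous_on[OF q1'])
    have at: "at r within {0..1} = at r" if "0 < r" "r < 1" for r :: real
      by (rule at_within_interior) (use that in auto)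
    have q1m: "q1 a \<le> q1 x" if "0 \<le> a" "a \<le> x" "x \<le> 1" for a x
      by (rule mono_on_unit_interval[OF q1']) (use that \<phi>0 M0 in auto)
    have q10: "M / 2 \<le> q1 a" if "0 \<le> a" "a \<le> 1" for a
      using q1m[of 0 a] that by (simp add: q1_def)
    have S: "\<bar>Kx (x, y) + Ky (x, y)\<bar> \<le> exp (s * x) * q1 x" if xy: "0 \<le> y" "y \<le> x" "x \<le> 1" for x y
    proof -
      define a where "a = (x + y) / 2"
      define \<sigma> where "\<sigma> = (x - y) / 2"
      have as: "a + \<sigma> = x" "a - \<sigma> = y" "0 \<le> \<sigma>" "0 \<le> a" "a \<le> 1" "a \<le> x" using xy by (auto simp: a_def \<sigma>_def field_simps)
      have ex: "1 \<le> exp (s * x)" using s xy by simp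
      have diag: "\<bar>Kx (a, a) + Ky (a, a)\<bar> \<le> M / 2" using diag_sum[of a] M[of a] as by auto
      show ?thesis
      proof (cases "\<sigma> = 0")
        case True
        then have "x = a" "y = a" using as by auto
        moreover have "M / 2 \<le> 1 * q1 a" using q10[of a] as by simp
        moreover have "1 * q1 a \<le> exp (s * x) * q1 a" by (intro mult_right_mono ex) (use q10[of a] as M0 in auto)
        ultimately show ?thesis using diag by auto
      next
        case False
        then have \<sigma>: "0 < \<sigma>" using as by simp
        have "norm ((Kx (a + \<sigma>, a - \<sigma>) + Ky (a + \<sigma>, a - \<sigma>)) - (Kx (a + 0, a - 0) + Ky (a + 0, a - 0)))
            \<le> exp (s * x) * q1 (a + \<sigma>) - exp (s * x) * q1 (a + 0)"
        proof (rule differentiable_bound_general[OF \<sigma>])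
          show "continuous_on {0..\<sigma>} (\<lambda>r. Kx (a + r, a - r) + Ky (a + r, a - r))"
            by (intro continuous_on_add continuous_on_triangle_curve[OF KD(1)] continuous_on_triangle_curve[OF KD(2)])
              (use as xy in \<open>auto intro!: continuous_intros\<close>)
          show "continuous_on {0..\<sigma>} (\<lambda>r. exp (s * x) * q1 (a + r))"
            by (intro continuous_intros continuous_on_compose2[OF q1c]) (use as xy in auto)
          fix r assume r: "0 < r" "r < \<sigma>"
          have pos: "0 < a - r" "a - r < a + r" "a + r < 1" using r as xy by auto
          have "((\<lambda>r. Kx (a + r, a - r) + Ky (a + r, a - r)) has_real_derivative
              (Kxx (a + r, a - r) * 1 + Kxy (a + r, a - r) * (-1)) + (Kyx (a + r, a - r) * 1 + Kyy (a + r, a - r) * (-1)))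
              (at r within {0<..<\<sigma>})"
            by (intro DERIV_add C1_triangle_curve[OF Kx] C1_triangle_curve[OF Ky])
              (use r as xy in \<open>auto intro!: derivative_eq_intros\<close>)
          moreover have "(Kxx (a + r, a - r) * 1 + Kxy (a + r, a - r) * (-1)) + (Kyx (a + r, a - r) * 1 + Kyy (a + r, a - r) * (-1))
              = B (a - r) * K (a + r, a - r)"
            using mixed_derivatives_eq[OF pos] pde[of "a + r" "a - r"] pos by (simp add: B_def triangle_def)
          ultimately show "((\<lambda>r. Kx (a + r, a - r) + Ky (a + r, a - r)) has_vector_derivative B (a - r) * K (a + r, a - r)) (at r)"
            using r by (simp add: has_real_derivative_iff_has_vector_derivative at_within_open[of _ "{0<..<\<sigma>}"])
          have "(q1 has_real_derivative M * \<phi> (a + r)) (at (a + r))" using q1'[of "a + r"] at[of "a + r"] pos r as by auto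
          then have "((\<lambda>r. q1 (r + a)) has_real_derivative M * \<phi> (a + r)) (at r)"
            using DERIV_shift[of q1 "M * \<phi> (a + r)" r a] by (simp add: add.commute)
          then have "((\<lambda>r. exp (s * x) * q1 (a + r)) has_real_derivative exp (s * x) * (M * \<phi> (a + r))) (at r)"
            using DERIV_cmult by (simp add: add.commute)
          then show "((\<lambda>r. exp (s * x) * q1 (a + r)) has_vector_derivative exp (s * x) * (M * \<phi> (a + r))) (at r)"
            by (simp only: has_real_derivative_iff_has_vector_derivative)
          have "\<bar>B (a - r)\<bar> * \<bar>K (a + r, a - r)\<bar> \<le> M * (exp (s * (a + r)) * \<phi> (a + r))"
            by (intro mult_mono M K\<phi>) (use pos as r M0 in auto)
          also have "\<dots> \<le> M * (exp (s * x) * \<phi> (a + r))"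
            by (intro mult_left_mono mult_right_mono) (use pos as r M0 s \<phi>0 in \<open>auto intro!: mult_left_mono\<close>)
          finally show "norm (B (a - r) * K (a + r, a - r)) \<le> exp (s * x) * (M * \<phi> (a + r))"
            by (simp add: abs_mult mult_ac)
        qed
        then have "\<bar>Kx (x, y) + Ky (x, y)\<bar> \<le> \<bar>Kx (a, a) + Ky (a, a)\<bar> + (exp (s * x) * q1 x - exp (s * x) * q1 a)"
          unfolding as by simp
        moreover have "M / 2 \<le> exp (s * x) * q1 a"
          using mult_mono[OF ex q10[of a]] as M0 by auto
        ultimately show ?thesis using diag by linarith
      qed
    qed
    \<comment> \<open>In the Robin case the boundary condition makes
      \<open>exp (r * x) * K (x, 0)\<close> a primitive of \<open>exp (r * x) * (Kx + Ky)\<close>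
      with \<open>r = q\<close>; as \<open>0 <= r + s\<close>, the weight can be frozen at the right
      end.\<close>
    have h: "\<bar>K (x, 0)\<bar> \<le> exp (s * x) * Q x" if x: "0 \<le> x" "x \<le> 1" for x
    proof (cases "q = \<infinity> \<or> x = 0")
      case True
      then have "K (x, 0) = 0" using bc[of x] x diag_0 by (auto simp: left_bc_def)
      moreover have "Q 0 \<le> Q x"
        by (rule mono_on_unit_interval[OF Q']) (use x q10 M0 in force)+
      ultimately show ?thesis by (simp add: Q_def)
    next
      case False
      define r where "r = real_of_ereal q"
      have x0: "0 < x" and rs: "0 \<le> r + s" using False x s by (auto simp: r_def)
      have "norm (exp (r * x) * K (x, 0) - exp (r * 0) * K (0, 0)) \<le> exp ((r + s) * x) * Q x - exp ((r + s) * x) * Q 0"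
      proof (rule differentiable_bound_general[OF x0])
        show "continuous_on {0..x} (\<lambda>t. exp (r * t) * K (t, 0))"
          by (intro continuous_on_mult continuous_on_triangle_curve[OF KD(3)]) (use x in \<open>auto intro!: continuous_intros\<close>)
        show "continuous_on {0..x} (\<lambda>t. exp ((r + s) * x) * Q t)"
          by (intro continuous_intros continuous_on_subset[OF Qc]) (use x in auto)
        fix t assume t: "0 < t" "t < x"
        have "((\<lambda>t. exp (r * t) * K (t, 0)) has_real_derivative r * exp (r * t) * K (t, 0) + Kx (t, 0) * exp (r * t)) (at t)"
          by (rule DERIV_mult[OF _ K_deriv_x[OF K]]) (use t x in \<open>auto intro!: derivative_eq_intros\<close>)
        moreover have "r * exp (r * t) * K (t, 0) + Kx (t, 0) * exp (r * t) = exp (r * t) * (Kx (t, 0) + Ky (t, 0))"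
          using bc[of t] t x False by (simp add: left_bc_def r_def algebra_simps)
        ultimately show "((\<lambda>t. exp (r * t) * K (t, 0)) has_vector_derivative exp (r * t) * (Kx (t, 0) + Ky (t, 0))) (at t)"
          by (simp only: has_real_derivative_iff_has_vector_derivative)
        have "((\<lambda>t. exp ((r + s) * x) * Q t) has_real_derivative exp ((r + s) * x) * q1 t) (at t)"
          using Q'[of t] at[of t] t x by (intro DERIV_cmult) auto
        then show "((\<lambda>t. exp ((r + s) * x) * Q t) has_vector_derivative exp ((r + s) * x) * q1 t) (at t)"
          by (simp only: has_real_derivative_iff_has_vector_derivative)
        have "exp (r * t) * \<bar>Kx (t, 0) + Ky (t, 0)\<bar> \<le> exp (r * t) * (exp (s * t) * q1 t)"
          by (intro mult_left_mono S) (use t x in auto)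
        also have "\<dots> = exp ((r + s) * t) * q1 t" by (simp add: exp_add distrib_right)
        also have "\<dots> \<le> exp ((r + s) * x) * q1 t"
          using q10[of t] M0 t x rs by (intro mult_right_mono) (auto intro!: mult_left_mono)
        finally show "norm (exp (r * t) * (Kx (t, 0) + Ky (t, 0))) \<le> exp ((r + s) * x) * q1 t"
          by (simp add: abs_mult)
      qed
      then have "exp (r * x) * \<bar>K (x, 0)\<bar> \<le> exp (r * x) * (exp (s * x) * Q x)"
        by (simp add: diag_0 abs_mult Q_def exp_add distrib_right mult.assoc)
      then show ?thesis by simp
    qed
    obtain x y where pxy: "p = (x, y)" and xy: "0 \<le> y" "y \<le> x" "x \<le> 1" using p by (auto simp: triangle_def)
    have "\<bar>K (x, y)\<bar> \<le> exp (s * x) * Q x"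
    proof (cases "y = 0")
      case False
      then have y0: "0 < y" using xy by simp
      have "norm (K (x - y + y, y) - K (x - y + 0, 0)) \<le> exp (s * x) * Q (x - y + y) - exp (s * x) * Q (x - y + 0)"
      proof (rule differentiable_bound_general[OF y0])
        show "continuous_on {0..y} (\<lambda>r. K (x - y + r, r))"
          by (intro continuous_on_triangle_curve[OF KD(3)]) (use xy in \<open>auto intro!: continuous_intros\<close>)
        show "continuous_on {0..y} (\<lambda>r. exp (s * x) * Q (x - y + r))"
          by (intro continuous_intros continuous_on_compose2[OF Qc]) (use xy in auto)
        fix r assume r: "0 < r" "r < y"
        have "((\<lambda>r. K (x - y + r, r)) has_real_derivative Kx (x - y + r, r) * 1 + Ky (x - y + r, r) * 1) (at r within {0<..<y})"
          by (intro C1_triangle_curve[OF K]) (use r xy in \<open>auto intro!: derivative_eq_intros\<close>)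
        then show "((\<lambda>r. K (x - y + r, r)) has_vector_derivative Kx (x - y + r, r) + Ky (x - y + r, r)) (at r)"
          using r by (simp add: has_real_derivative_iff_has_vector_derivative at_within_open[of _ "{0<..<y}"])
        have "(Q has_real_derivative q1 (r + (x - y))) (at (r + (x - y)))" using Q'[of "r + (x - y)"] at[of "r + (x - y)"] xy r by auto
        then have "((\<lambda>r. Q (r + (x - y))) has_real_derivative q1 (r + (x - y))) (at r)"
          using DERIV_shift[of Q "q1 (r + (x - y))" r "x - y"] by simp
        then have "((\<lambda>r. exp (s * x) * Q (r + (x - y))) has_real_derivative exp (s * x) * q1 (r + (x - y))) (at r)"
          by (rule DERIV_cmult)
        then show "((\<lambda>r. exp (s * x) * Q (x - y + r)) has_vector_derivative exp (s * x) * q1 (x - y + r)) (at r)"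
          by (simp only: has_real_derivative_iff_has_vector_derivative add.commute)
        have "\<bar>Kx (x - y + r, r) + Ky (x - y + r, r)\<bar> \<le> exp (s * (x - y + r)) * q1 (x - y + r)"
          by (rule S) (use r xy in auto)
        also have "\<dots> \<le> exp (s * x) * q1 (x - y + r)"
          using q10[of "x - y + r"] M0 r xy s by (intro mult_right_mono) (auto intro!: mult_left_mono)
        finally show "norm (Kx (x - y + r, r) + Ky (x - y + r, r)) \<le> exp (s * x) * q1 (x - y + r)" by simp
      qed
      then have "\<bar>K (x, y)\<bar> \<le> \<bar>K (x - y, 0)\<bar> + (exp (s * x) * Q x - exp (s * x) * Q (x - y))" by simp
      moreover have "\<bar>K (x - y, 0)\<bar> \<le> exp (s * (x - y)) * Q (x - y)" by (rule h) (use xy in auto)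
      moreover have "exp (s * (x - y)) * Q (x - y) \<le> exp (s * x) * Q (x - y)"
      proof (rule mult_right_mono)
        have "Q 0 \<le> Q (x - y)" by (rule mono_on_unit_interval[OF Q']) (use xy q10 M0 in force)+
        then show "0 \<le> Q (x - y)" by (simp add: Q_def)
      qed (use xy s in \<open>auto intro!: mult_left_mono\<close>)
      ultimately show ?thesis by linarith
    qed (use h xy in auto)
    then have "f p \<le> Q x" by (simp add: f_def pxy exp_minus field_simps)
    then show "f p \<le> M / 2 * fst p + M * integral {0..fst p} (\<lambda>z. (fst p - z) * \<phi> z)" by (simp add: pxy Q_def)
  qed (use M0 xy in auto)
  then show ?thesis by (simp add: f_def exp_minus field_simps)
qed

end

section \<open>Sideways wave equation and the inverse transform\<close>

text \<open>Banach's fixed point theorem for the twice integrated equation. The unknown is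
  \<open>y = exp (- l * x) * u\<close>: this weight makes the map a contraction on the whole
  interval at once.\<close>

lemma linear_ODE_solution:
  fixes c :: "real \<Rightarrow> real" and \<alpha> \<beta> :: real
  assumes c: "continuous_on {0..1} c"
  obtains u u' where "\<And>x. x \<in> {0..1} \<Longrightarrow> (u has_real_derivative u' x) (at x within {0..1})"
    "\<And>x. x \<in> {0..1} \<Longrightarrow> (u' has_real_derivative c x * u x) (at x within {0..1})"
    "u 0 = \<alpha>" "u' 0 = \<beta>"
proof -
  obtain C where C: "\<And>x. x \<in> {0..1} \<Longrightarrow> \<bar>c x\<bar> \<le> C" using continuous_on_Icc_bounded[OF c] by blast
  have C0: "0 \<le> C" using C[of 0] by simp
  \<comment> \<open>The contraction factor is at most \<open>C / l\<close>, hence at most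
    \<open>1 / 2\<close>.\<close>
  define l where "l = 2 * C + 1"
  have l: "l > 0" using C0 by (simp add: l_def)
  \<comment> \<open>Clamping to the interval turns continuous functions on \<open>{0..1}\<close>
    into bounded continuous functions on the line, which form a complete space.\<close>
  define cl :: "real \<Rightarrow> real" where "cl = (\<lambda>x. max 0 (min 1 x))"
  have cl: "cl x \<in> {0..1}" for x by (auto simp: cl_def)
  have clc: "continuous_on UNIV cl" unfolding cl_def by (intro continuous_intros)
  define G where "G = (\<lambda>y x. exp (- l * x) * (\<alpha> + \<beta> * x + integral {0..x} (\<lambda>z. (x - z) * (c z * exp (l * z) * y z))))"
  have cy: "continuous_on {0..1} (\<lambda>z. c z * exp (l * z) * y z)" if "continuous_on {0..1} y" for y
    by (intro continuous_intros c that)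
  have Gc: "continuous_on {0..1} (G y)" if "continuous_on {0..1} y" for y
    unfolding G_def
    by (intro continuous_intros DERIV_continuous_on[OF integral_convolution_derivative[OF cy[OF that]]])
  have Gb: "(\<lambda>x. G (apply_bcontfun y) (cl x)) \<in> bcontfun" for y
  proof -
    have yc: "continuous_on {0..1} (apply_bcontfun y)"
      by simp
    have "continuous_on UNIV (\<lambda>x. G (apply_bcontfun y) (cl x))"
      by (rule continuous_on_compose2[OF Gc[OF yc] clc]) (use cl in auto)
    moreover obtain D where "\<And>x. x \<in> {0..1} \<Longrightarrow> \<bar>G (apply_bcontfun y) x\<bar> \<le> D"
      using continuous_on_Icc_bounded[OF Gc[OF yc]] by blast
    then have "bounded (range (\<lambda>x. G (apply_bcontfun y) (cl x)))"
      using cl by (auto intro!: boundedI[where B=D])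
    ultimately show ?thesis by (simp add: bcontfun_def)
  qed
  define T where "T = (\<lambda>y. Bcontfun (\<lambda>x. G (apply_bcontfun y) (cl x)))"
  have T: "apply_bcontfun (T y) x = G (apply_bcontfun y) (cl x)" for y x
    unfolding T_def using Bcontfun_inverse[OF Gb] by simp
  have "\<exists>!y. T y = y"
  proof (rule banach_fix_type[of "1 / 2"])
    show "\<forall>f g. dist (T f) (T g) \<le> 1 / 2 * dist f g"
    proof (intro allI dist_bound)
      fix f g :: "real \<Rightarrow>\<^sub>C real" and x0 :: real
      define x where "x = cl x0"
      have x: "x \<in> {0..1}" by (simp add: x_def cl del: atLeastAtMost_iff)
      have s: "{0..x} \<subseteq> {0..1}" using x by auto
      let ?f = "apply_bcontfun f" and ?g = "apply_bcontfun g"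
      have fc: "continuous_on {0..x} ?f" "continuous_on {0..x} ?g"
        by simp_all
      have i: "(\<lambda>z. (x - z) * (c z * exp (l * z) * y z)) integrable_on {0..x}" if "continuous_on {0..x} y" for y
        by (intro integrable_continuous_real continuous_intros continuous_on_subset[OF c s] that)
      have "dist (apply_bcontfun (T f) x0) (apply_bcontfun (T g) x0)
          = exp (- l * x) * \<bar>integral {0..x} (\<lambda>z. (x - z) * (c z * exp (l * z) * ?f z)) - integral {0..x} (\<lambda>z. (x - z) * (c z * exp (l * z) * ?g z))\<bar>"
        unfolding T G_def x_def[symmetric] dist_real_def by (simp flip: right_diff_distrib add: abs_mult)
      also have "integral {0..x} (\<lambda>z. (x - z) * (c z * exp (l * z) * ?f z)) - integral {0..x} (\<lambda>z. (x - z) * (c z * exp (l * z) * ?g z))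
          = integral {0..x} (\<lambda>z. (x - z) * (c z * exp (l * z) * (?f z - ?g z)))"
        using Henstock_Kurzweil_Integration.integral_diff[OF i[OF fc(1)] i[OF fc(2)]] by (simp add: algebra_simps)
      also have "\<bar>\<dots>\<bar> \<le> integral {0..x} (\<lambda>z. C * dist f g * exp (l * z))"
      proof -
        have "norm (integral {0..x} (\<lambda>z. (x - z) * (c z * exp (l * z) * (?f z - ?g z)))) \<le> integral {0..x} (\<lambda>z. C * dist f g * exp (l * z))"
        proof (rule integral_norm_bound_integral)
          show "(\<lambda>z. (x - z) * (c z * exp (l * z) * (?f z - ?g z))) integrable_on {0..x}"
            by (intro i continuous_intros fc)
          show "(\<lambda>z. C * dist f g * exp (l * z)) integrable_on {0..x}"
            by (intro integrable_continuous_real continuous_intros)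
          fix z assume z: "z \<in> {0..x}"
          have "\<bar>?f z - ?g z\<bar> \<le> dist f g" using dist_bounded[of f z g] by (simp add: dist_real_def)
          then have "\<bar>x - z\<bar> * (\<bar>c z\<bar> * exp (l * z) * \<bar>?f z - ?g z\<bar>) \<le> 1 * (C * exp (l * z) * dist f g)"
            using z x C[of z] C0 by (intro mult_mono mult_nonneg_nonneg) auto
          then show "norm ((x - z) * (c z * exp (l * z) * (?f z - ?g z))) \<le> C * dist f g * exp (l * z)"
            by (simp add: abs_mult mult_ac)
        qed
        then show ?thesis by simp
      qed
      also have "integral {0..x} (\<lambda>z. C * dist f g * exp (l * z)) = C * dist f g * ((exp (l * x) - 1) / l)"
      proof -
        have "((\<lambda>z. exp (l * z)) has_integral exp (l * x) / l - exp (l * 0) / l) {0..x}"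
          using l x by (intro fundamental_theorem_of_calculus)
            (auto intro!: derivative_eq_intros simp flip: has_real_derivative_iff_has_vector_derivative)
        then show ?thesis by (simp add: integral_unique diff_divide_distrib)
      qed
      also have "exp (- l * x) * (C * dist f g * ((exp (l * x) - 1) / l)) \<le> 1 / 2 * dist f g"
      proof -
        have "exp (- l * x) * (exp (l * x) - 1) = 1 - exp (- l * x)"
          by (simp add: right_diff_distrib flip: exp_add)
        then have "exp (- l * x) * (C * dist f g * ((exp (l * x) - 1) / l)) = (C / l) * (1 - exp (- l * x)) * dist f g"
          by (simp add: mult_ac)
        also have "\<dots> \<le> (1 / 2) * 1 * dist f g"
        proof (intro mult_right_mono mult_mono)
          show "C / l \<le> 1 / 2" using C0 by (simp add: l_def field_simps)
          have "0 \<le> l * x" using l x by simp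
          then show "0 \<le> 1 - exp (- l * x)" by simp
        qed auto
        finally show ?thesis by simp
      qed
      finally show "dist (apply_bcontfun (T f) x0) (apply_bcontfun (T g) x0) \<le> 1 / 2 * dist f g"
        by simp
    qed
  qed auto
  then obtain y where y: "T y = y" by blast
  have yc: "continuous_on {0..1} (apply_bcontfun y)"
    by simp
  define u where "u = (\<lambda>x. exp (l * x) * apply_bcontfun y x)"
  have uc: "continuous_on {0..1} u" unfolding u_def by (intro continuous_intros yc)
  have cu: "continuous_on {0..1} (\<lambda>z. c z * u z)" by (intro continuous_intros c uc)
  have ux: "u x = \<alpha> + \<beta> * x + integral {0..x} (\<lambda>z. (x - z) * (c z * u z))" if x: "x \<in> {0..1}" for x
  proof -
    have "apply_bcontfun y x = G (apply_bcontfun y) x" using T[of y x] y x by (simp add: cl_def)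
    then have "u x = (exp (l * x) * exp (- l * x)) * (\<alpha> + \<beta> * x + integral {0..x} (\<lambda>z. (x - z) * (c z * exp (l * z) * apply_bcontfun y z)))"
      unfolding u_def G_def by simp
    then show ?thesis by (simp add: u_def mult.assoc flip: exp_add)
  qed
  define u' where "u' = (\<lambda>x. \<beta> + integral {0..x} (\<lambda>z. c z * u z))"
  show ?thesis
  proof (rule that[of u u'])
    fix x :: real assume x: "x \<in> {0..1}"
    have "((\<lambda>x. \<alpha> + \<beta> * x + integral {0..x} (\<lambda>z. (x - z) * (c z * u z))) has_real_derivative u' x) (at x within {0..1})"
      using integral_convolution_derivative[OF cu x] unfolding u'_def by (auto intro!: derivative_eq_intros)
    then show "(u has_real_derivative u' x) (at x within {0..1})"
      by (rule has_field_derivative_transform_within[where d=1, OF _ zero_less_one x]) (simp add: ux)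
    show "(u' has_real_derivative c x * u x) (at x within {0..1})"
      unfolding u'_def using integral_has_real_derivative[OF cu x] by (auto intro!: derivative_eq_intros)
  qed (simp_all add: ux[of 0] u'_def)
qed

text \<open>The solution of \<open>y'' = - k\<^sup>2 * y\<close> with \<open>y 0 = 0\<close> and
  \<open>y' 0 = 1\<close>; the value at \<open>k = 0\<close> is the limit.\<close>

definition sk :: "real \<Rightarrow> real \<Rightarrow> real" where
  "sk k x = (if k = 0 then x else sin (k * x) / k)"

lemma sk_deriv: "(sk k has_real_derivative cos (k * x)) (at x within S)"
  by (cases "k = 0") (auto simp: sk_def [abs_def] intro!: derivative_eq_intros)

lemma cos_deriv: "((\<lambda>x. cos (k * x)) has_real_derivative - k\<^sup>2 * sk k x) (at x within S)"
  by (cases "k = 0") (auto simp: sk_def intro!: derivative_eq_intros simp: power2_eq_square)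

lemma sin_eq_sk: "sin (k * x) = k * sk k x"
  by (simp add: sk_def)

lemma sk_cont: "continuous_on S (sk k)"
  by (rule DERIV_continuous_on[OF sk_deriv])

lemma sk_0 [simp]: "sk k 0 = 0" by (simp add: sk_def)

lemma sk_minus [simp]: "sk k (- x) = - sk k x" by (simp add: sk_def)

lemma integral_FTC:
  fixes f f' :: "real \<Rightarrow> real"
  assumes "a \<le> b" "\<And>x. x \<in> {a..b} \<Longrightarrow> (f has_real_derivative f' x) (at x within {a..b})"
  shows "(f' has_integral (f b - f a)) {a..b}"
  using fundamental_theorem_of_calculus[of a b f f'] assms
  by (simp add: has_real_derivative_iff_has_vector_derivative)

lemma integral_cos_symmetric:
  assumes "0 \<le> r"
  shows "integral {t - r..t + r} (\<lambda>\<tau>. cos (k * \<tau>)) = 2 * cos (k * t) * sk k r"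
proof -
  have "((\<lambda>\<tau>. cos (k * \<tau>)) has_integral (sk k (t + r) - sk k (t - r))) {t - r..t + r}"
    by (rule integral_FTC) (use assms sk_deriv in auto)
  moreover have "sk k (t + r) - sk k (t - r) = 2 * cos (k * t) * sk k r"
    by (cases "k = 0") (auto simp: sk_def field_simps sin_add sin_diff)
  ultimately show ?thesis by (simp add: integral_unique)
qed

text \<open>The conserved energy gives only \<open>d' = 0\<close>, as it does not see
  \<open>d\<close> when \<open>k = 0\<close>; then \<open>d\<close> is constant.\<close>

lemma oscillator_unique:
  assumes d: "\<And>x. x \<in> {0..1} \<Longrightarrow> (d has_real_derivative d' x) (at x within {0..1})"
    and d': "\<And>x. x \<in> {0..1} \<Longrightarrow> (d' has_real_derivative - k\<^sup>2 * d x) (at x within {0..1})"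
    and "d 0 = 0" "d' 0 = 0" and x: "x \<in> {0..1}"
  shows "d x = 0"
proof -
  define E where "E = (\<lambda>x. (d' x)\<^sup>2 + k\<^sup>2 * (d x)\<^sup>2)"
  have E': "((\<lambda>x. - E x) has_real_derivative 0) (at x within {0..1})" if "x \<in> {0..1}" for x
    unfolding E_def using d[OF that] d'[OF that] by (auto intro!: derivative_eq_intros)
  have "d' y = 0" if "y \<in> {0..1}" for y
  proof -
    have "- E 0 \<le> - E y" by (rule mono_on_unit_interval[OF E']) (use that in auto)
    then have "(d' y)\<^sup>2 + k\<^sup>2 * (d y)\<^sup>2 \<le> 0" using assms(3,4) by (simp add: E_def)
    moreover have "0 \<le> k\<^sup>2 * (d y)\<^sup>2" by simp
    ultimately have "(d' y)\<^sup>2 \<le> 0" by linarith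
    then show ?thesis by simp
  qed
  then have d0: "(d has_real_derivative 0) (at x within {0..1})" if "x \<in> {0..1}" for x using d[OF that] that by simp
  have "d 0 \<le> d x" by (rule mono_on_unit_interval[OF d0]) (use x in auto)
  moreover have "- d 0 \<le> - d x"
    by (rule mono_on_unit_interval[of "\<lambda>x. - d x" "\<lambda>_. - 0"]) (use x d0 in \<open>auto intro!: DERIV_minus simp del: minus_zero\<close>)
  ultimately show ?thesis using assms(3) by simp
qed

text \<open>The law of reflection at \<open>x = 0\<close> for primitives of waves:
  \<open>- 1\<close> is the odd extension, and the Robin formula at \<open>q = 0\<close> gives
  \<open>1\<close>, the even extension. For the waves themselves the kernel would contain a point
  mass; for primitives it is a bounded function.\<close>

definition refl_kernel :: "ereal \<Rightarrow> real \<Rightarrow> real" where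
  "refl_kernel q d = (if q = \<infinity> then - 1 else 2 * exp (- real_of_ereal q * d) - 1)"

lemma refl_kernel_cont: "continuous_on S (\<lambda>r. refl_kernel q (y - r))"
  unfolding refl_kernel_def by (cases "q = \<infinity>") (auto intro!: continuous_intros)

text \<open>Standing wave: \<open>\<omega>\<close> is extended to negative arguments by reflection at \<open>0\<close>.\<close>

lemma refl_wave:
  assumes bc: "left_bc q \<alpha> \<beta>" and y: "0 \<le> y"
  shows "integral {- y..0} (\<lambda>x. \<alpha> * cos (k * x) + \<beta> * sk k x)
       = integral {0..y} (\<lambda>r. refl_kernel q (y - r) * (\<alpha> * cos (k * r) + \<beta> * sk k r))"
proof -
  define S where "S = integral {0..y} (sk k)"
  have Si: "(sk k has_integral S) {0..y}"
    unfolding S_def by (intro integrable_integral integrable_continuous_real sk_cont)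
  have c1: "((\<lambda>x. cos (k * x)) has_integral sk k y) {- y..0}"
    using integral_FTC[of "- y" 0 "sk k" "\<lambda>x. cos (k * x)"] sk_deriv y by simp
  have c2: "((\<lambda>x. cos (k * x)) has_integral sk k y) {0..y}"
    using integral_FTC[of 0 y "sk k" "\<lambda>x. cos (k * x)"] sk_deriv y by simp
  have s1: "(sk k has_integral - S) {- y..0}"
  proof -
    have "((\<lambda>x. sk k (- x)) has_integral S) {- y..- 0}"
      using Si by (simp only: has_integral_reflect_real)
    from has_integral_neg[OF this] show ?thesis by simp
  qed
  have L: "((\<lambda>x. \<alpha> * cos (k * x) + \<beta> * sk k x) has_integral \<alpha> * sk k y + \<beta> * (- S)) {- y..0}"
    by (intro has_integral_add has_integral_mult_right c1 s1)
  have R: "((\<lambda>r. refl_kernel q (y - r) * (\<alpha> * cos (k * r) + \<beta> * sk k r)) has_integral \<alpha> * sk k y + \<beta> * (- S)) {0..y}"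
  proof (cases "q = \<infinity>")
    case True
    then show ?thesis
      using has_integral_neg[OF has_integral_mult_right[OF Si, of \<beta>]] bc by (simp add: refl_kernel_def left_bc_def)
  next
    case False
    define r0 where "r0 = real_of_ereal q"
    have b: "\<beta> = r0 * \<alpha>" using bc False by (simp add: left_bc_def r0_def)
    have "((\<lambda>r. exp (- r0 * (y - r)) * (cos (k * r) + r0 * sk k r)) has_integral
        (exp (- r0 * (y - y)) * sk k y - exp (- r0 * (y - 0)) * sk k 0)) {0..y}"
      by (rule integral_FTC[OF y]) (auto intro!: derivative_eq_intros sk_deriv simp: algebra_simps)
    from has_integral_mult_right[OF this, of "2 * \<alpha>"]
    have "((\<lambda>r. 2 * \<alpha> * (exp (- r0 * (y - r)) * (cos (k * r) + r0 * sk k r)) - (\<alpha> * cos (k * r) + \<beta> * sk k r))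
       has_integral 2 * \<alpha> * sk k y - (\<alpha> * sk k y + \<beta> * S)) {0..y}"
      using has_integral_add[OF has_integral_mult_right[OF c2, of \<alpha>] has_integral_mult_right[OF Si, of \<beta>]]
      by (intro has_integral_diff) auto
    moreover have "2 * \<alpha> * (exp (- r0 * (y - r)) * (cos (k * r) + r0 * sk k r)) - (\<alpha> * cos (k * r) + \<beta> * sk k r)
       = refl_kernel q (y - r) * (\<alpha> * cos (k * r) + \<beta> * sk k r)" for r
      using False by (simp add: refl_kernel_def b r0_def algebra_simps)
    ultimately show ?thesis by (simp add: algebra_simps)
  qed
  show ?thesis using L R by (simp add: integral_unique)
qed

text \<open>The offset \<open>- 1\<close> cancels in differences, and in the first bound it leaves
  room for one copy of the wave on the physical side; this is how \<open>2 * exp s\<close> arises in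
  both situations below.\<close>

lemma refl_kernel_bounds:
  assumes s: "0 \<le> s" "q \<noteq> \<infinity> \<Longrightarrow> - s \<le> real_of_ereal q"
    and d: "0 \<le> d" "d \<le> 1" and d': "0 \<le> d'" "d' \<le> 1"
  shows "\<bar>refl_kernel q d\<bar> \<le> 2 * exp s - 1" "\<bar>refl_kernel q d - refl_kernel q d'\<bar> \<le> 2 * exp s"
proof -
  have e1: "1 \<le> exp s" using s by simp
  have e: "exp (- real_of_ereal q * d) \<le> exp s" if "q \<noteq> \<infinity>" "0 \<le> d" "d \<le> 1" for d
  proof -
    have "- real_of_ereal q * d \<le> s * 1"
      using s(2)[OF that(1)] that s(1) mult_mono[of "- real_of_ereal q" s d 1] by auto
    then show ?thesis by simp
  qed
  show "\<bar>refl_kernel q d\<bar> \<le> 2 * exp s - 1"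
  proof (cases "q = \<infinity>")
    case False
    moreover have "0 < exp (- real_of_ereal q * d)" by simp
    ultimately have "- (2 * exp (- real_of_ereal q * d) - 1) \<le> 2 * exp s - 1" using e1 by linarith
    then show ?thesis using e[of d] False d unfolding refl_kernel_def abs_le_iff by auto
  qed (use e1 in \<open>simp add: refl_kernel_def\<close>)
  have p: "0 < exp (- real_of_ereal q * d)" "0 < exp (- real_of_ereal q * d')" by simp_all
  show "\<bar>refl_kernel q d - refl_kernel q d'\<bar> \<le> 2 * exp s"
  proof (cases "q = \<infinity>")
    case False
    then have "refl_kernel q d - refl_kernel q d' = 2 * exp (- real_of_ereal q * d) - 2 * exp (- real_of_ereal q * d')"
      by (simp add: refl_kernel_def)
    then show ?thesis using e[OF False d] e[OF False d'] p unfolding abs_le_iff by linarith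
  qed (use e1 in \<open>simp add: refl_kernel_def\<close>)
qed

lemma integral_abs_le_abs_integral:
  fixes f g :: "real \<Rightarrow> real"
  assumes "continuous_on {a..b} f" "continuous_on {a..b} g" "\<And>x. x \<in> {a..b} \<Longrightarrow> \<bar>f x\<bar> \<le> g x"
  shows "\<bar>integral {a..b} f\<bar> \<le> integral {a..b} g"
  using integral_norm_bound_integral[of f "{a..b}" g] assms by (simp add: integrable_continuous_real)

text \<open>Integrals of a reflected wave, in terms of its values on the physical side \<open>[0,X]\<close> only.
  The reflected part is summed before taking absolute values, which keeps the constant \<open>2 exp s\<close>
  uniform in \<open>q\<close>.\<close>

lemma reflected_integral_bounds:
  assumes \<omega>: "continuous_on UNIV \<omega>"
    and refl: "\<And>y. y \<in> {0..1} \<Longrightarrow> integral {- y..0} \<omega> = integral {0..y} (\<lambda>r. refl_kernel q (y - r) * \<omega> r)"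
    and s: "0 \<le> s" "q \<noteq> \<infinity> \<Longrightarrow> - s \<le> real_of_ereal q"
    and X: "X \<le> 1"
  defines "A \<equiv> integral {0..X} (\<lambda>r. \<bar>\<omega> r\<bar>)"
  shows "\<And>a b. - X \<le> a \<Longrightarrow> a \<le> b \<Longrightarrow> b \<le> X \<Longrightarrow> \<bar>integral {a..b} \<omega>\<bar> \<le> 2 * exp s * A"
    and "\<And>y. 0 \<le> y \<Longrightarrow> y \<le> X \<Longrightarrow> \<bar>integral {- y..X} \<omega>\<bar> + \<bar>integral {y..X} \<omega>\<bar> \<le> 2 * exp s * A"
proof -
  define R where "R = (\<lambda>y. integral {0..y} (\<lambda>r. \<bar>\<omega> r\<bar>))"
  have e1: "1 \<le> exp s" using s by simp
  have e2: "0 \<le> 2 * exp s - 1" using e1 by linarith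
  have c: "continuous_on S \<omega>" for S by (rule continuous_on_subset[OF \<omega>]) simp
  have ca: "continuous_on S (\<lambda>r. \<bar>\<omega> r\<bar>)" for S by (intro continuous_intros c)
  have i: "f integrable_on {a..b}" if "continuous_on {a..b} f" for a b and f :: "real \<Rightarrow> real"
    by (rule integrable_continuous_real[OF that])
  have Rd: "integral {a..b} (\<lambda>r. \<bar>\<omega> r\<bar>) = R b - R a" if "0 \<le> a" "a \<le> b" for a b
    using Henstock_Kurzweil_Integration.integral_combine[OF that i[OF ca]] by (simp add: R_def)
  have Rnn: "0 \<le> integral {a..b} (\<lambda>r. \<bar>\<omega> r\<bar>)" for a b by (rule integral_nonneg[OF i[OF ca]]) simp
  have Rm: "R a \<le> R b" if "0 \<le> a" "a \<le> b" for a b using Rd[OF that] Rnn[of a b] by simp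
  have R0: "0 \<le> R a" for a unfolding R_def by (rule Rnn)
  have pos: "\<bar>integral {a..b} \<omega>\<bar> \<le> R b - R a" if "0 \<le> a" "a \<le> b" for a b
    using integral_abs_le_abs_integral[OF c ca, of a b] Rd[OF that] by simp
  have neg: "\<bar>integral {- y..0} \<omega>\<bar> \<le> (2 * exp s - 1) * R y" if "0 \<le> y" "y \<le> 1" for y
  proof -
    have "\<bar>integral {0..y} (\<lambda>r. refl_kernel q (y - r) * \<omega> r)\<bar> \<le> integral {0..y} (\<lambda>r. (2 * exp s - 1) * \<bar>\<omega> r\<bar>)"
    proof (rule integral_abs_le_abs_integral)
      show "continuous_on {0..y} (\<lambda>r. refl_kernel q (y - r) * \<omega> r)" by (intro continuous_on_mult refl_kernel_cont c)
      show "continuous_on {0..y} (\<lambda>r. (2 * exp s - 1) * \<bar>\<omega> r\<bar>)" by (intro continuous_intros c)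
      show "\<bar>refl_kernel q (y - r) * \<omega> r\<bar> \<le> (2 * exp s - 1) * \<bar>\<omega> r\<bar>" if "r \<in> {0..y}" for r
        unfolding abs_mult by (intro mult_right_mono refl_kernel_bounds(1)[OF s, where d'=0]) (use that \<open>y \<le> 1\<close> in auto)
    qed
    then show ?thesis using refl[of y] that by (simp add: R_def)
  qed
  have split: "integral {a..b} \<omega> = integral {a..m} \<omega> + integral {m..b} \<omega>" if "a \<le> m" "m \<le> b" for a m b
    using Henstock_Kurzweil_Integration.integral_combine[OF that i[OF c]] by simp
  have A: "A = R X" by (simp add: A_def R_def)
  show "\<bar>integral {a..b} \<omega>\<bar> \<le> 2 * exp s * A" if ab: "- X \<le> a" "a \<le> b" "b \<le> X" for a b
  proof -
    consider "0 \<le> a" | "a < 0" "0 \<le> b" | "b < 0" by linarith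
    then show ?thesis
    proof cases
      case 1
      have "R b - R a \<le> 1 * R X" using Rm[of b X] R0[of a] 1 ab by simp
      also have "1 * R X \<le> 2 * exp s * R X" by (rule mult_right_mono[OF _ R0]) (use e1 in linarith)
      finally show ?thesis using pos[of a b] 1 ab A by simp
    next
      case 2
      have "\<bar>integral {a..b} \<omega>\<bar> \<le> \<bar>integral {a..0} \<omega>\<bar> + \<bar>integral {0..b} \<omega>\<bar>" using split[of a 0 b] 2 by simp
      also have "\<bar>integral {a..0} \<omega>\<bar> \<le> (2 * exp s - 1) * R (- a)" using neg[of "- a"] 2 ab X by simp
      also have "\<dots> \<le> (2 * exp s - 1) * R X" by (rule mult_left_mono[OF Rm e2]) (use 2 ab in auto)
      also have "\<bar>integral {0..b} \<omega>\<bar> \<le> R X" using pos[of 0 b] Rm[of b X] 2 ab by (simp add: R_def)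
      finally show ?thesis using A by (simp add: algebra_simps)
    next
      case 3
      \<comment> \<open>Both end points lie on the reflected side. The two reflection formulas are
        subtracted first, so that the difference of the kernels is estimated and not each kernel
        separately.\<close>
      define y z where "y = - a" and "z = - b"
      have yz: "0 < z" "z \<le> y" "y \<le> X" using 3 ab by (auto simp: y_def z_def)
      let ?k = "\<lambda>y r. refl_kernel q (y - r) * \<omega> r"
      have kc: "continuous_on S (?k y)" for S y by (intro continuous_on_mult refl_kernel_cont c)
      have "integral {a..b} \<omega> = integral {- y..0} \<omega> - integral {- z..0} \<omega>"
        using split[of a b 0] 3 ab by (simp add: y_def z_def)
      also have "\<dots> = integral {0..y} (?k y) - integral {0..z} (?k z)" using refl[of y] refl[of z] yz X by simp
      also have "integral {0..y} (?k y) = integral {0..z} (?k y) + integral {z..y} (?k y)"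
        using Henstock_Kurzweil_Integration.integral_combine[of 0 z y "?k y"] i[OF kc] yz by simp
      also have "\<dots> - integral {0..z} (?k z) = integral {0..z} (\<lambda>r. ?k y r - ?k z r) + integral {z..y} (?k y)"
        using Henstock_Kurzweil_Integration.integral_diff[OF i[OF kc] i[OF kc], of 0 z y z] by simp
      also have "\<bar>\<dots>\<bar> \<le> 2 * exp s * R z + 2 * exp s * (R y - R z)"
      proof (rule order_trans[OF abs_triangle_ineq add_mono])
        have "\<bar>integral {0..z} (\<lambda>r. ?k y r - ?k z r)\<bar> \<le> integral {0..z} (\<lambda>r. 2 * exp s * \<bar>\<omega> r\<bar>)"
        proof (rule integral_abs_le_abs_integral)
          show "continuous_on {0..z} (\<lambda>r. ?k y r - ?k z r)" by (intro continuous_on_diff kc)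
          show "continuous_on {0..z} (\<lambda>r. 2 * exp s * \<bar>\<omega> r\<bar>)" by (intro continuous_intros c)
          fix r assume r: "r \<in> {0..z}"
          have "\<bar>refl_kernel q (y - r) - refl_kernel q (z - r)\<bar> * \<bar>\<omega> r\<bar> \<le> 2 * exp s * \<bar>\<omega> r\<bar>"
            by (intro mult_right_mono refl_kernel_bounds(2)[OF s]) (use r yz X in auto)
          then show "\<bar>?k y r - ?k z r\<bar> \<le> 2 * exp s * \<bar>\<omega> r\<bar>" by (simp flip: left_diff_distrib add: abs_mult)
        qed
        then show "\<bar>integral {0..z} (\<lambda>r. ?k y r - ?k z r)\<bar> \<le> 2 * exp s * R z" by (simp add: R_def)
        have "\<bar>integral {z..y} (?k y)\<bar> \<le> integral {z..y} (\<lambda>r. 2 * exp s * \<bar>\<omega> r\<bar>)"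
        proof (rule integral_abs_le_abs_integral)
          show "continuous_on {z..y} (\<lambda>r. 2 * exp s * \<bar>\<omega> r\<bar>)" by (intro continuous_intros c)
          fix r assume r: "r \<in> {z..y}"
          have "\<bar>refl_kernel q (y - r)\<bar> \<le> 2 * exp s - 1"
            by (rule refl_kernel_bounds(1)[OF s, where d'=0]) (use r yz X in auto)
          then show "\<bar>?k y r\<bar> \<le> 2 * exp s * \<bar>\<omega> r\<bar>" unfolding abs_mult by (intro mult_right_mono) auto
        qed (rule kc)
        then show "\<bar>integral {z..y} (?k y)\<bar> \<le> 2 * exp s * (R y - R z)" using Rd[of z y] yz by simp
      qed
      also have "\<dots> = 2 * exp s * R y" by (simp add: algebra_simps)
      also have "\<dots> \<le> 2 * exp s * R X" by (intro mult_left_mono Rm) (use yz in auto)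
      finally show ?thesis using A by simp
    qed
  qed
  \<comment> \<open>The reflected part costs the longer interval up to
    \<open>(2 * exp s - 1) * R y\<close>, while the shorter one sees only \<open>R X - R y\<close>;
    so the pair together obeys the bound of a single interval.\<close>
  show "\<bar>integral {- y..X} \<omega>\<bar> + \<bar>integral {y..X} \<omega>\<bar> \<le> 2 * exp s * A" if y: "0 \<le> y" "y \<le> X" for y
  proof -
    have "\<bar>integral {- y..X} \<omega>\<bar> \<le> \<bar>integral {- y..0} \<omega>\<bar> + \<bar>integral {0..X} \<omega>\<bar>" using split[of "- y" 0 X] y by simp
    also have "\<dots> \<le> (2 * exp s - 1) * R y + R X" using neg[of y] pos[of 0 X] y X by (simp add: R_def)
    finally have "\<bar>integral {- y..X} \<omega>\<bar> + \<bar>integral {y..X} \<omega>\<bar> \<le> (2 * exp s - 2) * R y + 2 * R X"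
      using pos[of y X] y by (simp add: algebra_simps)
    also have "\<dots> \<le> (2 * exp s - 2) * R X + 2 * R X"
      by (intro add_mono mult_left_mono Rm) (use y e1 in auto)
    finally show ?thesis using A by (simp add: algebra_simps)
  qed
qed

section \<open>Perturbed waves whose transform is a free wave\<close>

context backstepping
begin

text \<open>\<open>U\<close> solves \<open>U\<^sub>x\<^sub>x + B U = U\<^sub>t\<^sub>t\<close> with \<open>K U(\<cdot>,0) = \<omega>\<close>. Solved for \<open>x\<close> as the time variable by
  d'Alembert's formula, the Cauchy data at \<open>x = 0\<close> are those of the free wave
  \<open>(\<omega>(x + t) + \<omega>(x - t)) / 2\<close>; this bounds the inverse transform without its kernel.\<close>

definition tame :: "(real \<Rightarrow> real) \<Rightarrow> (real \<Rightarrow> real \<Rightarrow> real) \<Rightarrow> bool" where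
  "tame \<omega> U \<longleftrightarrow> continuous_on UNIV \<omega> \<and> (\<forall>z. continuous_on UNIV (U z)) \<and>
     (\<exists>C. \<forall>z\<in>{0..1}. \<forall>t. \<bar>U z t\<bar> \<le> C) \<and> continuous_on {0..1} (\<lambda>x. U x 0) \<and>
     (\<forall>x\<in>{0..1}. backstep K (\<lambda>x. U x 0) x = \<omega> x) \<and>
     (\<forall>y\<in>{0..1}. integral {- y..0} \<omega> = integral {0..y} (\<lambda>r. refl_kernel q (y - r) * \<omega> r)) \<and>
     (\<forall>x\<in>{0..1}. \<forall>t. ((\<lambda>z. B z * integral {t - (x - z)..t + (x - z)} (U z))
        has_integral \<omega> (x + t) + \<omega> (x - t) - 2 * U x t) {0..x})"

lemma tame_linear:
  assumes 1: "tame \<omega>\<^sub>1 U\<^sub>1" and 2: "tame \<omega>\<^sub>2 U\<^sub>2"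
  shows "tame (\<lambda>x. m * \<omega>\<^sub>1 x + n * \<omega>\<^sub>2 x) (\<lambda>x t. m * U\<^sub>1 x t + n * U\<^sub>2 x t)"
  unfolding tame_def
proof (intro conjI ballI allI)
  have c1: "continuous_on S \<omega>\<^sub>1" and c2: "continuous_on S \<omega>\<^sub>2" for S
    using 1 2 by (auto simp: tame_def intro: continuous_on_subset)
  have u1: "continuous_on S (U\<^sub>1 z)" and u2: "continuous_on S (U\<^sub>2 z)" for S z
    using 1 2 by (auto simp: tame_def intro: continuous_on_subset)
  have v1: "continuous_on {0..1} (\<lambda>x. U\<^sub>1 x 0)" and v2: "continuous_on {0..1} (\<lambda>x. U\<^sub>2 x 0)"
    using 1 2 by (auto simp: tame_def)
  show "continuous_on UNIV (\<lambda>x. m * \<omega>\<^sub>1 x + n * \<omega>\<^sub>2 x)" by (intro continuous_intros c1 c2)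
  show "continuous_on UNIV (\<lambda>t. m * U\<^sub>1 z t + n * U\<^sub>2 z t)" for z by (intro continuous_intros u1 u2)
  show "continuous_on {0..1} (\<lambda>x. m * U\<^sub>1 x 0 + n * U\<^sub>2 x 0)" by (intro continuous_intros v1 v2)
  show "\<exists>C. \<forall>z\<in>{0..1}. \<forall>t. \<bar>m * U\<^sub>1 z t + n * U\<^sub>2 z t\<bar> \<le> C"
  proof -
    obtain C1 C2 where C: "\<forall>z\<in>{0..1}. \<forall>t. \<bar>U\<^sub>1 z t\<bar> \<le> C1" "\<forall>z\<in>{0..1}. \<forall>t. \<bar>U\<^sub>2 z t\<bar> \<le> C2"
      using 1 2 unfolding tame_def by blast
    have "\<bar>m * U\<^sub>1 z t + n * U\<^sub>2 z t\<bar> \<le> \<bar>m\<bar> * C1 + \<bar>n\<bar> * C2" if "z \<in> {0..1}" for z t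
      using C that by (intro order_trans[OF abs_triangle_ineq] add_mono) (auto simp: abs_mult intro!: mult_left_mono)
    then show ?thesis by blast
  qed
  show "backstep K (\<lambda>x. m * U\<^sub>1 x 0 + n * U\<^sub>2 x 0) x = m * \<omega>\<^sub>1 x + n * \<omega>\<^sub>2 x" if "x \<in> {0..1}" for x
    using backstep_linear[OF KD(3) continuous_imp_integrable_real[OF v1] continuous_imp_integrable_real[OF v2] that, of m n]
      1 2 that by (simp add: tame_def)
  show "integral {- y..0} (\<lambda>x. m * \<omega>\<^sub>1 x + n * \<omega>\<^sub>2 x) = integral {0..y} (\<lambda>r. refl_kernel q (y - r) * (m * \<omega>\<^sub>1 r + n * \<omega>\<^sub>2 r))"
    if y: "y \<in> {0..1}" for y
  proof -
    let ?k = "\<lambda>\<omega> r. refl_kernel q (y - r) * \<omega> r"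
    have "integral {- y..0} (\<lambda>x. m * \<omega>\<^sub>1 x + n * \<omega>\<^sub>2 x) = m * integral {- y..0} \<omega>\<^sub>1 + n * integral {- y..0} \<omega>\<^sub>2"
      by (rule integral_unique)
        (intro has_integral_add has_integral_mult_right integrable_integral integrable_continuous_real c1 c2)
    moreover have "integral {0..y} (\<lambda>r. m * ?k \<omega>\<^sub>1 r + n * ?k \<omega>\<^sub>2 r) = m * integral {0..y} (?k \<omega>\<^sub>1) + n * integral {0..y} (?k \<omega>\<^sub>2)"
      by (rule integral_unique)
        (intro has_integral_add has_integral_mult_right integrable_integral integrable_continuous_real continuous_on_mult refl_kernel_cont c1 c2)
    moreover have "(\<lambda>r. refl_kernel q (y - r) * (m * \<omega>\<^sub>1 r + n * \<omega>\<^sub>2 r)) = (\<lambda>r. m * ?k \<omega>\<^sub>1 r + n * ?k \<omega>\<^sub>2 r)"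
      by (auto simp: algebra_simps)
    ultimately show ?thesis using 1 2 y by (simp add: tame_def)
  qed
  show "((\<lambda>z. B z * integral {t - (x - z)..t + (x - z)} (\<lambda>t. m * U\<^sub>1 z t + n * U\<^sub>2 z t)) has_integral
      m * \<omega>\<^sub>1 (x + t) + n * \<omega>\<^sub>2 (x + t) + (m * \<omega>\<^sub>1 (x - t) + n * \<omega>\<^sub>2 (x - t)) - 2 * (m * U\<^sub>1 x t + n * U\<^sub>2 x t)) {0..x}"
    if x: "x \<in> {0..1}" for x t
  proof -
    let ?J = "\<lambda>U z. B z * integral {t - (x - z)..t + (x - z)} (U z)"
    have "((\<lambda>z. m * ?J U\<^sub>1 z + n * ?J U\<^sub>2 z) has_integral
        m * (\<omega>\<^sub>1 (x + t) + \<omega>\<^sub>1 (x - t) - 2 * U\<^sub>1 x t) + n * (\<omega>\<^sub>2 (x + t) + \<omega>\<^sub>2 (x - t) - 2 * U\<^sub>2 x t)) {0..x}"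
      using 1 2 x by (intro has_integral_add has_integral_mult_right) (auto simp: tame_def)
    moreover have "m * ?J U\<^sub>1 z + n * ?J U\<^sub>2 z = B z * integral {t - (x - z)..t + (x - z)} (\<lambda>t. m * U\<^sub>1 z t + n * U\<^sub>2 z t)" for z
    proof -
      have "integral {t - (x - z)..t + (x - z)} (\<lambda>t. m * U\<^sub>1 z t + n * U\<^sub>2 z t)
          = m * integral {t - (x - z)..t + (x - z)} (U\<^sub>1 z) + n * integral {t - (x - z)..t + (x - z)} (U\<^sub>2 z)"
        by (rule integral_unique)
          (intro has_integral_add has_integral_mult_right integrable_integral integrable_continuous_real u1 u2)
      then show ?thesis by (simp add: algebra_simps)
    qed
    ultimately show ?thesis by (simp add: algebra_simps)
  qed
qed

text \<open>Take \<open>U x t = u x * cos (k * t)\<close> with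
  \<open>u'' = - (k\<^sup>2 + B) * u\<close> and Cauchy data \<open>\<alpha>\<close>,
  \<open>\<beta>\<close>. By intertwining, the transform of \<open>u\<close> solves the free
  oscillator equation with the same data, so it is the given free wave.\<close>

lemma tame_standing_wave:
  assumes lbc: "left_bc q \<alpha> \<beta>"
  shows "\<exists>U. tame (\<lambda>x. \<alpha> * cos (k * x) + \<beta> * sk k x) U"
proof -
  define w where "w = (\<lambda>x. \<alpha> * cos (k * x) + \<beta> * sk k x)"
  define w' where "w' = (\<lambda>x. \<alpha> * (- k\<^sup>2 * sk k x) + \<beta> * cos (k * x))"
  have wd: "(w has_real_derivative w' x) (at x within S)" for x S
    unfolding w_def w'_def by (intro DERIV_add DERIV_cmult cos_deriv sk_deriv)
  have w'd: "(w' has_real_derivative - k\<^sup>2 * w x) (at x within S)" for x S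
  proof -
    have "(w' has_real_derivative \<alpha> * (- k\<^sup>2 * cos (k * x)) + \<beta> * (- k\<^sup>2 * sk k x)) (at x within S)"
      unfolding w'_def by (intro DERIV_add DERIV_cmult cos_deriv sk_deriv)
    then show ?thesis by (simp add: w_def algebra_simps)
  qed
  have cB: "continuous_on {0..1} (\<lambda>x. - (k\<^sup>2 + B x))" by (intro continuous_intros B_cont)
  obtain u u' where ud: "\<And>x. x \<in> {0..1} \<Longrightarrow> (u has_real_derivative u' x) (at x within {0..1})"
    and u'd: "\<And>x. x \<in> {0..1} \<Longrightarrow> (u' has_real_derivative - (k\<^sup>2 + B x) * u x) (at x within {0..1})"
    and u0: "u 0 = \<alpha>" and u'0: "u' 0 = \<beta>"
    using linear_ODE_solution[OF cB, of \<alpha> \<beta>] by blast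
  have uc: "continuous_on {0..1} u" by (rule DERIV_continuous_on[OF ud])
  have uH: "H2 u u' (\<lambda>x. - (k\<^sup>2 + B x) * u x)"
  proof (rule H2_classical[OF ud u'd])
    show "continuous_on {0..1} (\<lambda>x. - (k\<^sup>2 + B x) * u x)" by (intro continuous_intros B_cont uc)
  qed
  have transform: "backstep K u x = w x" if x: "x \<in> {0..1}" for x
  proof -
    note BI = backstep_intertwines[OF uH, unfolded u0 u'0, OF lbc]
    define y where "y = backstep K u"
    define y' where "y' = (\<lambda>x. u' x - K (x, x) * u x - (LINT y|lebesgue_on {0..x}. Kx (x, y) * u y))"
    have yH: "H2 y y' (backstep K (\<lambda>y. - (k\<^sup>2 + B y) * u y + B y * u y))"
      using BI(1) by (simp only: y_def y'_def)
    note yD = H2D[OF yH]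
    have y'': "backstep K (\<lambda>y. - (k\<^sup>2 + B y) * u y + B y * u y) x = - k\<^sup>2 * y x" if "x \<in> {0..1}" for x
    proof -
      have "(\<lambda>y. - (k\<^sup>2 + B y) * u y + B y * u y) = (\<lambda>y. (- k\<^sup>2) * u y + 0 * u y)" by (auto simp: algebra_simps)
      then show ?thesis
        using backstep_linear[OF KD(3) continuous_imp_integrable_real[OF uc] continuous_imp_integrable_real[OF uc] that, of "- k\<^sup>2" 0]
        by (simp add: y_def)
    qed
    have c: "continuous_on {0..1} (\<lambda>x. - k\<^sup>2 * y x)" by (intro continuous_intros yD(2))
    have y'd: "(y' has_real_derivative - k\<^sup>2 * y x) (at x within {0..1})" if x: "x \<in> {0..1}" for x
    proof -
      have "((\<lambda>x. y' 0 + integral {0..x} (\<lambda>x. - k\<^sup>2 * y x)) has_real_derivative - k\<^sup>2 * y x) (at x within {0..1})"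
        using DERIV_add[OF DERIV_const[of "y' 0"] integral_has_real_derivative[OF c x]] by (simp only: add_0)
      moreover have "y' 0 + integral {0..z} (\<lambda>x. - k\<^sup>2 * y x) = y' z" if z: "z \<in> {0..1}" for z
      proof -
        have "(LINT s|lebesgue_on {0..z}. backstep K (\<lambda>y. - (k\<^sup>2 + B y) * u y + B y * u y) s) = (LINT s|lebesgue_on {0..z}. - k\<^sup>2 * y s)"
          by (rule integral_cong_on) (use z y'' in auto)
        also have "\<dots> = integral {0..z} (\<lambda>x. - k\<^sup>2 * y x)"
          by (rule LINT_continuous_eq_integral[OF continuous_on_subset[OF c]]) (use z in auto)
        finally show ?thesis using yD(5)[OF z] by argo
      qed
      ultimately show ?thesis
        by (rule has_field_derivative_transform_within[where d=1, OF _ zero_less_one x])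
    qed
    have "y x - w x = 0"
    proof (rule oscillator_unique[of "\<lambda>x. y x - w x" "\<lambda>x. y' x - w' x" k])
      fix x :: real assume x: "x \<in> {0..1}"
      show "((\<lambda>x. y x - w x) has_real_derivative y' x - w' x) (at x within {0..1})"
        by (intro DERIV_diff yD(4) wd x)
      show "((\<lambda>x. y' x - w' x) has_real_derivative - k\<^sup>2 * (y x - w x)) (at x within {0..1})"
        using DERIV_diff[OF y'd[OF x] w'd[of x]] by (simp add: algebra_simps)
    next
      show "y 0 - w 0 = 0" using BI(2) by (simp add: y_def w_def)
      show "y' 0 - w' 0 = 0" by (simp add: y'_def w'_def diag_0 u'0)
    qed (rule x)
    then show ?thesis by (simp add: y_def)
  qed
  \<comment> \<open>Variation of constants: \<open>w - u\<close> has zero Cauchy data and solves the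
    free oscillator equation with source \<open>B * u\<close>.\<close>
  have voc: "((\<lambda>z. B z * u z * sk k (x - z)) has_integral w x - u x) {0..x}" if x: "x \<in> {0..1}" for x
  proof -
    have "((\<lambda>z. - (B z * u z * sk k (x - z))) has_integral
        (u x * cos (k * (x - x)) + u' x * sk k (x - x)) - (u 0 * cos (k * (x - 0)) + u' 0 * sk k (x - 0))) {0..x}"
    proof (rule integral_FTC)
      fix z assume z: "z \<in> {0..x}"
      have s: "{0..x} \<subseteq> {0..1}" "z \<in> {0..1}" using x z by auto
      have e0: "((\<lambda>z. x - z) has_real_derivative - 1) (at z within {0..x})" by (auto intro!: derivative_eq_intros)
      have e1: "((\<lambda>z. cos (k * (x - z))) has_real_derivative k\<^sup>2 * sk k (x - z)) (at z within {0..x})"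
        using DERIV_chain2[where f="\<lambda>x. cos (k * x)" and g="\<lambda>z. x - z", OF cos_deriv e0] by simp
      have e2: "((\<lambda>z. sk k (x - z)) has_real_derivative - cos (k * (x - z))) (at z within {0..x})"
        using DERIV_chain2[where f="sk k" and g="\<lambda>z. x - z", OF sk_deriv e0] by simp
      have "((\<lambda>z. u z * cos (k * (x - z)) + u' z * sk k (x - z)) has_real_derivative
          (u' z * cos (k * (x - z)) + k\<^sup>2 * sk k (x - z) * u z) + (- (k\<^sup>2 + B z) * u z * sk k (x - z) + - cos (k * (x - z)) * u' z))
          (at z within {0..x})"
        by (intro DERIV_add DERIV_mult DERIV_subset[OF ud s(1)] DERIV_subset[OF u'd s(1)] e1 e2 s(2))
      then show "((\<lambda>z. u z * cos (k * (x - z)) + u' z * sk k (x - z)) has_real_derivative - (B z * u z * sk k (x - z))) (at z within {0..x})"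
        by (simp add: algebra_simps)
    qed (use x in auto)
    from has_integral_neg[OF this] show ?thesis by (simp add: w_def u0 u'0 algebra_simps)
  qed
  obtain C where C: "\<And>x. x \<in> {0..1} \<Longrightarrow> \<bar>u x\<bar> \<le> C" using continuous_on_Icc_bounded[OF uc] by blast
  have "tame w (\<lambda>x t. u x * cos (k * t))"
    unfolding tame_def
  proof (intro conjI ballI allI)
    show "continuous_on UNIV w" by (rule DERIV_continuous_on[OF wd])
    show "continuous_on UNIV (\<lambda>t. u z * cos (k * t))" for z by (intro continuous_intros)
    have "\<bar>u z * cos (k * t)\<bar> \<le> C" if "z \<in> {0..1}" for z t
      using mult_mono[OF C[OF that] abs_cos_le_one[of "k * t"]] C[OF that] by (simp add: abs_mult)
    then show "\<exists>C. \<forall>z\<in>{0..1}. \<forall>t. \<bar>u z * cos (k * t)\<bar> \<le> C" by blast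
    show "continuous_on {0..1} (\<lambda>x. u x * cos (k * 0))" using uc by simp
    show "backstep K (\<lambda>x. u x * cos (k * 0)) x = w x" if "x \<in> {0..1}" for x
      using transform[OF that] by simp
    show "integral {- y..0} w = integral {0..y} (\<lambda>r. refl_kernel q (y - r) * w r)" if "y \<in> {0..1}" for y
      unfolding w_def by (rule refl_wave[OF lbc]) (use that in auto)
    show "((\<lambda>z. B z * integral {t - (x - z)..t + (x - z)} (\<lambda>t. u z * cos (k * t))) has_integral
        w (x + t) + w (x - t) - 2 * (u x * cos (k * t))) {0..x}" if x: "x \<in> {0..1}" for x t
    proof -
      \<comment> \<open>The factor \<open>2 * cos (k * t)\<close> turns this into d'Alembert's
        formula: \<open>sk\<close> becomes the integral of the wave over a window of half-width
        \<open>x - z\<close>, and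
        \<open>2 * cos (k * t) * w x = w (x + t) + w (x - t)\<close>.\<close>
      have h1: "((\<lambda>z. 2 * cos (k * t) * (B z * u z * sk k (x - z))) has_integral 2 * cos (k * t) * (w x - u x)) {0..x}"
        by (rule has_integral_mult_right[OF voc[OF x]])
      have h2: "2 * cos (k * t) * (w x - u x) = w (x + t) + w (x - t) - 2 * (u x * cos (k * t))"
        by (cases "k = 0") (auto simp: w_def sk_def field_simps sin_add sin_diff cos_add cos_diff)
      have h3: "2 * cos (k * t) * (B z * u z * sk k (x - z)) = B z * integral {t - (x - z)..t + (x - z)} (\<lambda>t. u z * cos (k * t))"
        if "z \<in> {0..x}" for z
        using integral_cos_symmetric[of "x - z" t k] that by simp
      show ?thesis by (rule has_integral_eq[OF h3 h1[unfolded h2]])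
    qed
  qed
  then show ?thesis unfolding w_def by blast
qed

end

text \<open>Generated by linear combinations, so that tame waves can be built along the derivation
  by \<open>tame_linear\<close>.\<close>

inductive trig_sum :: "(real \<Rightarrow> real) \<Rightarrow> bool" where
  cosine: "trig_sum (\<lambda>x. cos (k * x))"
| linear: "trig_sum f \<Longrightarrow> trig_sum g \<Longrightarrow> trig_sum (\<lambda>x. m * f x + n * g x)"

lemma trig_sum_cmult: "trig_sum f \<Longrightarrow> trig_sum (\<lambda>x. m * f x)"
  using trig_sum.linear[of f f m 0] by simp

lemma trig_sum_continuous: "trig_sum f \<Longrightarrow> continuous_on S f"
  by (induction rule: trig_sum.induct) (auto intro!: continuous_intros)

lemma trig_sum_mult:
  assumes "trig_sum f" "trig_sum g"
  shows "trig_sum (\<lambda>x. f x * g x)"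
  using assms
proof (induction arbitrary: g rule: trig_sum.induct)
  case (cosine k)
  show ?case using cosine
  proof (induction rule: trig_sum.induct)
    case (cosine l)
    have eq: "(\<lambda>x. cos (k * x) * cos (l * x)) = (\<lambda>x. (1 / 2) * cos ((k - l) * x) + (1 / 2) * cos ((k + l) * x))"
      by (auto simp: cos_times_cos left_diff_distrib distrib_right)
    show ?case unfolding eq by (rule trig_sum.linear[OF trig_sum.cosine trig_sum.cosine])
  next
    case (linear f g m n)
    have "(\<lambda>x. cos (k * x) * (m * f x + n * g x)) = (\<lambda>x. m * (cos (k * x) * f x) + n * (cos (k * x) * g x))"
      by (auto simp: algebra_simps)
    then show ?case using trig_sum.linear[OF linear.IH] by simp
  qed
next
  case (linear f1 f2 m n)
  have "(\<lambda>x. (m * f1 x + n * f2 x) * g x) = (\<lambda>x. m * (f1 x * g x) + n * (f2 x * g x))"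
    by (auto simp: algebra_simps)
  then show ?case using trig_sum.linear[OF linear.IH(1)[OF linear.prems] linear.IH(2)[OF linear.prems]] by simp
qed

text \<open>Stone-Weierstrass; the single function \<open>cos x\<close> is injective on
  \<open>{0..1}\<close> and so separates points.\<close>

lemma trig_sum_dense:
  assumes "continuous_on {0..1} f" "0 < e"
  obtains g where "trig_sum g" "\<And>x. x \<in> {0..1} \<Longrightarrow> \<bar>f x - g x\<bar> < e"
proof -
  have "\<exists>g. trig_sum g \<and> (\<forall>x\<in>{0..1}. \<bar>f x - g x\<bar> < e)"
  proof (rule Stone_Weierstrass_HOL[OF compact_Icc _ _ _ _ _ assms])
    show "trig_sum (\<lambda>x. c)" for c using trig_sum_cmult[OF trig_sum.cosine[of 0], of c] by simp
    show "trig_sum (\<lambda>x. f x + g x)" if "trig_sum f \<and> trig_sum g" for f g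
      using trig_sum.linear[of f g 1 1] that by simp
    show "trig_sum (\<lambda>x. f x * g x)" if "trig_sum f \<and> trig_sum g" for f g
      using trig_sum_mult that by blast
    show "\<exists>f. trig_sum f \<and> f x \<noteq> f y" if "x \<in> {0..1} \<and> y \<in> {0..1} \<and> x \<noteq> y" for x y :: real
    proof (intro exI conjI)
      show "trig_sum (\<lambda>x. cos (1 * x))" by (rule trig_sum.cosine)
      show "cos (1 * x) \<noteq> cos (1 * y)" using cos_inj_pi[of x y] that pi_gt3 by auto
    qed
  qed (rule trig_sum_continuous)
  then show ?thesis using that by blast
qed

lemma Gronwall:
  fixes h :: "real \<Rightarrow> real"
  assumes h: "continuous_on {0..1} h" and C: "0 \<le> C"
    and le: "\<And>x. x \<in> {0..1} \<Longrightarrow> \<bar>h x\<bar> \<le> d + C * integral {0..x} (\<lambda>y. \<bar>h y\<bar>)"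
    and x: "x \<in> {0..1}"
  shows "\<bar>h x\<bar> \<le> d * exp C"
proof -
  have ha: "continuous_on {0..1} (\<lambda>y. \<bar>h y\<bar>)" by (intro continuous_intros h)
  let ?I = "\<lambda>x. integral {0..x} (\<lambda>y. \<bar>h y\<bar>)"
  have d0: "0 \<le> d" using le[of 0] by simp
  have "- ((d + C * ?I 0) * exp (- C * 0)) \<le> - ((d + C * ?I x) * exp (- C * x))"
  proof (rule mono_on_unit_interval[where f="\<lambda>x. - ((d + C * ?I x) * exp (- C * x))"])
    fix t :: real assume t: "t \<in> {0..1}"
    show "((\<lambda>x. - ((d + C * ?I x) * exp (- C * x))) has_real_derivative
        C * exp (- C * t) * (d + C * ?I t - \<bar>h t\<bar>)) (at t within {0..1})"
      using integral_has_real_derivative[OF ha t]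
      by (auto intro!: derivative_eq_intros simp: algebra_simps)
    show "0 \<le> C * exp (- C * t) * (d + C * ?I t - \<bar>h t\<bar>)" using le[OF t] C by simp
  qed (use x in auto)
  then have "(d + C * ?I x) * exp (- (C * x)) \<le> d" by simp
  then have "d + C * ?I x \<le> d * exp (C * x)" by (simp add: exp_minus field_simps)
  also have "\<dots> \<le> d * exp C" using x C d0 mult_left_mono[of x 1 C] by (intro mult_left_mono) auto
  finally show ?thesis using le[OF x] by simp
qed

text \<open>Converts integrals in time of a free wave into integrals of its profile over space, to
  which \<open>reflected_integral_bounds\<close> applies.\<close>

lemma integral_wave:
  fixes \<omega> :: "real \<Rightarrow> real"
  assumes "continuous_on UNIV \<omega>"
  shows "integral {a..b} (\<lambda>\<tau>. (\<omega> (z + \<tau>) + \<omega> (z - \<tau>)) / 2)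
       = (integral {a + z..b + z} \<omega> + integral {z - b..z - a} \<omega>) / 2"
proof -
  have c: "continuous_on S \<omega>" for S by (rule continuous_on_subset[OF assms]) simp
  have s1: "integral {a..b} (\<lambda>\<tau>. \<omega> (z + \<tau>)) = integral {a + z..b + z} \<omega>"
    using integral_shift_Icc_real[of a b \<omega> z] by (simp add: o_def)
  have s2: "integral {a..b} (\<lambda>\<tau>. \<omega> (z - \<tau>)) = integral {z - b..z - a} \<omega>"
    using Henstock_Kurzweil_Integration.integral_reflect_real[of "- a" "- b" "\<lambda>\<tau>. \<omega> (z + \<tau>)"] integral_shift_Icc_real[of "- b" "- a" \<omega> z]
    by (simp add: o_def add.commute)
  have "(\<lambda>\<tau>. \<omega> (z + \<tau>)) integrable_on {a..b}" "(\<lambda>\<tau>. \<omega> (z - \<tau>)) integrable_on {a..b}"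
    by (intro integrable_continuous_real continuous_on_compose2[OF assms] continuous_intros subset_UNIV)+
  then have "integral {a..b} (\<lambda>\<tau>. \<omega> (z + \<tau>) + \<omega> (z - \<tau>)) = integral {a + z..b + z} \<omega> + integral {z - b..z - a} \<omega>"
    by (simp add: Henstock_Kurzweil_Integration.integral_add s1 s2)
  then show ?thesis by simp
qed

lemma abs_average_le: "\<bar>a\<bar> \<le> c \<Longrightarrow> \<bar>b\<bar> \<le> c \<Longrightarrow> \<bar>(a + b) / 2\<bar> \<le> c" for a b c :: real
  by (auto simp: abs_le_iff field_simps)

lemma half_sum_le: "J \<le> Z \<Longrightarrow> Z + H \<le> g \<Longrightarrow> 1 / 2 * (J + 2 * H) \<le> 1 / 2 * Z + (g - Z)" for J H Z g :: real
  by (simp add: field_simps)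

section \<open>The inverse transform, estimated on domains of dependence\<close>

context backstepping
begin

text \<open>\<open>W\<close> is the free wave with the Cauchy data of \<open>U\<close> at
  \<open>x = 0\<close>. The difference \<open>U - W\<close> obeys a Volterra inequality whose source
  is a window integral of \<open>W\<close>, controlled by \<open>\<omega>\<close> on the physical
  side. A bound uniform in \<open>t\<close> comes from \<open>iterated_Gronwall\<close>; one more
  round at \<open>t = 0\<close>, with a better source, gives the factor
  \<open>1 / 2\<close>.\<close>

lemma tame_bound:
  assumes tame: "tame \<omega> U"
    and M: "\<And>y. y \<in> {0..1} \<Longrightarrow> \<bar>B y\<bar> \<le> M"
    and s: "0 \<le> s" "q \<noteq> \<infinity> \<Longrightarrow> - s \<le> real_of_ereal q"
    and X: "X \<in> {0..1}"
  shows "\<bar>U X 0 - \<omega> X\<bar> \<le> M / 2 * exp (s + M / 3) * X * integral {0..X} (\<lambda>r. \<bar>\<omega> r\<bar>)"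
proof -
  have M0: "0 \<le> M" using M[of 0] by simp
  have X01: "0 \<le> X" "X \<le> 1" using X by auto
  have \<omega>c: "continuous_on UNIV \<omega>" and Uc: "\<And>z. continuous_on UNIV (U z)"
    and refl: "\<And>y. y \<in> {0..1} \<Longrightarrow> integral {- y..0} \<omega> = integral {0..y} (\<lambda>r. refl_kernel q (y - r) * \<omega> r)"
    and eq: "\<And>x t. x \<in> {0..1} \<Longrightarrow> ((\<lambda>z. B z * integral {t - (x - z)..t + (x - z)} (U z))
        has_integral \<omega> (x + t) + \<omega> (x - t) - 2 * U x t) {0..x}"
    using tame unfolding tame_def by blast+
  obtain CU where CU: "\<And>z t. z \<in> {0..1} \<Longrightarrow> \<bar>U z t\<bar> \<le> CU" using tame unfolding tame_def by blast
  define A where "A = integral {0..X} (\<lambda>r. \<bar>\<omega> r\<bar>)"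
  note rb = reflected_integral_bounds[OF \<omega>c refl s X01(2), folded A_def]
  have c: "continuous_on S \<omega>" for S by (rule continuous_on_subset[OF \<omega>c]) simp
  have A0: "0 \<le> A" unfolding A_def by (intro integral_nonneg integrable_continuous_real continuous_intros c) auto
  define W where "W = (\<lambda>x t. (\<omega> (x + t) + \<omega> (x - t)) / 2)"
  define IW where "IW = (\<lambda>x t z. integral {t - (x - z)..t + (x - z)} (W z))"
  have IW: "IW x t z = (integral {t - x + 2 * z..t + x} \<omega> + integral {- t - x + 2 * z..x - t} \<omega>) / 2" for x t z
    unfolding IW_def W_def integral_wave[OF \<omega>c] by (simp add: algebra_simps)
  have Wc: "continuous_on S (W z)" for z S
    unfolding W_def by (intro continuous_intros continuous_on_compose2[OF \<omega>c] subset_UNIV) auto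
  \<comment> \<open>The domain of dependence of \<open>(X, 0)\<close> when \<open>x\<close> plays
    the role of time: all windows stay inside, and there \<open>W\<close> uses
    \<open>\<omega>\<close> only on \<open>{-X..X}\<close>.\<close>
  define P where "P = {(x, t). 0 \<le> x \<and> x + \<bar>t\<bar> \<le> X}"
  have key: "\<bar>U x t - W x t\<bar> \<le> (1 / 2) * integral {0..x} (\<lambda>z. M * (g z + 2 * (x - z) * \<phi> z))"
    if p: "(x, t) \<in> P" and \<phi>: "continuous_on {0..1} \<phi>"
      and b: "\<And>x t. (x, t) \<in> P \<Longrightarrow> \<bar>U x t - W x t\<bar> \<le> \<phi> x"
      and g: "continuous_on {0..x} g" "\<And>z. z \<in> {0..x} \<Longrightarrow> \<bar>IW x t z\<bar> \<le> g z" for x t \<phi> g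
  proof -
    have x: "0 \<le> x" "x + \<bar>t\<bar> \<le> X" "x \<in> {0..1}" using p X by (auto simp: P_def)
    have "\<bar>integral {0..x} (\<lambda>z. B z * integral {t - (x - z)..t + (x - z)} (U z))\<bar> \<le> integral {0..x} (\<lambda>z. M * (g z + 2 * (x - z) * \<phi> z))"
      unfolding real_norm_def[symmetric]
    proof (rule integral_norm_bound_integral)
      show "(\<lambda>z. B z * integral {t - (x - z)..t + (x - z)} (U z)) integrable_on {0..x}"
        using eq[OF x(3)] by (rule has_integral_integrable)
      show "(\<lambda>z. M * (g z + 2 * (x - z) * \<phi> z)) integrable_on {0..x}"
        by (intro integrable_continuous_real continuous_intros g continuous_on_subset[OF \<phi>]) (use x in auto)
      fix z assume z: "z \<in> {0..x}"
      have "integral {t - (x - z)..t + (x - z)} (U z) = IW x t z + integral {t - (x - z)..t + (x - z)} (\<lambda>\<tau>. U z \<tau> - W z \<tau>)"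
        unfolding IW_def
        by (subst Henstock_Kurzweil_Integration.integral_diff)
          (auto intro!: integrable_continuous_real Wc continuous_on_subset[OF Uc])
      moreover have "\<bar>integral {t - (x - z)..t + (x - z)} (\<lambda>\<tau>. U z \<tau> - W z \<tau>)\<bar> \<le> 2 * (x - z) * \<phi> z"
      proof -
        have "\<bar>integral {t - (x - z)..t + (x - z)} (\<lambda>\<tau>. U z \<tau> - W z \<tau>)\<bar> \<le> integral {t - (x - z)..t + (x - z)} (\<lambda>\<tau>. \<phi> z)"
        proof (rule integral_abs_le_abs_integral)
          show "continuous_on {t - (x - z)..t + (x - z)} (\<lambda>\<tau>. U z \<tau> - W z \<tau>)"
            by (intro continuous_intros Wc continuous_on_subset[OF Uc]) auto
          show "\<bar>U z \<tau> - W z \<tau>\<bar> \<le> \<phi> z" if "\<tau> \<in> {t - (x - z)..t + (x - z)}" for \<tau>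
            by (rule b) (use that z x in \<open>auto simp: P_def\<close>)
        qed auto
        then show ?thesis using z by simp
      qed
      ultimately have "\<bar>integral {t - (x - z)..t + (x - z)} (U z)\<bar> \<le> g z + 2 * (x - z) * \<phi> z"
        using g(2)[OF z] by linarith
      then have "\<bar>B z\<bar> * \<bar>integral {t - (x - z)..t + (x - z)} (U z)\<bar> \<le> M * (g z + 2 * (x - z) * \<phi> z)"
        by (intro mult_mono M) (use z x M0 in auto)
      then show "norm (B z * integral {t - (x - z)..t + (x - z)} (U z)) \<le> M * (g z + 2 * (x - z) * \<phi> z)"
        by (simp add: abs_mult)
    qed
    then show ?thesis using integral_unique[OF eq[OF x(3), of t]] by (simp add: W_def abs_minus_commute field_simps)
  qed
  have bound: "\<bar>U x t - W x t\<bar> \<le> growth (M * exp s * A) M x" if p: "(x, t) \<in> P" for x t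
  proof -
    obtain Cw where Cw: "\<And>x. x \<in> {-1..1} \<Longrightarrow> \<bar>\<omega> x\<bar> \<le> Cw" using continuous_on_Icc_bounded[OF c] by blast
    have "(\<lambda>(x, t). \<bar>U x t - W x t\<bar>) (x, t) \<le> growth (M * exp s * A) M (fst (x, t))"
    proof (rule iterated_Gronwall[where P=P and \<xi>=fst and Q="CU + Cw" and f="\<lambda>(x, t). \<bar>U x t - W x t\<bar>"])
      fix p assume "p \<in> P"
      then obtain x t where xt: "p = (x, t)" "0 \<le> x" "x + \<bar>t\<bar> \<le> X" by (auto simp: P_def)
      then show "fst p \<in> {0..1}" using X01 by auto
      have "\<bar>\<omega> (x + t)\<bar> \<le> Cw" "\<bar>\<omega> (x - t)\<bar> \<le> Cw" "\<bar>U x t\<bar> \<le> CU"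
        using xt X01 by (auto intro!: Cw CU)
      then have "\<bar>U x t - W x t\<bar> \<le> CU + Cw" unfolding W_def abs_le_iff by (auto simp: field_simps)
      then show "(\<lambda>(x, t). \<bar>U x t - W x t\<bar>) p \<le> CU + Cw" by (simp add: xt(1))
    next
      fix \<phi> :: "real \<Rightarrow> real" and p :: "real \<times> real"
      assume \<phi>: "continuous_on {0..1} \<phi>" and b: "\<And>p. p \<in> P \<Longrightarrow> (\<lambda>(x, t). \<bar>U x t - W x t\<bar>) p \<le> \<phi> (fst p)"
        and "p \<in> P"
      then obtain x t where xt: "p = (x, t)" "(x, t) \<in> P" "0 \<le> x" "x + \<bar>t\<bar> \<le> X" by (auto simp: P_def)
      have "\<bar>U x t - W x t\<bar> \<le> (1 / 2) * integral {0..x} (\<lambda>z. M * (2 * exp s * A + 2 * (x - z) * \<phi> z))"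
      proof (rule key[OF xt(2) \<phi>])
        show "\<bar>U x t - W x t\<bar> \<le> \<phi> x" if "(x, t) \<in> P" for x t using b[OF that] by simp
        show "\<bar>IW x t z\<bar> \<le> 2 * exp s * A" if z: "z \<in> {0..x}" for z
        proof -
          have "\<bar>integral {t - x + 2 * z..t + x} \<omega>\<bar> \<le> 2 * exp s * A"
            by (rule rb(1)) (use xt z in auto)
          moreover have "\<bar>integral {- t - x + 2 * z..x - t} \<omega>\<bar> \<le> 2 * exp s * A"
            by (rule rb(1)) (use xt z in auto)
          ultimately show ?thesis unfolding IW by (rule abs_average_le)
        qed
      qed auto
      also have "integral {0..x} (\<lambda>z. M * (2 * exp s * A + 2 * (x - z) * \<phi> z))
          = integral {0..x} (\<lambda>z. 2 * M * exp s * A + 2 * M * ((x - z) * \<phi> z))"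
        by (simp add: algebra_simps)
      also have "\<dots> = 2 * M * exp s * A * x + 2 * M * integral {0..x} (\<lambda>z. (x - z) * \<phi> z)"
      proof (rule integral_unique, intro has_integral_add has_integral_mult_right integrable_integral integrable_continuous_real)
        show "((\<lambda>z. 2 * M * exp s * A) has_integral 2 * M * exp s * A * x) {0..x}"
          using has_integral_const_real[of "2 * M * exp s * A" 0 x] xt(3) by (simp add: mult.commute)
        show "continuous_on {0..x} (\<lambda>z. (x - z) * \<phi> z)"
          by (intro continuous_intros continuous_on_subset[OF \<phi>]) (use xt X01 in auto)
      qed
      finally show "(\<lambda>(x, t). \<bar>U x t - W x t\<bar>) p \<le> M * exp s * A * fst p + M * integral {0..fst p} (\<lambda>z. (fst p - z) * \<phi> z)"
        by (simp add: xt(1))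
    qed (use M0 A0 p in auto)
    then show ?thesis by simp
  qed
  \<comment> \<open>At \<open>(X, 0)\<close> both windows coincide with
    \<open>{2 * z - X..X}\<close>. The substitution of \<open>X - z\<close> for \<open>z\<close>
    changes the sign of the lower end point, so the paired bound \<open>rb(2)\<close> applies: on
    average \<open>j\<close> is at most \<open>exp s * A\<close>, half of the uniform bound.\<close>
  define j where "j = (\<lambda>z. \<bar>integral {2 * z - X..X} \<omega>\<bar>)"
  have jc: "continuous_on {0..X} j"
  proof -
    have "continuous_on {-X..X} (\<lambda>y. integral {y..X} \<omega>)"
      by (rule indefinite_integral_continuous_1'[OF integrable_continuous_real[OF c]])
    then have "continuous_on {0..X} (\<lambda>z. integral {2 * z - X..X} \<omega>)"
      by (rule continuous_on_compose2) (auto intro!: continuous_intros)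
    then show ?thesis unfolding j_def by (intro continuous_intros)
  qed
  have jI: "integral {0..X} j \<le> exp s * A * X"
  proof -
    have "integral {0..X} (\<lambda>z. j (X - z)) = integral {0..X} j"
    proof -
      have "integral {0..X} (\<lambda>z. j (X - z)) = integral {- X..0} (\<lambda>z. j (X + z))"
        using Henstock_Kurzweil_Integration.integral_reflect_real[of 0 "- X" "\<lambda>z. j (X + z)"] by simp
      then show ?thesis using integral_shift_Icc_real[of "- X" 0 j X] by (simp add: o_def)
    qed
    moreover have jc': "continuous_on {0..X} (\<lambda>z. j (X - z))"
      by (rule continuous_on_compose2[OF jc]) (auto intro!: continuous_intros)
    ultimately have "2 * integral {0..X} j = integral {0..X} (\<lambda>z. j z + j (X - z))"
      using Henstock_Kurzweil_Integration.integral_add[OF integrable_continuous_real[OF jc] integrable_continuous_real[OF jc']] by simp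
    also have "\<dots> \<le> integral {0..X} (\<lambda>z. 2 * exp s * A)"
    proof (rule integral_le)
      fix z assume z: "z \<in> {0..X}"
      show "j z + j (X - z) \<le> 2 * exp s * A"
      proof (cases "2 * z \<le> X")
        case True
        then show ?thesis using rb(2)[of "X - 2 * z"] z unfolding j_def by (simp add: algebra_simps)
      next
        case False
        then show ?thesis using rb(2)[of "2 * z - X"] z unfolding j_def by (simp add: algebra_simps)
      qed
    qed (intro integrable_continuous_real continuous_intros jc jc')+
    finally show ?thesis using X01 by (simp add: mult_ac)
  qed
  let ?g = "growth (M * exp s * A) M"
  have "\<bar>U X 0 - W X 0\<bar> \<le> (1 / 2) * integral {0..X} (\<lambda>z. M * (j z + 2 * (X - z) * ?g z))"
  proof (rule key[OF _ growth_cont bound])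
    show "(X, 0) \<in> P" using X01 by (simp add: P_def)
    show "\<bar>IW X 0 z\<bar> \<le> j z" for z unfolding IW j_def by (simp add: algebra_simps)
  qed (use jc in simp_all)
  also have "integral {0..X} (\<lambda>z. M * (j z + 2 * (X - z) * ?g z)) = integral {0..X} (\<lambda>z. M * j z + 2 * M * ((X - z) * ?g z))"
    by (simp add: algebra_simps)
  also have "\<dots> = M * integral {0..X} j + 2 * M * integral {0..X} (\<lambda>z. (X - z) * ?g z)"
    by (rule integral_unique, intro has_integral_add has_integral_mult_right integrable_integral integrable_continuous_real continuous_intros jc growth_cont)
  also have "\<dots> = M * integral {0..X} j + 2 * (M * integral {0..X} (\<lambda>z. (X - z) * ?g z))" by simp
  also have "(1 / 2) * \<dots> \<le> (1 / 2) * (M * exp s * A * X) + (?g X - M * exp s * A * X)"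
  proof -
    have "M * integral {0..X} j \<le> M * exp s * A * X" using mult_left_mono[OF jI M0] by (simp add: mult_ac)
    moreover have "M * exp s * A * X + M * integral {0..X} (\<lambda>z. (X - z) * ?g z) \<le> ?g X"
      by (rule growth_supersolution) (use M0 A0 X in auto)
    ultimately show ?thesis by (rule half_sum_le)
  qed
  also have "\<dots> = M * exp s * A * X * (exp (M * X\<^sup>2 / 6) - 1 / 2)" by (simp add: growth_def algebra_simps)
  \<comment> \<open>From \<open>y - 1 / 2 <= y\<^sup>2 / 2\<close>; squaring doubles the
    \<open>M / 6\<close> of \<open>growth\<close> to the \<open>M / 3\<close> of the claim.\<close>
  also have "\<dots> \<le> M * exp s * A * X * (exp (M / 3) / 2)"
  proof (rule mult_left_mono)
    define y where "y = exp (M * X\<^sup>2 / 6)"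
    have "y - 1 / 2 \<le> y\<^sup>2 / 2" using zero_le_power2[of "y - 1"] by (simp add: power2_eq_square algebra_simps)
    moreover have "y\<^sup>2 \<le> exp (M / 3)"
    proof -
      have "X\<^sup>2 \<le> 1" using X01 by (simp add: power_le_one)
      then have "M * X\<^sup>2 \<le> M * 1" using M0 by (intro mult_left_mono) auto
      moreover have "y\<^sup>2 = exp (M * X\<^sup>2 / 3)" by (simp add: y_def power2_eq_square flip: exp_add)
      ultimately show ?thesis by simp
    qed
    ultimately show "exp (M * X\<^sup>2 / 6) - 1 / 2 \<le> exp (M / 3) / 2" unfolding y_def by linarith
  qed (use M0 A0 X01 in simp)
  finally show ?thesis by (simp add: W_def A_def exp_add mult_ac)
qed

text \<open>The left condition has to survive the approximation. For finite \<open>q\<close> each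
  approximant is \<open>\<gamma> + r * \<Gamma>\<close> with \<open>\<Gamma>\<close> a primitive of
  the cosine sum \<open>\<gamma>\<close>; for \<open>q = \<infinity>\<close> it is
  \<open>sin x * \<gamma> x\<close>, a combination of sines by product formulas.\<close>

lemma tame_dense:
  assumes w: "H2 w w' w''" and lbc: "left_bc q (w 0) (w' 0)" and e: "0 < e"
  obtains \<omega> U where "tame \<omega> U" "\<And>x. x \<in> {0..1} \<Longrightarrow> \<bar>w x - \<omega> x\<bar> \<le> e"
proof (cases "q = \<infinity>")
  case False
  note wD = H2D[OF w]
  define r where "r = real_of_ereal q"
  have basis: "\<exists>\<Gamma> U. \<Gamma> 0 = 0 \<and> (\<forall>x. (\<Gamma> has_real_derivative \<gamma> x) (at x)) \<and> tame (\<lambda>x. \<gamma> x + r * \<Gamma> x) U"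
    if "trig_sum \<gamma>" for \<gamma>
    using that
  proof (induction rule: trig_sum.induct)
    case (cosine k)
    have "left_bc q 1 r" using False by (simp add: left_bc_def r_def)
    then obtain U where "tame (\<lambda>x. 1 * cos (k * x) + r * sk k x) U" using tame_standing_wave by blast
    then show ?case by (intro exI[of _ "sk k"] exI[of _ U]) (auto intro: sk_deriv)
  next
    case (linear f g m n)
    then obtain \<Gamma>1 U1 \<Gamma>2 U2 where 1: "\<Gamma>1 0 = 0" "\<And>x. (\<Gamma>1 has_real_derivative f x) (at x)" "tame (\<lambda>x. f x + r * \<Gamma>1 x) U1"
      and 2: "\<Gamma>2 0 = 0" "\<And>x. (\<Gamma>2 has_real_derivative g x) (at x)" "tame (\<lambda>x. g x + r * \<Gamma>2 x) U2" by blast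
    have "(\<lambda>x. m * (f x + r * \<Gamma>1 x) + n * (g x + r * \<Gamma>2 x)) = (\<lambda>x. m * f x + n * g x + r * (m * \<Gamma>1 x + n * \<Gamma>2 x))"
      by (auto simp: algebra_simps)
    then show ?case using tame_linear[OF 1(3) 2(3), of m n] 1 2
      by (intro exI[of _ "\<lambda>x. m * \<Gamma>1 x + n * \<Gamma>2 x"] exI[of _ "\<lambda>x t. m * U1 x t + n * U2 x t"])
        (auto intro!: DERIV_add DERIV_cmult)
  qed
  \<comment> \<open>\<open>H\<close> solves \<open>H' + r * H = w\<close> with
    \<open>H 0 = 0\<close>, so \<open>w = g + r * H\<close> with \<open>g = H'\<close>, the shape of
    the waves in \<open>basis\<close>.\<close>
  define H where "H = (\<lambda>x. exp (- r * x) * integral {0..x} (\<lambda>y. exp (r * y) * w y))"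
  define g where "g = (\<lambda>x. w x - r * H x)"
  have ec: "continuous_on {0..1} (\<lambda>y. exp (r * y) * w y)" by (intro continuous_intros wD(2))
  have Hd: "(H has_real_derivative g x) (at x within {0..1})" if "x \<in> {0..1}" for x
  proof -
    have "(H has_real_derivative - r * exp (- r * x) * integral {0..x} (\<lambda>y. exp (r * y) * w y) + (exp (r * x) * w x) * exp (- r * x)) (at x within {0..1})"
      unfolding H_def by (intro DERIV_mult integral_has_real_derivative[OF ec that]) (auto intro!: derivative_eq_intros)
    moreover have "- r * exp (- r * x) * integral {0..x} (\<lambda>y. exp (r * y) * w y) + (exp (r * x) * w x) * exp (- r * x) = g x"
    proof -
      have "exp (r * x) * exp (- r * x) = 1" by (simp flip: exp_add)
      then have "(exp (r * x) * w x) * exp (- r * x) = w x" by (metis mult.assoc mult.commute mult_1)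
      then show ?thesis by (simp add: g_def H_def)
    qed
    ultimately show ?thesis by simp
  qed
  have gc: "continuous_on {0..1} g" unfolding g_def by (intro continuous_intros wD(2) DERIV_continuous_on[OF Hd])
  \<comment> \<open>An error \<open>d\<close> in \<open>g\<close> produces an error of at most
    \<open>d\<close> in its primitive, hence at most \<open>(1 + |r|) * d\<close> in
    \<open>w\<close>.\<close>
  have "0 < e / (1 + \<bar>r\<bar>)" using e by (simp add: add_pos_nonneg)
  then obtain \<gamma> where \<gamma>: "trig_sum \<gamma>" "\<And>x. x \<in> {0..1} \<Longrightarrow> \<bar>g x - \<gamma> x\<bar> < e / (1 + \<bar>r\<bar>)"
    using trig_sum_dense[OF gc] by blast
  then obtain \<Gamma> U where G: "\<Gamma> 0 = 0" "\<And>x. (\<Gamma> has_real_derivative \<gamma> x) (at x)" "tame (\<lambda>x. \<gamma> x + r * \<Gamma> x) U"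
    using basis by blast
  show ?thesis
  proof (rule that[OF G(3)])
    fix x :: real assume x: "x \<in> {0..1}"
    have "\<bar>H x - \<Gamma> x\<bar> \<le> e / (1 + \<bar>r\<bar>) * x"
    proof -
      have d: "((\<lambda>x. H x - \<Gamma> x) has_real_derivative g t - \<gamma> t) (at t within {0..1})" if "t \<in> {0..1}" for t
        by (intro DERIV_diff Hd that has_field_derivative_at_within[OF G(2)])
      have "(e / (1 + \<bar>r\<bar>)) * 0 - (H 0 - \<Gamma> 0) \<le> (e / (1 + \<bar>r\<bar>)) * x - (H x - \<Gamma> x)"
      proof (rule mono_on_unit_interval[where f="\<lambda>x. (e / (1 + \<bar>r\<bar>)) * x - (H x - \<Gamma> x)"])
        fix t :: real assume t: "t \<in> {0..1}"
        show "((\<lambda>x. (e / (1 + \<bar>r\<bar>)) * x - (H x - \<Gamma> x)) has_real_derivative e / (1 + \<bar>r\<bar>) - (g t - \<gamma> t)) (at t within {0..1})"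
          by (intro DERIV_diff[OF DERIV_cmult_Id d[OF t]])
        show "0 \<le> e / (1 + \<bar>r\<bar>) - (g t - \<gamma> t)" using \<gamma>(2)[OF t] by linarith
      qed (use x in auto)
      moreover have "(e / (1 + \<bar>r\<bar>)) * 0 + (H 0 - \<Gamma> 0) \<le> (e / (1 + \<bar>r\<bar>)) * x + (H x - \<Gamma> x)"
      proof (rule mono_on_unit_interval[where f="\<lambda>x. (e / (1 + \<bar>r\<bar>)) * x + (H x - \<Gamma> x)"])
        fix t :: real assume t: "t \<in> {0..1}"
        show "((\<lambda>x. (e / (1 + \<bar>r\<bar>)) * x + (H x - \<Gamma> x)) has_real_derivative e / (1 + \<bar>r\<bar>) + (g t - \<gamma> t)) (at t within {0..1})"
          by (intro DERIV_add[OF DERIV_cmult_Id d[OF t]])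
        show "0 \<le> e / (1 + \<bar>r\<bar>) + (g t - \<gamma> t)" using \<gamma>(2)[OF t] by linarith
      qed (use x in auto)
      moreover have "H 0 - \<Gamma> 0 = 0" by (simp add: H_def G(1))
      ultimately show ?thesis by (simp add: abs_le_iff)
    qed
    also have "\<dots> \<le> e / (1 + \<bar>r\<bar>)" using x e by (intro mult_left_le) (auto intro: divide_nonneg_nonneg)
    finally have "\<bar>r\<bar> * \<bar>H x - \<Gamma> x\<bar> \<le> \<bar>r\<bar> * (e / (1 + \<bar>r\<bar>))" by (intro mult_left_mono) auto
    moreover have "\<bar>w x - (\<gamma> x + r * \<Gamma> x)\<bar> \<le> \<bar>g x - \<gamma> x\<bar> + \<bar>r\<bar> * \<bar>H x - \<Gamma> x\<bar>"
    proof -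
      have "w x - (\<gamma> x + r * \<Gamma> x) = (g x - \<gamma> x) + r * (H x - \<Gamma> x)" by (simp add: g_def algebra_simps)
      then show ?thesis using abs_triangle_ineq[of "g x - \<gamma> x" "r * (H x - \<Gamma> x)"] by (simp only: abs_mult)
    qed
    moreover have "e / (1 + \<bar>r\<bar>) + \<bar>r\<bar> * (e / (1 + \<bar>r\<bar>)) = e"
    proof -
      define d where "d = e / (1 + \<bar>r\<bar>)"
      have "(1 + \<bar>r\<bar>) * d = e" by (simp add: d_def)
      then show ?thesis by (simp add: algebra_simps flip: d_def)
    qed
    ultimately show "\<bar>w x - (\<gamma> x + r * \<Gamma> x)\<bar> \<le> e"
      using \<gamma>(2)[OF x] by linarith
  qed
next
  case True
  note wD = H2D[OF w]
  have w0: "w 0 = 0" using lbc True by (simp add: left_bc_def)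
  have lb: "left_bc q 0 k" for k using True by (simp add: left_bc_def)
  have basis: "\<exists>U. tame (\<lambda>x. sin x * \<gamma> x) U" if "trig_sum \<gamma>" for \<gamma>
    using that
  proof (induction rule: trig_sum.induct)
    case (cosine k)
    obtain U1 where 1: "tame (\<lambda>x. 0 * cos ((k + 1) * x) + (k + 1) * sk (k + 1) x) U1" using tame_standing_wave[OF lb] by blast
    obtain U2 where 2: "tame (\<lambda>x. 0 * cos ((k - 1) * x) + (k - 1) * sk (k - 1) x) U2" using tame_standing_wave[OF lb] by blast
    have "(\<lambda>x. (1 / 2) * (0 * cos ((k + 1) * x) + (k + 1) * sk (k + 1) x) + (- 1 / 2) * (0 * cos ((k - 1) * x) + (k - 1) * sk (k - 1) x))
       = (\<lambda>x. sin x * cos (k * x))"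
    proof
      fix x :: real
      have "sin ((k + 1) * x) - sin ((k - 1) * x) = 2 * (sin x * cos (k * x))"
        by (simp add: distrib_right left_diff_distrib sin_add sin_diff)
      then show "(1 / 2) * (0 * cos ((k + 1) * x) + (k + 1) * sk (k + 1) x) + (- 1 / 2) * (0 * cos ((k - 1) * x) + (k - 1) * sk (k - 1) x) = sin x * cos (k * x)"
        by (simp add: sin_eq_sk)
    qed
    then show ?case using tame_linear[OF 1 2, of "1 / 2" "- 1 / 2"] by auto
  next
    case (linear f g m n)
    then obtain U1 U2 where "tame (\<lambda>x. sin x * f x) U1" "tame (\<lambda>x. sin x * g x) U2" by blast
    from tame_linear[OF this, of m n] show ?case by (auto simp: algebra_simps)
  qed
  \<comment> \<open>\<open>w\<close> vanishes at \<open>0\<close> and is differentiable there, so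
    division by \<open>sin\<close> leaves a continuous function with value \<open>w' 0\<close> at
    \<open>0\<close>.\<close>
  define h where "h = (\<lambda>x. if x = 0 then w' 0 else w x / sin x)"
  have sinpos: "0 < sin x" if "0 < x" "x \<le> 1" for x :: real using that pi_gt3 by (intro sin_gt_zero) auto
  have hc: "continuous_on {0..1} h"
    unfolding continuous_on_def
  proof
    fix x :: real assume x: "x \<in> {0..1}"
    show "(h \<longlongrightarrow> h x) (at x within {0..1})"
    proof (cases "x = 0")
      case True
      have "((\<lambda>y. w y / y) \<longlongrightarrow> w' 0) (at 0 within {0..1})"
        using wD(4)[of 0] w0 unfolding has_field_derivative_iff by simp
      moreover have "((\<lambda>y::real. sin y / y) \<longlongrightarrow> 1) (at 0 within {0..1})"
        using DERIV_sin[of 0] unfolding has_field_derivative_iff by (auto intro: tendsto_within_subset)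
      ultimately have "((\<lambda>y. (w y / y) / (sin y / y)) \<longlongrightarrow> w' 0 / 1) (at 0 within {0..1})"
        by (rule tendsto_divide) simp
      then have "(h \<longlongrightarrow> w' 0 / 1) (at 0 within {0..1})"
        by (rule Lim_transform_eventually) (auto simp: eventually_at_filter h_def)
      then show ?thesis using True by (simp add: h_def)
    next
      case False
      then have x0: "0 < x" "x \<le> 1" using x by auto
      have "((\<lambda>y. w y / sin y) \<longlongrightarrow> w x / sin x) (at x within {0..1})"
        using wD(2) x sinpos[OF x0] by (intro tendsto_divide) (auto simp: continuous_on_def intro!: tendsto_intros)
      moreover have "eventually (\<lambda>y. w y / sin y = h y) (at x within {0..1})"
        using eventually_at_topological x0 by (auto simp: eventually_at_topological h_def intro!: exI[of _ "{0<..}"])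
      ultimately have "(h \<longlongrightarrow> w x / sin x) (at x within {0..1})" by (rule Lim_transform_eventually)
      then show ?thesis using x0 by (simp add: h_def)
    qed
  qed
  obtain \<gamma> where \<gamma>: "trig_sum \<gamma>" "\<And>x. x \<in> {0..1} \<Longrightarrow> \<bar>h x - \<gamma> x\<bar> < e"
    using trig_sum_dense[OF hc e] by blast
  obtain U where U: "tame (\<lambda>x. sin x * \<gamma> x) U" using basis[OF \<gamma>(1)] by blast
  show ?thesis
  proof (rule that[OF U])
    fix x :: real assume x: "x \<in> {0..1}"
    have "w x = sin x * h x" using x sinpos[of x] w0 by (cases "x = 0") (auto simp: h_def)
    then have "\<bar>w x - sin x * \<gamma> x\<bar> = \<bar>sin x\<bar> * \<bar>h x - \<gamma> x\<bar>" by (simp flip: right_diff_distrib add: abs_mult)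
    also have "\<dots> \<le> 1 * e" using \<gamma>(2)[OF x] by (intro mult_mono) auto
    finally show "\<bar>w x - sin x * \<gamma> x\<bar> \<le> e" by simp
  qed
qed

text \<open>The bound for tame waves passes to all admissible profiles. Gronwall controls
  \<open>u - U\<close> by the error in the transform; its poor constant \<open>exp C\<close>
  multiplies only that error.\<close>

theorem inverse_bound:
  assumes u: "H2 u u' u''" and lbc: "left_bc q (u 0) (u' 0)"
    and M: "\<And>y. y \<in> {0..1} \<Longrightarrow> \<bar>B y\<bar> \<le> M"
    and s: "0 \<le> s" "q \<noteq> \<infinity> \<Longrightarrow> - s \<le> real_of_ereal q"
    and X: "X \<in> {0..1}"
  defines "w \<equiv> backstep K u"
  shows "\<bar>u X - w X\<bar> \<le> M / 2 * exp (s + M / 3) * X * integral {0..X} (\<lambda>r. \<bar>w r\<bar>)"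
proof (rule field_le_epsilon)
  fix e' :: real assume e': "0 < e'"
  note BI = backstep_intertwines[OF u lbc, folded w_def]
  define w' where "w' = (\<lambda>x. u' x - K (x, x) * u x - (LINT y|lebesgue_on {0..x}. Kx (x, y) * u y))"
  have wH: "H2 w w' (backstep K (\<lambda>y. u'' y + B y * u y))" using BI(1) by (simp only: w'_def)
  have wl: "left_bc q (w 0) (w' 0)" using lbc BI(2) by (simp add: w'_def diag_0)
  have wc: "continuous_on {0..1} w" by (rule H2D(2)[OF wH])
  have uc: "continuous_on {0..1} u" by (rule H2D(2)[OF u])
  have M0: "0 \<le> M" using M[of 0] by simp
  obtain C where C: "C > 0" "\<And>x y. 0 \<le> y \<Longrightarrow> y \<le> x \<Longrightarrow> x \<le> 1 \<Longrightarrow> \<bar>K (x, y)\<bar> \<le> C"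
    using continuous_on_triangle_bounded[OF KD(3)] by blast
  define D where "D = M / 2 * exp (s + M / 3)"
  have D0: "0 \<le> D" using M0 by (simp add: D_def)
  \<comment> \<open>Three errors are collected: \<open>exp C\<close> from \<open>u - U\<close>,
    \<open>1\<close> from \<open>w - \<omega>\<close>, and \<open>D\<close> from the integral of
    \<open>\<omega>\<close>.\<close>
  define e where "e = e' / (exp C + 1 + D)"
  have e: "0 < e" using e' D0 by (simp add: e_def add_pos_nonneg add_pos_pos)
  have ee: "e * (exp C + 1 + D) = e'" using D0 add_pos_nonneg[of "exp C + 1" D] by (simp add: e_def add_pos_pos)
  obtain \<omega> U where tame: "tame \<omega> U" and near: "\<And>x. x \<in> {0..1} \<Longrightarrow> \<bar>w x - \<omega> x\<bar> \<le> e"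
    using tame_dense[OF wH wl e] by blast
  have \<omega>c: "continuous_on S \<omega>" for S using tame by (auto simp: tame_def intro: continuous_on_subset)
  have vc: "continuous_on {0..1} (\<lambda>x. U x 0)" using tame by (simp add: tame_def)
  define h where "h = (\<lambda>x. u x - U x 0)"
  have hc: "continuous_on {0..1} h" unfolding h_def by (intro continuous_intros uc vc)
  have hb: "\<bar>h x\<bar> \<le> e * exp C" if "x \<in> {0..1}" for x
  proof (rule Gronwall[OF hc _ _ that])
    fix x :: real assume x: "x \<in> {0..1}"
    have "backstep K h x = w x - \<omega> x"
      using backstep_linear[OF KD(3) continuous_imp_integrable_real[OF uc] continuous_imp_integrable_real[OF vc] x, of 1 "-1"] tame x
      by (simp add: tame_def w_def h_def)
    then have hx: "h x = (w x - \<omega> x) + (LINT y|lebesgue_on {0..x}. K (x, y) * h y)" by (simp add: backstep_def)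
    have "\<bar>LINT y|lebesgue_on {0..x}. K (x, y) * h y\<bar> \<le> C * (LINT y|lebesgue_on {0..x}. \<bar>h y\<bar>)"
      by (rule Volterra_abs_le[OF KD(3) continuous_imp_integrable_real[OF hc] x]) (use C x in auto)
    also have "(LINT y|lebesgue_on {0..x}. \<bar>h y\<bar>) = integral {0..x} (\<lambda>y. \<bar>h y\<bar>)"
      by (rule LINT_continuous_eq_integral) (intro continuous_intros continuous_on_subset[OF hc], use x in auto)
    finally show "\<bar>h x\<bar> \<le> e + C * integral {0..x} (\<lambda>y. \<bar>h y\<bar>)" using near[OF x] hx by linarith
  qed (use C in simp)
  have sub: "{0..X} \<subseteq> {0..1}" using X by auto
  have "integral {0..X} (\<lambda>r. \<bar>\<omega> r\<bar>) \<le> integral {0..X} (\<lambda>r. \<bar>w r\<bar> + e)"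
  proof (rule integral_le)
    show "(\<lambda>r. \<bar>\<omega> r\<bar>) integrable_on {0..X}" by (intro integrable_continuous_real continuous_intros \<omega>c)
    show "(\<lambda>r. \<bar>w r\<bar> + e) integrable_on {0..X}" by (intro integrable_continuous_real continuous_intros continuous_on_subset[OF wc sub])
    show "\<bar>\<omega> r\<bar> \<le> \<bar>w r\<bar> + e" if "r \<in> {0..X}" for r using near[of r] that sub by fastforce
  qed
  also have "\<dots> = integral {0..X} (\<lambda>r. \<bar>w r\<bar>) + e * X"
  proof (rule integral_unique, rule has_integral_add)
    show "((\<lambda>r. \<bar>w r\<bar>) has_integral integral {0..X} (\<lambda>r. \<bar>w r\<bar>)) {0..X}"
      by (intro integrable_integral integrable_continuous_real continuous_intros continuous_on_subset[OF wc sub])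
    show "((\<lambda>r. e) has_integral e * X) {0..X}" using has_integral_const_real[of e 0 X] X by (simp add: mult.commute)
  qed
  finally have "D * X * integral {0..X} (\<lambda>r. \<bar>\<omega> r\<bar>) \<le> D * X * (integral {0..X} (\<lambda>r. \<bar>w r\<bar>) + e * X)"
    using D0 X by (intro mult_left_mono) auto
  also have "\<dots> \<le> D * X * integral {0..X} (\<lambda>r. \<bar>w r\<bar>) + D * e"
  proof -
    have "X * X \<le> 1 * 1" using X by (intro mult_mono) auto
    then have "(D * e) * (X * X) \<le> (D * e) * 1" using D0 e by (intro mult_left_mono) auto
    then show ?thesis by (simp add: algebra_simps)
  qed
  finally have "\<bar>U X 0 - \<omega> X\<bar> \<le> D * X * integral {0..X} (\<lambda>r. \<bar>w r\<bar>) + D * e"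
    using tame_bound[OF tame M s X] by (simp add: D_def)
  then have "\<bar>u X - w X\<bar> \<le> D * X * integral {0..X} (\<lambda>r. \<bar>w r\<bar>) + e * (exp C + 1 + D)"
    using hb[OF X] near[OF X] unfolding h_def by (simp add: algebra_simps)
  then have "\<bar>u X - w X\<bar> \<le> D * X * integral {0..X} (\<lambda>r. \<bar>w r\<bar>) + e'" unfolding ee .
  then show "\<bar>u X - w X\<bar> \<le> M / 2 * exp (s + M / 3) * X * integral {0..X} (\<lambda>r. \<bar>w r\<bar>) + e'"
    by (simp add: D_def)
qed

end

section \<open>Bounds in the norm of \<open>L\<^sup>2\<close>\<close>

lemma inner2_commute: "inner2 g h = inner2 h g"
  by (simp add: inner2_def mult.commute)

lemma inner2_linear:
  assumes "f \<in> L2" "g \<in> L2" "h \<in> L2"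
  shows "inner2 (\<lambda>x. r * f x + s * g x) h = r * inner2 f h + s * inner2 g h"
proof -
  have "(\<lambda>x. (r * f x + s * g x) * h x) = (\<lambda>x. r * (f x * h x) + s * (g x * h x))" by (auto simp: algebra_simps)
  then show ?thesis
    using L2_mult_integrable[OF assms(1,3)] L2_mult_integrable[OF assms(2,3)] by (simp add: inner2_def)
qed

lemma inner2_self_nonneg: "0 \<le> inner2 h h"
  by (simp add: inner2_def)

lemma norm2_nonneg: "0 \<le> norm2 h"
  by (simp add: norm2_def inner2_self_nonneg)

lemma norm2_square: "(norm2 h)\<^sup>2 = inner2 h h"
  by (simp add: norm2_def inner2_self_nonneg)

lemma L2_lincomb: "f \<in> L2 \<Longrightarrow> g \<in> L2 \<Longrightarrow> (\<lambda>x. r * f x + s * g x) \<in> L2"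
  by (intro L2_add L2_cmult)

lemma inner2_lincomb_self:
  assumes "f \<in> L2" "g \<in> L2"
  shows "inner2 (\<lambda>x. r * f x + s * g x) (\<lambda>x. r * f x + s * g x)
    = r\<^sup>2 * inner2 f f + 2 * r * s * inner2 f g + s\<^sup>2 * inner2 g g"
proof -
  have L: "(\<lambda>x. r * f x + s * g x) \<in> L2" by (rule L2_lincomb[OF assms])
  show ?thesis
    unfolding inner2_linear[OF assms L] inner2_commute[of _ "\<lambda>x. r * f x + s * g x"]
      inner2_linear[OF assms(1) assms(2) assms(1)] inner2_linear[OF assms(1) assms(2) assms(2)]
    by (simp add: inner2_commute[of g f] power2_eq_square algebra_simps)
qed

lemma Cauchy_Schwarz_L2:
  assumes g: "g \<in> L2" and h: "h \<in> L2"
  shows "\<bar>inner2 g h\<bar> \<le> norm2 g * norm2 h"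
proof -
  have q: "0 \<le> r\<^sup>2 * inner2 g g + 2 * r * inner2 g h + inner2 h h" for r
    using inner2_self_nonneg[of "\<lambda>x. r * g x + 1 * h x"] inner2_lincomb_self[OF g h, of r 1] by simp
  have "(inner2 g h)\<^sup>2 \<le> inner2 g g * inner2 h h"
  proof (cases "inner2 g g = 0")
    case True
    \<comment> \<open>With vanishing leading coefficient the quadratic is affine in
      \<open>r\<close>, and the chosen \<open>r\<close> would give it the value
      \<open>- 1\<close>.\<close>
    have "inner2 g h = 0"
    proof (rule ccontr)
      assume n: "inner2 g h \<noteq> 0"
      have "2 * (- (inner2 h h + 1) / (2 * inner2 g h)) * inner2 g h = - (inner2 h h + 1)" using n by simp
      then show False using q[of "- (inner2 h h + 1) / (2 * inner2 g h)"] True by simp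
    qed
    then show ?thesis using True by simp
  next
    case False
    then have p: "0 < inner2 g g" using inner2_self_nonneg[of g] by simp
    have "(- inner2 g h / inner2 g g)\<^sup>2 * inner2 g g + 2 * (- inner2 g h / inner2 g g) * inner2 g h + inner2 h h
        = inner2 h h - (inner2 g h)\<^sup>2 / inner2 g g"
      using p by (simp add: power2_eq_square field_simps)
    then have "(inner2 g h)\<^sup>2 / inner2 g g \<le> inner2 h h" using q[of "- inner2 g h / inner2 g g"] by simp
    then show ?thesis using p by (simp add: pos_divide_le_eq mult.commute)
  qed
  then have "(inner2 g h)\<^sup>2 \<le> (norm2 g * norm2 h)\<^sup>2" by (simp add: power_mult_distrib norm2_square)
  then show ?thesis
    using abs_le_square_iff[of "inner2 g h" "norm2 g * norm2 h"] norm2_nonneg[of g] norm2_nonneg[of h] by simp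
qed

lemma norm2_triangle:
  assumes g: "g \<in> L2" and h: "h \<in> L2"
  shows "norm2 (\<lambda>x. g x + h x) \<le> norm2 g + norm2 h"
proof (rule power2_le_imp_le)
  have "(norm2 (\<lambda>x. g x + h x))\<^sup>2 = inner2 g g + 2 * inner2 g h + inner2 h h"
    using inner2_lincomb_self[OF g h, of 1 1] by (simp add: norm2_square)
  also have "\<dots> \<le> (norm2 g + norm2 h)\<^sup>2"
    using Cauchy_Schwarz_L2[OF g h] by (simp add: power2_sum norm2_square[symmetric])
  finally show "(norm2 (\<lambda>x. g x + h x))\<^sup>2 \<le> (norm2 g + norm2 h)\<^sup>2" .
qed (simp add: norm2_nonneg)

lemma norm2_cmult: "norm2 (\<lambda>x. r * h x) = \<bar>r\<bar> * norm2 h"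
proof -
  have "inner2 (\<lambda>x. r * h x) (\<lambda>x. r * h x) = r\<^sup>2 * inner2 h h"
    by (simp add: inner2_def power2_eq_square mult_ac)
  then show ?thesis by (simp add: norm2_def real_sqrt_mult)
qed

lemma inner2_cong_AE:
  assumes "g \<in> L2" "g' \<in> L2" "h \<in> L2" "h' \<in> L2" "AE x in unitM. g x = g' x" "AE x in unitM. h x = h' x"
  shows "inner2 g h = inner2 g' h'"
  unfolding inner2_def
proof (rule integral_cong_AE)
  show "(\<lambda>x. g x * h x) \<in> borel_measurable unitM" "(\<lambda>x. g' x * h' x) \<in> borel_measurable unitM"
    using assms by (auto intro!: borel_measurable_integrable L2_mult_integrable)
  show "AE x in unitM. g x * h x = g' x * h' x" using assms(5,6) by eventually_elim simp
qed

lemma norm2_cong_AE: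
  "g \<in> L2 \<Longrightarrow> h \<in> L2 \<Longrightarrow> AE x in unitM. g x = h x \<Longrightarrow> norm2 g = norm2 h"
  using inner2_cong_AE[of g h g h] by (simp add: norm2_def)

lemma norm2_mono:
  assumes g: "g \<in> L2" and h: "h \<in> L2" and le: "\<And>x. x \<in> {0..1} \<Longrightarrow> \<bar>g x\<bar> \<le> C * \<bar>h x\<bar>" and C: "0 \<le> C"
  shows "norm2 g \<le> C * norm2 h"
proof (rule power2_le_imp_le)
  have "inner2 g g \<le> (LINT x|unitM. C\<^sup>2 * (h x * h x))"
    unfolding inner2_def
  proof (rule integral_mono)
    show "integrable unitM (\<lambda>x. g x * g x)" by (rule L2_mult_integrable[OF g g])
    show "integrable unitM (\<lambda>x. C\<^sup>2 * (h x * h x))" using L2_mult_integrable[OF h h] by simp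
    fix x assume "x \<in> space unitM"
    then have "\<bar>g x\<bar> * \<bar>g x\<bar> \<le> (C * \<bar>h x\<bar>) * (C * \<bar>h x\<bar>)"
      using le[of x] C by (intro mult_mono) auto
    then show "g x * g x \<le> C\<^sup>2 * (h x * h x)" by (simp add: power2_eq_square mult_ac abs_mult_self_eq)
  qed
  then show "(norm2 g)\<^sup>2 \<le> (C * norm2 h)\<^sup>2"
    by (simp add: power_mult_distrib norm2_square inner2_def)
qed (use C norm2_nonneg in auto)

lemma LINT_abs_le_norm2:
  assumes h: "h \<in> L2" and x: "x \<in> {0..1}"
  shows "(LINT y|lebesgue_on {0..x}. \<bar>h y\<bar>) \<le> sqrt x * norm2 h"
proof -
  define i where "i = (\<lambda>y::real. if y \<in> {0..x} then 1 else 0 :: real)"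
  have sub: "{0..x} \<subseteq> {0..1}" using x by auto
  have iL: "i \<in> L2"
  proof (rule L2_I[where C=1])
    have "(\<lambda>y. 1::real) \<in> borel_measurable (lebesgue_on {0..x})" by simp
    then show "i \<in> borel_measurable unitM"
      unfolding i_def using borel_measurable_if_lebesgue_on[of "{0..x}" "{0..1}" "\<lambda>_. 1 :: real"] sub by simp
  qed (simp add: i_def)
  have aL: "(\<lambda>y. \<bar>h y\<bar>) \<in> L2" using h by (auto simp: L2_def)
  have "inner2 i (\<lambda>y. \<bar>h y\<bar>) = (LINT y|unitM. (if y \<in> {0..x} then \<bar>h y\<bar> else 0))"
    unfolding inner2_def i_def by (rule arg_cong[where f="integral\<^sup>L unitM"]) auto
  also have "\<dots> = (LINT y|lebesgue_on {0..x}. \<bar>h y\<bar>)" by (rule integral_restrict[OF sub]) auto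
  finally have e1: "inner2 i (\<lambda>y. \<bar>h y\<bar>) = \<dots>" .
  have "inner2 i i = (LINT y|unitM. (if y \<in> {0..x} then 1 else 0))"
    unfolding inner2_def i_def by (rule arg_cong[where f="integral\<^sup>L unitM"]) auto
  also have "\<dots> = (LINT y|lebesgue_on {0..x}. 1 :: real)" by (rule integral_restrict[OF sub]) auto
  also have "\<dots> = x" using LINT_continuous_eq_integral[of 0 x "\<lambda>_. 1"] x by simp
  finally have "norm2 i = sqrt x" by (simp add: norm2_def)
  moreover have "norm2 (\<lambda>y. \<bar>h y\<bar>) = norm2 h" by (simp add: norm2_def inner2_def)
  ultimately show ?thesis using Cauchy_Schwarz_L2[OF iL aL] e1 by simp
qed

text \<open>Cauchy-Schwarz adds a factor \<open>sqrt x\<close> to the pointwise factor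
  \<open>x\<close>. The square of their product, \<open>x ^ 3\<close>, has integral
  \<open>1 / 4\<close>, whence \<open>C / 2\<close>; this is why the pointwise bounds retain
  \<open>x\<close>.\<close>

lemma Volterra_norm_le:
  assumes D: "D \<in> L2" and h: "h \<in> L2" and C: "0 \<le> C"
    and le: "\<And>x. x \<in> {0..1} \<Longrightarrow> \<bar>D x\<bar> \<le> C * x * (LINT y|lebesgue_on {0..x}. \<bar>h y\<bar>)"
  shows "norm2 D \<le> C / 2 * norm2 h"
proof (rule power2_le_imp_le)
  have c3: "continuous_on {0..1} (\<lambda>x::real. x ^ 3)" by (intro continuous_intros)
  have "inner2 D D \<le> (LINT x|unitM. (C * norm2 h)\<^sup>2 * x ^ 3)"
    unfolding inner2_def
  proof (rule integral_mono)
    show "integrable unitM (\<lambda>x. D x * D x)" by (rule L2_mult_integrable[OF D D])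
    show "integrable unitM (\<lambda>x. (C * norm2 h)\<^sup>2 * x ^ 3)"
      using continuous_imp_integrable_real[OF c3] by simp
    fix x assume "x \<in> space unitM"
    then have x: "x \<in> {0..1}" "0 \<le> x" by auto
    have b: "\<bar>D x\<bar> \<le> C * x * (sqrt x * norm2 h)"
      using le[OF x(1)] mult_left_mono[OF LINT_abs_le_norm2[OF h x(1)], of "C * x"] C x by simp
    have "\<bar>D x\<bar> * \<bar>D x\<bar> \<le> (C * x * (sqrt x * norm2 h)) * (C * x * (sqrt x * norm2 h))"
      by (rule mult_mono[OF b b]) (use b in auto)
    also have "\<dots> = (C * norm2 h)\<^sup>2 * (x\<^sup>2 * (sqrt x * sqrt x))" by (simp add: power2_eq_square)
    also have "\<dots> = (C * norm2 h)\<^sup>2 * x ^ 3" using x by (simp add: power2_eq_square power3_eq_cube)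
    finally show "D x * D x \<le> (C * norm2 h)\<^sup>2 * x ^ 3" by simp
  qed
  also have "(LINT x|unitM. (C * norm2 h)\<^sup>2 * x ^ 3) = (C * norm2 h)\<^sup>2 * (1 / 4)"
  proof -
    have "(LINT x|unitM. x ^ 3 :: real) = 1 ^ 4 / 4 - 0 ^ 4 / 4"
      by (rule LINT_FTC[OF _ c3]) (auto intro!: derivative_eq_intros)
    then show ?thesis by simp
  qed
  finally show "(norm2 D)\<^sup>2 \<le> (C / 2 * norm2 h)\<^sup>2"
    by (simp add: norm2_square power_mult_distrib power_divide)
qed (use C norm2_nonneg in auto)

context backstepping
begin

context
  fixes M s :: real
  assumes M: "\<And>y. y \<in> {0..1} \<Longrightarrow> \<bar>B y\<bar> \<le> M"
    and s: "0 \<le> s" "q \<noteq> \<infinity> \<Longrightarrow> - s \<le> real_of_ereal q"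
begin

lemma M_nonneg: "0 \<le> M" using M[of 0] by simp

lemma backstep_norm_le:
  assumes h: "h \<in> L2"
  shows "norm2 (backstep K h) \<le> (1 + M / 4 * exp (s + M / 3)) * norm2 h"
proof -
  define D where "D = (\<lambda>x. backstep K h x - h x)"
  have bL: "backstep K h \<in> L2" by (rule backstep_L2[OF KD(3) h])
  have DL: "D \<in> L2" unfolding D_def by (rule L2_diff[OF bL h])
  have "norm2 D \<le> (M / 2 * exp (s + M / 3)) / 2 * norm2 h"
  proof (rule Volterra_norm_le[OF DL h])
    fix x :: real assume x: "x \<in> {0..1}"
    have "\<bar>K (x, y)\<bar> \<le> M / 2 * exp (s + M / 3) * x" if "y \<in> {0..x}" for y
    proof -
      have "\<bar>K (x, y)\<bar> \<le> exp (s * x) * growth (M / 2) M x"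
        by (rule kernel_bound[OF M s]) (use x that in \<open>auto simp: triangle_def\<close>)
      also have "\<dots> = M / 2 * exp (s * x + M * x\<^sup>2 / 6) * x" by (simp add: growth_def exp_add)
      \<comment> \<open>The exponent is weakened from \<open>M / 6\<close> to \<open>M / 3\<close>,
        so that both directions of the transform share one constant.\<close>
      also have "\<dots> \<le> M / 2 * exp (s + M / 3) * x"
      proof (intro mult_right_mono mult_left_mono)
        have "s * x \<le> s * 1" using s x by (intro mult_left_mono) auto
        moreover have "M * x\<^sup>2 \<le> M * 1" using M_nonneg x by (intro mult_left_mono) (auto simp: power_le_one)
        ultimately show "exp (s * x + M * x\<^sup>2 / 6) \<le> exp (s + M / 3)" using M_nonneg by simp
      qed (use x M_nonneg in auto)
      finally show ?thesis .
    qed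
    from Volterra_abs_le[OF KD(3) L2_integrable[OF h] x this]
    show "\<bar>D x\<bar> \<le> M / 2 * exp (s + M / 3) * x * (LINT y|lebesgue_on {0..x}. \<bar>h y\<bar>)"
      by (simp add: D_def backstep_def)
  qed (use M_nonneg in simp)
  moreover have "norm2 (backstep K h) \<le> norm2 h + norm2 D"
    using norm2_triangle[OF h DL] by (simp add: D_def)
  ultimately show ?thesis by (simp add: algebra_simps)
qed

lemma inverse_norm_le:
  assumes u: "H2 u u' u''" and lbc: "left_bc q (u 0) (u' 0)"
  shows "norm2 u \<le> (1 + M / 4 * exp (s + M / 3)) * norm2 (backstep K u)"
proof -
  define w where "w = backstep K u"
  have uL: "u \<in> L2" by (rule continuous_L2[OF H2D(2)[OF u]])
  have wc: "continuous_on {0..1} w" unfolding w_def by (rule H2D(2)[OF backstep_intertwines(1)[OF u lbc]])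
  have wL: "w \<in> L2" by (rule continuous_L2[OF wc])
  define D where "D = (\<lambda>x. u x - w x)"
  have DL: "D \<in> L2" unfolding D_def by (rule L2_diff[OF uL wL])
  have "norm2 D \<le> (M / 2 * exp (s + M / 3)) / 2 * norm2 w"
  proof (rule Volterra_norm_le[OF DL wL])
    fix x :: real assume x: "x \<in> {0..1}"
    have "(LINT y|lebesgue_on {0..x}. \<bar>w y\<bar>) = integral {0..x} (\<lambda>y. \<bar>w y\<bar>)"
      by (rule LINT_continuous_eq_integral) (intro continuous_intros continuous_on_subset[OF wc], use x in auto)
    then show "\<bar>D x\<bar> \<le> M / 2 * exp (s + M / 3) * x * (LINT y|lebesgue_on {0..x}. \<bar>w y\<bar>)"
      using inverse_bound[OF u lbc M s x] by (simp add: D_def w_def)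
  qed (use M_nonneg in simp)
  moreover have "norm2 u \<le> norm2 w + norm2 D"
    using norm2_triangle[OF wL DL] by (simp add: D_def)
  ultimately show ?thesis by (simp add: algebra_simps w_def)
qed

end

end

section \<open>Time derivative of the transformed energy\<close>

lemma norm2_diff_commute: "norm2 (\<lambda>x. g x - h x) = norm2 (\<lambda>x. h x - g x)"
  using norm2_cmult[of "-1" "\<lambda>x. g x - h x"] by simp

lemma abs_norm2_diff_le:
  assumes g: "g \<in> L2" and h: "h \<in> L2"
  shows "\<bar>norm2 g - norm2 h\<bar> \<le> norm2 (\<lambda>x. g x - h x)"
  using norm2_triangle[OF L2_diff[OF g h] h] norm2_triangle[OF L2_diff[OF h g] g] norm2_diff_commute[of g h]
  by simp

text \<open>The time derivative exists only in the sense of \<open>L2\<close>. The difference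
  quotient of \<open>v\<close> is \<open>vt + p\<close> with \<open>p\<close> small in norm;
  boundedness of the transform carries this over to its image, and the square is expanded.\<close>

lemma backstep_norm2_derivative:
  assumes K: "continuous_on triangle K" and C: "\<And>h. h \<in> L2 \<Longrightarrow> norm2 (backstep K h) \<le> C * norm2 h"
    and v: "\<And>r. r \<in> I \<Longrightarrow> v r \<in> L2" and vt: "vt \<in> L2" and t: "t \<in> I"
    and lim: "((\<lambda>r. norm2 (\<lambda>x. (v r x - v t x) / (r - t) - vt x)) \<longlongrightarrow> 0) (at t within I)"
  shows "((\<lambda>r. (norm2 (backstep K (v r)))\<^sup>2) has_real_derivative 2 * inner2 (backstep K (v t)) (backstep K vt)) (at t within I)"
proof -
  define w where "w = backstep K (v t)"
  define z where "z = backstep K vt"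
  define n where "n = (\<lambda>r. norm2 (\<lambda>x. (v r x - v t x) / (r - t) - vt x))"
  have wL: "w \<in> L2" unfolding w_def by (rule backstep_L2[OF K v[OF t]])
  have zL: "z \<in> L2" unfolding z_def by (rule backstep_L2[OF K vt])
  have est: "\<bar>((norm2 (backstep K (v r)))\<^sup>2 - (norm2 w)\<^sup>2) / (r - t) - 2 * inner2 w z\<bar>
      \<le> 2 * (norm2 w * (C * n r)) + \<bar>r - t\<bar> * (C * n r + norm2 z)\<^sup>2" if r: "r \<in> I" "r \<noteq> t" for r
  proof -
    define p where "p = (\<lambda>x. (v r x - v t x) / (r - t) - vt x)"
    have pL: "p \<in> L2"
    proof -
      have "(\<lambda>x. (1 / (r - t)) * (v r x - v t x)) \<in> L2" by (intro L2_cmult L2_diff v r t)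
      then show ?thesis unfolding p_def using L2_diff[OF _ vt] by simp
    qed
    define y where "y = backstep K p"
    have yL: "y \<in> L2" unfolding y_def by (rule backstep_L2[OF K pL])
    have yb: "norm2 y \<le> C * n r" unfolding y_def n_def p_def[symmetric] by (rule C[OF pL])
    \<comment> \<open>The factors \<open>1\<close> put sums into the form expected by
      \<open>backstep_linear\<close> and \<open>inner2_linear\<close>.\<close>
    define d where "d = (\<lambda>x. 1 * y x + 1 * z x)"
    have dL: "d \<in> L2" unfolding d_def by (rule L2_lincomb[OF yL zL])
    have "AE x in unitM. backstep K (v r) x = 1 * w x + (r - t) * d x"
    proof (rule AE_I2)
      fix x assume "x \<in> space unitM"
      then have x: "x \<in> {0..1}" by simp
      have "v r = (\<lambda>x. 1 * v t x + (r - t) * (1 * p x + 1 * vt x))"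
        using r by (auto simp: p_def)
      then have "backstep K (v r) x = backstep K (\<lambda>x. 1 * v t x + (r - t) * (1 * p x + 1 * vt x)) x" by (rule arg_cong)
      also have "\<dots> = 1 * w x + (r - t) * backstep K (\<lambda>x. 1 * p x + 1 * vt x) x"
        unfolding w_def by (rule backstep_linear[OF K L2_integrable[OF v[OF t]] L2_integrable[OF L2_lincomb[OF pL vt]] x])
      also have "backstep K (\<lambda>x. 1 * p x + 1 * vt x) x = d x"
        unfolding d_def y_def z_def by (rule backstep_linear[OF K L2_integrable[OF pL] L2_integrable[OF vt] x])
      finally show "backstep K (v r) x = 1 * w x + (r - t) * d x" .
    qed
    then have "norm2 (backstep K (v r)) = norm2 (\<lambda>x. 1 * w x + (r - t) * d x)"
      by (intro norm2_cong_AE backstep_L2[OF K v[OF r(1)]] L2_lincomb wL dL)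
    then have eq: "(norm2 (backstep K (v r)))\<^sup>2 = inner2 w w + 2 * (r - t) * inner2 w d + (r - t)\<^sup>2 * inner2 d d"
      unfolding norm2_square using inner2_lincomb_self[OF wL dL, of 1 "r - t"] by (simp add: norm2_square[symmetric])
    have "((norm2 (backstep K (v r)))\<^sup>2 - (norm2 w)\<^sup>2) / (r - t) = 2 * inner2 w d + (r - t) * inner2 d d"
      unfolding eq norm2_square[of w] using r by (simp add: power2_eq_square field_simps)
    moreover have "inner2 w d = inner2 w y + inner2 w z"
      using inner2_linear[OF yL zL wL, of 1 1] by (simp add: d_def inner2_commute[of w])
    ultimately have "\<bar>((norm2 (backstep K (v r)))\<^sup>2 - (norm2 w)\<^sup>2) / (r - t) - 2 * inner2 w z\<bar> = \<bar>2 * inner2 w y + (r - t) * inner2 d d\<bar>"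
      by simp
    also have "\<dots> \<le> 2 * \<bar>inner2 w y\<bar> + \<bar>r - t\<bar> * (norm2 d)\<^sup>2"
      by (rule order_trans[OF abs_triangle_ineq]) (simp add: abs_mult norm2_square inner2_self_nonneg)
    also have "\<dots> \<le> 2 * (norm2 w * (C * n r)) + \<bar>r - t\<bar> * (C * n r + norm2 z)\<^sup>2"
    proof (intro add_mono mult_left_mono power_mono)
      show "\<bar>inner2 w y\<bar> \<le> norm2 w * (C * n r)"
        using Cauchy_Schwarz_L2[OF wL yL] mult_left_mono[OF yb norm2_nonneg[of w]] by linarith
      show "norm2 d \<le> C * n r + norm2 z" using norm2_triangle[OF yL zL] yb by (simp add: d_def)
    qed (auto simp: norm2_nonneg)
    finally show ?thesis .
  qed
  have "((\<lambda>r. ((norm2 (backstep K (v r)))\<^sup>2 - (norm2 w)\<^sup>2) / (r - t) - 2 * inner2 w z) \<longlongrightarrow> 0) (at t within I)"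
  proof (rule Lim_null_comparison)
    show "eventually (\<lambda>r. norm (((norm2 (backstep K (v r)))\<^sup>2 - (norm2 w)\<^sup>2) / (r - t) - 2 * inner2 w z)
      \<le> 2 * (norm2 w * (C * n r)) + \<bar>r - t\<bar> * (C * n r + norm2 z)\<^sup>2) (at t within I)"
      using est by (auto simp: eventually_at_filter)
    have "((\<lambda>r. 2 * (norm2 w * (C * n r)) + \<bar>r - t\<bar> * (C * n r + norm2 z)\<^sup>2) \<longlongrightarrow>
        2 * (norm2 w * (C * 0)) + \<bar>t - t\<bar> * (C * 0 + norm2 z)\<^sup>2) (at t within I)"
      by (intro tendsto_intros lim[folded n_def])
    then show "((\<lambda>r. 2 * (norm2 w * (C * n r)) + \<bar>r - t\<bar> * (C * n r + norm2 z)\<^sup>2) \<longlongrightarrow> 0) (at t within I)" by simp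
  qed
  then show ?thesis
    unfolding has_field_derivative_iff w_def z_def by (simp add: LIM_zero_iff)
qed

section \<open>The gain constant\<close>

lemma sinh_ge_cubic: "0 \<le> x \<Longrightarrow> x + x ^ 3 / 6 \<le> sinh x" for x :: real
proof -
  assume x: "0 \<le> x"
  have "sinh 0 - (0 + 0 ^ 3 / 6) \<le> sinh x - (x + x ^ 3 / 6)"
  proof (rule DERIV_nonneg_imp_nondecreasing[OF x])
    fix t :: real assume "0 \<le> t"
    have "((\<lambda>x. sinh x - (x + x ^ 3 / 6)) has_real_derivative cosh t - (1 + t\<^sup>2 / 2)) (at t)"
      by (auto intro!: derivative_eq_intros simp: power2_eq_square)
    then show "\<exists>y. ((\<lambda>x. sinh x - (x + x ^ 3 / 6)) has_real_derivative y) (at t) \<and> 0 \<le> y"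
      using cosh_ge_quadratic[OF \<open>0 \<le> t\<close>] by (intro exI[of _ "cosh t - (1 + t\<^sup>2 / 2)"]) auto
  qed
  then show ?thesis by simp
qed

lemma exp_ge_cubic:
  fixes x :: real
  assumes "0 \<le> x"
  shows "1 + x + x\<^sup>2 / 2 + x ^ 3 / 6 \<le> exp x"
proof -
  have "sinh x + cosh x = exp x" by (rule sinh_plus_cosh)
  then show ?thesis using sinh_ge_cubic[OF assms] cosh_ge_quadratic[OF assms] by linarith
qed

text \<open>The two factors bound the transform and its inverse. For \<open>M \<le> 1\<close> compare with
  \<open>M e\<^sup>M (1 + 2M\<^sup>2/3)\<^sup>1\<^sup>/\<^sup>2\<close>, for \<open>M \<ge> 1\<close> with the exponential growth of the right-hand side.\<close>

lemma gain_product: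
  assumes M: "0 < M"
  defines "\<kappa> \<equiv> M / 4 * exp (sqrt M + M / 3)"
  shows "(1 + \<kappa>)\<^sup>2 \<le> 1 + sqrt (M / 4 * (exp (4 * M) - 1))"
proof -
  have k0: "0 \<le> \<kappa>" using M by (simp add: \<kappa>_def)
  have e: "exp 1 < (272/100 :: real)" by (rule e_less_272)
  \<comment> \<open>The tangent of the square root at \<open>M = 1 / (4 * a\<^sup>2)\<close>;
    \<open>a = 1/2\<close> is used for \<open>M <= 1\<close> and \<open>a = 2/5\<close>
    beyond.\<close>
  have AG: "sqrt M \<le> a * M + 1 / (4 * a)" if "0 < a" for a
  proof -
    have "sqrt M = 2 * sqrt (a * M) * sqrt (1 / (4 * a))" using that M by (simp add: real_sqrt_mult real_sqrt_divide)
    also have "\<dots> \<le> (sqrt (a * M))\<^sup>2 + (sqrt (1 / (4 * a)))\<^sup>2" by (rule sum_squares_bound)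
    finally show ?thesis using that M by simp
  qed
  have "2 * \<kappa> + \<kappa>\<^sup>2 \<le> sqrt (M / 4 * (exp (4 * M) - 1))"
  proof (cases "M \<le> 1")
    case True
    define y where "y = exp (M * 2 / 3)"
    have e12: "exp (1 / 2) \<le> (165/100 :: real)"
    proof (rule power2_le_imp_le)
      have "(exp (1 / 2))\<^sup>2 = (exp 1 :: real)" by (simp add: power2_eq_square flip: exp_add)
      then show "(exp (1 / 2))\<^sup>2 \<le> (165/100 :: real)\<^sup>2" using e by (simp add: power2_eq_square)
    qed simp
    have y: "y \<le> 195/100"
    proof -
      have "(exp (2 / 3) :: real) \<le> 195/100"
      proof (rule power_le_imp_le_base)
        have "(exp (2 / 3)) ^ Suc 2 = (exp 1 :: real)\<^sup>2" by (simp add: power2_eq_square power3_eq_cube flip: exp_add)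
        also have "\<dots> \<le> (272/100)\<^sup>2" using e by (intro power_mono) auto
        also have "\<dots> \<le> (195/100) ^ Suc 2" by (simp add: power2_eq_square power3_eq_cube)
        finally show "(exp (2 / 3) :: real) ^ Suc 2 \<le> (195/100) ^ Suc 2" .
      qed simp
      moreover have "y \<le> exp (2 / 3)" using True by (simp add: y_def)
      ultimately show ?thesis by linarith
    qed
    have k: "\<kappa> \<le> M * (33/80 * exp (M * 5 / 6))"
    proof -
      have "exp (sqrt M + M / 3) \<le> exp (1 / 2 + M * 5 / 6)" using AG[of "1 / 2"] by simp
      also have "\<dots> = exp (1 / 2) * exp (M * 5 / 6)" by (rule exp_add)
      also have "\<dots> \<le> 165/100 * exp (M * 5 / 6)" by (intro mult_right_mono e12) simp
      finally show ?thesis using M by (simp add: \<kappa>_def)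
    qed
    have k1: "\<kappa> \<le> M * (33/80 * exp M)"
    proof (rule order_trans[OF k])
      show "M * (33/80 * exp (M * 5 / 6)) \<le> M * (33/80 * exp M)"
        using M by (intro mult_left_mono) auto
    qed
    have "\<kappa>\<^sup>2 \<le> (M * (33/80 * exp (M * 5 / 6)))\<^sup>2" by (rule power_mono[OF k k0])
    also have "\<dots> = M * exp M * (M * ((33/80)\<^sup>2 * y))"
    proof -
      have "exp (M * 5 / 6) * exp (M * 5 / 6) = exp M * y" by (simp add: y_def flip: exp_add)
      then show ?thesis by (simp add: power2_eq_square)
    qed
    also have "\<dots> \<le> M * exp M * (M * (34/100))"
    proof (intro mult_left_mono)
      have "(33/80)\<^sup>2 * y \<le> (33/80)\<^sup>2 * (195/100)" by (intro mult_left_mono y) simp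
      then show "(33/80)\<^sup>2 * y \<le> 34/100" by (simp add: power2_eq_square)
    qed (use M in auto)
    finally have "2 * \<kappa> + \<kappa>\<^sup>2 \<le> M * exp M * (33/40 + 34/100 * M)" using k1 by (simp add: algebra_simps)
    also have "\<dots> \<le> sqrt (M / 4 * (exp (4 * M) - 1))"
    proof (rule real_le_rsqrt)
      have sq: "(33/40 + 34/100 * M)\<^sup>2 \<le> 1 + 2 / 3 * M\<^sup>2"
      proof -
        have "0 \<le> (M - 1/2)\<^sup>2" by simp
        then have "M \<le> M\<^sup>2 + 1 / 4" by (simp add: power2_eq_square algebra_simps)
        moreover have "(33/40 + 34/100 * M)\<^sup>2 = 1089/1600 + 561/1000 * M + 289/2500 * M\<^sup>2"
          by (simp add: power2_eq_square algebra_simps)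
        ultimately show ?thesis using True by linarith
      qed
      \<comment> \<open>Since \<open>exp (4 * M) - 1 = 2 * exp (2 * M) * sinh (2 * M)\<close>, the
        two-term Taylor bound of \<open>sinh\<close> suffices.\<close>
      have low: "M\<^sup>2 * (exp M)\<^sup>2 * (1 + 2 / 3 * M\<^sup>2) \<le> M / 4 * (exp (4 * M) - 1)"
      proof -
        have "2 * M + (2 * M) ^ 3 / 6 \<le> sinh (2 * M)" by (rule sinh_ge_cubic) (use M in simp)
        then have h1: "(M / 2 * (exp M)\<^sup>2) * (2 * M + (2 * M) ^ 3 / 6) \<le> (M / 2 * (exp M)\<^sup>2) * sinh (2 * M)"
          using M by (intro mult_left_mono) auto
        have h2: "(M / 2 * (exp M)\<^sup>2) * (2 * M + (2 * M) ^ 3 / 6) = M\<^sup>2 * (exp M)\<^sup>2 * (1 + 2 / 3 * M\<^sup>2)"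
          by (simp add: power2_eq_square power3_eq_cube algebra_simps)
        have h3: "(M / 2 * (exp M)\<^sup>2) * sinh (2 * M) = M / 4 * (exp (4 * M) - 1)"
        proof -
          have "(exp M)\<^sup>2 = exp (2 * M)" by (simp add: power2_eq_square flip: exp_add)
          moreover have "exp (2 * M) * exp (2 * M) = exp (4 * M)" "exp (2 * M) * exp (- (2 * M)) = 1"
            by (simp_all flip: exp_add)
          ultimately show ?thesis by (simp add: sinh_def algebra_simps)
        qed
        show ?thesis by (rule h1[unfolded h2 h3])
      qed
      have "(M * exp M * (33/40 + 34/100 * M))\<^sup>2 = M\<^sup>2 * (exp M)\<^sup>2 * (33/40 + 34/100 * M)\<^sup>2"
        by (simp only: power_mult_distrib)
      also have "\<dots> \<le> M\<^sup>2 * (exp M)\<^sup>2 * (1 + 2 / 3 * M\<^sup>2)" by (rule mult_left_mono[OF sq]) simp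
      also note low
      finally show "(M * exp M * (33/40 + 34/100 * M))\<^sup>2 \<le> M / 4 * (exp (4 * M) - 1)" .
    qed
    finally show ?thesis .
  next
    case False
    then have M1: "1 \<le> M" by simp
    \<comment> \<open>\<open>11 / 15\<close> is \<open>2 / 5 + 1 / 3\<close>, with
      \<open>2 / 5\<close> from \<open>AG\<close>; \<open>8 / 15\<close> is chosen so that
      \<open>E\<^sup>2 * F = exp (2 * M)\<close>.\<close>
    define E where "E = exp (11 / 15 * M)"
    define F where "F = exp (8 / 15 * M)"
    have E0: "0 < E" and F0: "0 < F" by (simp_all add: E_def F_def)
    have e58: "exp (5 / 8) \<le> (187/100 :: real)"
    proof (rule power_le_imp_le_base)
      have "(exp (5 / 8)) ^ Suc 7 = (exp 1 :: real) ^ 5" by (simp flip: exp_of_nat_mult)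
      also have "\<dots> \<le> (272/100) ^ 5" using e by (intro power_mono) auto
      also have "\<dots> \<le> (187/100) ^ Suc 7" by (simp add: eval_nat_numeral)
      finally show "(exp (5 / 8) :: real) ^ Suc 7 \<le> (187/100) ^ Suc 7" .
    qed simp
    have k: "\<kappa> \<le> 187/400 * (M * E)"
    proof -
      have "exp (sqrt M + M / 3) \<le> exp (5 / 8 + 11 / 15 * M)" using AG[of "2 / 5"] by simp
      also have "\<dots> = exp (5 / 8) * E" by (simp add: exp_add E_def)
      also have "\<dots> \<le> 187/100 * E" using E0 by (intro mult_right_mono e58) simp
      finally show ?thesis using M by (simp add: \<kappa>_def)
    qed
    have ME: "M * E \<le> 5728/10000 * E\<^sup>2"
    proof -
      define y where "y = 11 / 15 * M"
      have y0: "0 \<le> y" using M by (simp add: y_def)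
      \<comment> \<open>A completed square bounds \<open>y\<close> by a multiple of the quadratic
        Taylor polynomial of \<open>exp y\<close>; the constant \<open>5728/10000\<close> lies just
        above \<open>42/100 * 15/11\<close>.\<close>
      have "0 \<le> (y - 29/21)\<^sup>2" by simp
      then have "y \<le> 42/100 * (1 + y + y\<^sup>2 / 2)" by (simp add: power2_eq_square algebra_simps)
      also have "\<dots> \<le> 42/100 * E"
      proof (rule mult_left_mono)
        have "0 \<le> y ^ 3 / 6" using y0 by simp
        then show "1 + y + y\<^sup>2 / 2 \<le> E"
          using exp_ge_cubic[OF y0] unfolding E_def y_def[symmetric] by linarith
      qed simp
      finally have "M \<le> 5728/10000 * E" using E0 by (simp add: y_def)
      then have "M * E \<le> (5728/10000 * E) * E" using E0 by (intro mult_right_mono) auto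
      then show ?thesis by (simp add: power2_eq_square)
    qed
    have "\<kappa>\<^sup>2 \<le> (187/400 * (M * E))\<^sup>2" by (rule power_mono[OF k k0])
    then have "\<kappa>\<^sup>2 \<le> (187/400)\<^sup>2 * (M\<^sup>2 * E\<^sup>2)" by (simp only: power_mult_distrib)
    moreover have "2 * \<kappa> \<le> 187/200 * (5728/10000 * E\<^sup>2)" using k ME by linarith
    ultimately have "2 * \<kappa> + \<kappa>\<^sup>2 \<le> 187/200 * (5728/10000 * E\<^sup>2) + (187/400)\<^sup>2 * (M\<^sup>2 * E\<^sup>2)"
      by (intro add_mono)
    also have "\<dots> = E\<^sup>2 * (187/200 * (5728/10000) + (187/400)\<^sup>2 * M\<^sup>2)" by (simp add: algebra_simps)
    \<comment> \<open>\<open>M / (1 + M)\<close> is a rational lower bound for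
      \<open>sqrt M / 2\<close>, the prefactor under the root on the right; \<open>988/1000\<close>
      leaves room for the \<open>- 1\<close> next to \<open>exp (4 * M)\<close>.\<close>
    also have "\<dots> \<le> E\<^sup>2 * (988/1000 * M / (1 + M) * F)"
    proof (rule mult_left_mono)
      define z where "z = 8 / 15 * M"
      have z0: "0 \<le> z" using M by (simp add: z_def)
      have F: "1 + z + z\<^sup>2 / 2 + z ^ 3 / 6 \<le> F" unfolding F_def z_def[symmetric] by (rule exp_ge_cubic[OF z0])
      have "(187/200 * (5728/10000) + (187/400)\<^sup>2 * M\<^sup>2) * (1 + M) \<le> (54/100 + 22/100 * M\<^sup>2) * (1 + M)"
      proof (intro mult_right_mono add_mono)
        show "187/200 * (5728/10000) \<le> (54/100 :: real)" by simp
        show "(187/400)\<^sup>2 \<le> (22/100 :: real)" by (simp add: power2_eq_square)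
      qed (use M in auto)
      also have "\<dots> \<le> 988/1000 * M * (1 + z + z\<^sup>2 / 2 + z ^ 3 / 6)"
      proof -
        have "988/1000 * M * (1 + z + z\<^sup>2 / 2 + z ^ 3 / 6) - (54/100 + 22/100 * M\<^sup>2) * (1 + M)
          = - 54/100 + 448/1000 * M + M\<^sup>2 * (7904/15000 - 22/100 + (31616/225000 - 22/100) * M + 988/1000 * 512 / 20250 * M\<^sup>2)"
          by (simp add: z_def power2_eq_square power3_eq_cube field_simps)
        moreover have "2/10 \<le> 7904/15000 - 22/100 + (31616/225000 - 22/100) * M + 988/1000 * 512 / 20250 * M\<^sup>2"
        proof -
          have "0 \<le> (M - 16/10)\<^sup>2" by simp
          then have "0 \<le> M\<^sup>2 - 32/10 * M + 256/100" by (simp add: power2_eq_square algebra_simps)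
          then show ?thesis using M by (simp add: field_simps)
        qed
        then have "M\<^sup>2 * (2/10) \<le> M\<^sup>2 * (7904/15000 - 22/100 + (31616/225000 - 22/100) * M + 988/1000 * 512 / 20250 * M\<^sup>2)"
          by (intro mult_left_mono) auto
        moreover have "1 \<le> M\<^sup>2" using M1 by (simp add: one_le_power)
        ultimately show ?thesis using M1 by linarith
      qed
      also have "\<dots> \<le> 988/1000 * M * F" using F M by (intro mult_left_mono) auto
      finally have "187/200 * (5728/10000) + (187/400)\<^sup>2 * M\<^sup>2 \<le> (988/1000 * M * F) / (1 + M)"
        using M by (subst pos_le_divide_eq) auto
      then show "187/200 * (5728/10000) + (187/400)\<^sup>2 * M\<^sup>2 \<le> 988/1000 * M / (1 + M) * F"
        by (simp only: times_divide_eq_left)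
    qed simp
    also have "\<dots> \<le> sqrt (M / 4 * (exp (4 * M) - 1))"
    proof (rule real_le_rsqrt)
      have EF: "(E\<^sup>2 * F)\<^sup>2 = exp (4 * M)"
        by (simp add: E_def F_def power2_eq_square flip: exp_add)
      have "(M / (1 + M))\<^sup>2 \<le> M / 4"
      proof -
        have "0 \<le> (1 - M)\<^sup>2" by simp
        then have "4 * M \<le> (1 + M)\<^sup>2" by (simp add: power2_eq_square algebra_simps)
        then have "M * (4 * M) \<le> M * (1 + M)\<^sup>2" using M by (intro mult_left_mono) auto
        then have "M\<^sup>2 \<le> M / 4 * (1 + M)\<^sup>2" by (simp add: power2_eq_square)
        then show ?thesis unfolding power_divide using M by (subst pos_divide_le_eq) auto
      qed
      then have "(988/1000)\<^sup>2 * (M / (1 + M))\<^sup>2 * exp (4 * M) \<le> (988/1000)\<^sup>2 * (M / 4) * exp (4 * M)"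
        by (intro mult_right_mono mult_left_mono) auto
      also have "\<dots> = M / 4 * ((988/1000)\<^sup>2 * exp (4 * M))" by simp
      also have "\<dots> \<le> M / 4 * (exp (4 * M) - 1)"
      proof (rule mult_left_mono)
        have "1 \<le> M\<^sup>2" "1 \<le> M ^ 3" using M1 by (simp_all add: one_le_power)
        then have "8/3 \<le> exp M" using exp_ge_cubic[of M] M1 by linarith
        then have "(8/3) ^ 4 \<le> (exp M) ^ 4" by (rule power_mono) simp
        moreover have "(exp M) ^ 4 = exp (4 * M)" by (simp flip: exp_of_nat_mult)
        ultimately have "42 \<le> exp (4 * M)" by (simp add: eval_nat_numeral)
        then show "(988/1000)\<^sup>2 * exp (4 * M) \<le> exp (4 * M) - 1" by (simp add: power2_eq_square)
      qed (use M in simp)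
      moreover have "E\<^sup>2 * (988/1000 * M / (1 + M) * F) = 988/1000 * (M / (1 + M)) * (E\<^sup>2 * F)" by simp
      ultimately show "(E\<^sup>2 * (988/1000 * M / (1 + M) * F))\<^sup>2 \<le> M / 4 * (exp (4 * M) - 1)"
        by (simp only: power_mult_distrib[of _ "E\<^sup>2 * F"] power_mult_distrib[of "988/1000"] EF)
    qed
    finally show ?thesis .
  qed
  then show ?thesis by (simp add: power2_eq_square algebra_simps)
qed

section \<open>Decay between events and minimal dwell time\<close>

text \<open>The solution \<open>v\<close> keeps its gain on all of \<open>{T..}\<close>, so decay
  and dwell time can be discussed before it is known when, or whether, the next event
  occurs.\<close>

locale event_interval = backstepping \<epsilon> c q "lam T" K Kx Ky Kxx Kxy Kyx Kyy
  for \<epsilon> c :: real and q :: ereal and lam :: "real \<Rightarrow> real \<Rightarrow> real" and T :: real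
    and K Kx Ky Kxx Kxy Kyx Kyy :: "real \<times> real \<Rightarrow> real" +
  fixes M s \<phi> \<mu> \<mu>1 R \<eta> \<theta> :: real and act :: actuation
    and v :: "real \<Rightarrow> real \<Rightarrow> real" and m :: "real \<Rightarrow> real"
  assumes M_bound: "\<And>y. y \<in> {0..1} \<Longrightarrow> \<bar>B y\<bar> \<le> M"
    and s_bound: "0 \<le> s" "q \<noteq> \<infinity> \<Longrightarrow> - s \<le> real_of_ereal q"
    and T: "0 \<le> T"
    and lam_cont: "\<And>t. 0 \<le> t \<Longrightarrow> continuous_on {0..1} (lam t)"
    and lam_lipschitz: "\<And>x t. x \<in> {0..1} \<Longrightarrow> T \<le> t \<Longrightarrow> \<bar>lam t x - lam T x\<bar> \<le> \<phi> * (t - T)"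
    and \<phi>: "0 < \<phi>"
    and sol: "fixed_gain_solution act \<epsilon> q lam K Kx T v"
    and state: "trigger_state lam \<mu> R \<eta> K T v m"
    and coercive: "coercive act q \<mu>1" and \<mu>: "\<mu> = c + \<epsilon> * \<mu>1" "0 < \<mu>"
    and R: "0 < R" "R < 1" and \<eta>: "2 * \<mu> * (1 - R) \<le> \<eta>" and \<theta>: "0 < \<theta>"
begin

definition \<kappa> :: real where "\<kappa> = 1 + M / 4 * exp (s + M / 3)"

abbreviation trig :: "real \<Rightarrow> real" where "trig \<equiv> trigger lam \<mu> R K T v"

definition N :: "real \<Rightarrow> real" where "N t = norm2 (backstep K (v t))"

lemma \<kappa>_ge_1: "1 \<le> \<kappa>"
  using M_bound[of 0] by (simp add: \<kappa>_def)

lemma K_norm: "h \<in> L2 \<Longrightarrow> norm2 (backstep K h) \<le> \<kappa> * norm2 h"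
  unfolding \<kappa>_def by (rule backstep_norm_le) (use M_bound s_bound in auto)

lemma K_inverse_norm: "H2 u u' u'' \<Longrightarrow> left_bc q (u 0) (u' 0) \<Longrightarrow> norm2 u \<le> \<kappa> * norm2 (backstep K u)"
  unfolding \<kappa>_def by (rule inverse_norm_le) (use M_bound s_bound in auto)

lemma v_L2: "T \<le> t \<Longrightarrow> v t \<in> L2"
  using sol by (simp add: fixed_gain_solution_def C0_L2_def)

lemma N_nonneg: "0 \<le> N t"
  by (simp add: N_def norm2_nonneg)

lemma perturbation_L2: "T \<le> t \<Longrightarrow> (\<lambda>x. (lam t x - lam T x) * v t x) \<in> L2"
  using T by (intro L2_continuous_mult continuous_on_diff lam_cont v_L2) auto

text \<open>The feedback law is exactly the homogeneous right condition for \<open>w\<close>, so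
  \<open>coercive\<close> applies to \<open>w\<close> and yields the rate \<open>\<mu>\<close>. Of
  it the fraction \<open>R\<close> is reserved for the perturbation and moved into
  \<open>trig\<close>.\<close>

lemma energy_derivative:
  assumes t: "T < t"
  shows "\<exists>d. ((\<lambda>r. (N r)\<^sup>2) has_real_derivative d) (at t) \<and> d \<le> - 2 * \<mu> * (1 - R) * (N t)\<^sup>2 + 2 * trig t"
    and "norm2 (v t) \<le> \<kappa> * N t"
proof -
  obtain vt where C1: "C1_L2 {T<..} v vt"
    and pl: "\<forall>t\<in>{T<..}. \<exists>ux uxx. H2 (v t) ux uxx \<and>
        (AE x in unitM. vt t x = \<epsilon> * uxx x + lam t x * v t x) \<and> left_bc q (v t 0) (ux 0)"
    using sol unfolding fixed_gain_solution_def plant_on_def by blast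
  obtain u' u'' where u: "H2 (v t) u' u''" and ae: "AE x in unitM. vt t x = \<epsilon> * u'' x + lam t x * v t x"
    and lbc: "left_bc q (v t 0) (u' 0)"
    using pl t by blast
  have fb: "feedback_bc act K Kx (v t)" using sol t by (simp add: fixed_gain_solution_def)
  show "norm2 (v t) \<le> \<kappa> * N t" unfolding N_def by (rule K_inverse_norm[OF u lbc])
  note uD = H2D[OF u]
  define w where "w = backstep K (v t)"
  define w' where "w' = (\<lambda>x. u' x - K (x, x) * v t x - (LINT y|lebesgue_on {0..x}. Kx (x, y) * v t y))"
  define w'' where "w'' = backstep K (\<lambda>y. u'' y + B y * v t y)"
  define f where "f = (\<lambda>x. (lam t x - lam T x) * v t x)"
  note BI = backstep_intertwines[OF u lbc, folded w_def w'_def w''_def]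
  have uL: "v t \<in> L2" by (rule continuous_L2[OF uD(2)])
  have gL: "(\<lambda>y. u'' y + B y * v t y) \<in> L2" by (intro L2_add uD(3) L2_continuous_mult B_cont uL)
  have fL: "f \<in> L2" unfolding f_def by (rule perturbation_L2) (use t in simp)
  have wL: "w \<in> L2" and w''L: "w'' \<in> L2" and KfL: "backstep K f \<in> L2"
    unfolding w_def w''_def by (rule backstep_L2[OF KD(3)], fact)+
  have "right_bc act (w 1) (w' 1)"
  proof -
    obtain h' h'' where h: "H2 (v t) h' h''" and hb: "case act of
        Dirichlet \<Rightarrow> v t 1 = (LINT y|unitM. K (1, y) * v t y)
      | Neumann \<Rightarrow> h' 1 = K (1, 1) * v t 1 + (LINT y|unitM. Kx (1, y) * v t y)"
      using fb unfolding feedback_bc_def by blast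
    have "h' 1 = u' 1"
      using vector_derivative_unique_within_closed_interval[of 0 1 1 "v t" "h' 1" "u' 1"] H2D(4)[OF h, of 1] uD(4)[of 1]
      by (simp add: has_real_derivative_iff_has_vector_derivative)
    then show ?thesis using hb
      by (auto simp: right_bc_def w_def w'_def backstep_def split: actuation.splits)
  qed
  moreover have "left_bc q (w 0) (w' 0)" using lbc BI(2,3) by (auto simp: w'_def)
  ultimately have co: "inner2 w w'' \<le> - \<mu>1 * inner2 w w"
    using coercive BI(1) unfolding coercive_def inner2_def by (simp only: power2_eq_square)
  have vtL: "vt t \<in> L2" using C1 t by (simp add: C1_L2_def C0_L2_def)
  \<comment> \<open>Splits \<open>lam t\<close> into \<open>lam T\<close> and the perturbation, and
    writes \<open>lam T x\<close> as \<open>\<epsilon> * B x - c\<close>, the form in which the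
    transform intertwines.\<close>
  have eq: "(\<lambda>x. \<epsilon> * u'' x + lam t x * v t x) = (\<lambda>x. 1 * (\<epsilon> * (u'' x + B x * v t x) + (- c) * v t x) + 1 * f x)"
    using eps by (auto simp: B_def f_def field_simps)
  have gcL: "(\<lambda>x. \<epsilon> * (u'' x + B x * v t x) + (- c) * v t x) \<in> L2" by (rule L2_lincomb[OF gL uL])
  have rL: "(\<lambda>x. \<epsilon> * u'' x + lam t x * v t x) \<in> L2"
    unfolding eq by (rule L2_lincomb[OF gcL fL])
  have zL: "(\<lambda>x. \<epsilon> * w'' x + (- c) * w x) \<in> L2" by (rule L2_lincomb[OF w''L wL])
  have zL': "(\<lambda>x. 1 * (\<epsilon> * w'' x + (- c) * w x) + 1 * backstep K f x) \<in> L2" by (rule L2_lincomb[OF zL KfL])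
  have "AE x in unitM. backstep K (vt t) x = 1 * (\<epsilon> * w'' x + (- c) * w x) + 1 * backstep K f x"
  proof -
    have "AE x in unitM. backstep K (vt t) x = backstep K (\<lambda>x. \<epsilon> * u'' x + lam t x * v t x) x"
      by (rule backstep_cong_AE[OF KD(3) L2_integrable[OF vtL] L2_integrable[OF rL] ae])
    moreover have "backstep K (\<lambda>x. \<epsilon> * u'' x + lam t x * v t x) x = 1 * (\<epsilon> * w'' x + (- c) * w x) + 1 * backstep K f x"
      if x: "x \<in> {0..1}" for x
      unfolding eq backstep_linear[OF KD(3) L2_integrable[OF gcL] L2_integrable[OF fL] x]
        backstep_linear[OF KD(3) L2_integrable[OF gL] L2_integrable[OF uL] x] w''_def w_def ..
    then have "AE x in unitM. backstep K (\<lambda>x. \<epsilon> * u'' x + lam t x * v t x) x = 1 * (\<epsilon> * w'' x + (- c) * w x) + 1 * backstep K f x"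
      by (intro AE_I2) simp
    ultimately show ?thesis by eventually_elim simp
  qed
  then have "inner2 (backstep K (vt t)) w = inner2 (\<lambda>x. 1 * (\<epsilon> * w'' x + (- c) * w x) + 1 * backstep K f x) w"
    by (intro inner2_cong_AE backstep_L2[OF KD(3) vtL] zL' wL) auto
  also have "\<dots> = \<epsilon> * inner2 w'' w - c * inner2 w w + inner2 (backstep K f) w"
    unfolding inner2_linear[OF zL KfL wL] inner2_linear[OF w''L wL wL] by simp
  finally have "inner2 w (backstep K (vt t)) = \<epsilon> * inner2 w w'' - c * inner2 w w + inner2 w (backstep K f)"
    by (simp only: inner2_commute)
  also have "\<dots> \<le> \<epsilon> * (- \<mu>1 * inner2 w w) - c * inner2 w w + inner2 w (backstep K f)"
    using mult_left_mono[OF co, of \<epsilon>] eps by simp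
  also have "\<dots> = - \<mu> * (N t)\<^sup>2 + inner2 w (backstep K f)"
    by (simp add: \<mu>(1) N_def norm2_square w_def algebra_simps)
  also have "\<dots> = - \<mu> * (1 - R) * (N t)\<^sup>2 + trig t"
    by (simp add: trigger_def N_def w_def f_def algebra_simps)
  finally have le: "2 * inner2 w (backstep K (vt t)) \<le> - 2 * \<mu> * (1 - R) * (N t)\<^sup>2 + 2 * trig t" by simp
  have "((\<lambda>r. norm2 (\<lambda>x. (v r x - v t x) / (r - t) - vt t x)) \<longlongrightarrow> 0) (at t within {T<..})"
    using C1 t by (simp add: C1_L2_def)
  from backstep_norm2_derivative[OF KD(3) K_norm _ vtL _ this]
  have "((\<lambda>r. (N r)\<^sup>2) has_real_derivative 2 * inner2 w (backstep K (vt t))) (at t within {T<..})"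
    using t v_L2 by (simp add: N_def w_def)
  then have "((\<lambda>r. (N r)\<^sup>2) has_real_derivative 2 * inner2 w (backstep K (vt t))) (at t)"
    using t by (simp add: at_within_open[of t "{T<..}"])
  then show "\<exists>d. ((\<lambda>r. (N r)\<^sup>2) has_real_derivative d) (at t) \<and> d \<le> - 2 * \<mu> * (1 - R) * (N t)\<^sup>2 + 2 * trig t"
    using le by blast
qed

text \<open>The energy inequality is available only after \<open>T\<close>, because the profile at
  \<open>T\<close> may be rough; continuity up to \<open>T\<close> lets monotonicity arguments start
  there.\<close>

lemma N_continuous: "continuous_on {T..} N"
  unfolding continuous_on_def
proof
  fix t assume t: "t \<in> {T..}"
  have lim: "((\<lambda>r. norm2 (\<lambda>x. v r x - v t x)) \<longlongrightarrow> 0) (at t within {T..})"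
    using sol t by (simp add: fixed_gain_solution_def C0_L2_def)
  have "((\<lambda>r. N r - N t) \<longlongrightarrow> 0) (at t within {T..})"
  proof (rule Lim_null_comparison)
    show "((\<lambda>r. \<kappa> * norm2 (\<lambda>x. v r x - v t x)) \<longlongrightarrow> 0) (at t within {T..})"
      using tendsto_mult[OF tendsto_const[of \<kappa>] lim] by simp
    have "norm (N r - N t) \<le> \<kappa> * norm2 (\<lambda>x. v r x - v t x)" if r: "r \<in> {T..}" for r
    proof -
      have L: "v r \<in> L2" "v t \<in> L2" using r t v_L2 by auto
      have "\<bar>N r - N t\<bar> \<le> norm2 (\<lambda>x. backstep K (v r) x - backstep K (v t) x)"
        unfolding N_def by (intro abs_norm2_diff_le backstep_L2[OF KD(3)] L)
      also have "\<dots> = norm2 (backstep K (\<lambda>x. v r x - v t x))"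
      proof (rule norm2_cong_AE)
        show "AE x in unitM. backstep K (v r) x - backstep K (v t) x = backstep K (\<lambda>x. v r x - v t x) x"
          using backstep_linear[OF KD(3) L2_integrable[OF L(1)] L2_integrable[OF L(2)], of _ 1 "-1"]
          by (intro AE_I2) simp
      qed (intro backstep_L2[OF KD(3)] L2_diff L)+
      also have "\<dots> \<le> \<kappa> * norm2 (\<lambda>x. v r x - v t x)" by (rule K_norm[OF L2_diff[OF L]])
      finally show ?thesis by simp
    qed
    then show "eventually (\<lambda>r. norm (N r - N t) \<le> \<kappa> * norm2 (\<lambda>x. v r x - v t x)) (at t within {T..})"
      by (auto simp: eventually_at_filter)
  qed
  then show "(N \<longlongrightarrow> N t) (at t within {T..})" by (simp add: LIM_zero_iff)
qed

lemma m_T: "m T = 0"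
  using state by (simp add: trigger_state_def)

lemma m_deriv_within: "T \<le> t \<Longrightarrow> (m has_real_derivative (- \<eta> * m t - trig t)) (at t within {T..})"
  using state by (simp add: trigger_state_def)

lemma m_deriv: "T < t \<Longrightarrow> (m has_real_derivative (- \<eta> * m t - trig t)) (at t)"
  using m_deriv_within[of t] at_within_interior[of t "{T..}"] by (simp add: interior_real_atLeast)

lemma m_continuous: "continuous_on {T..} m"
  by (rule DERIV_continuous_on[OF m_deriv_within]) simp

text \<open>The integrating factor \<open>exp ((\<eta> + k) * (r - T))\<close> makes the derivative
  a positive multiple of \<open>k * m r - trig r\<close>. It is used with
  \<open>k = 1 / \<theta>\<close> while no event has occurred and with \<open>k = 0\<close> for the
  dwell time.\<close>

lemma m_nonneg:
  assumes t: "T \<le> t" and le: "\<And>r. T < r \<Longrightarrow> r < t \<Longrightarrow> trig r \<le> k * m r"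
  shows "0 \<le> m t"
proof -
  let ?g = "\<lambda>r. exp ((\<eta> + k) * (r - T)) * m r"
  have "?g T \<le> ?g t"
  proof (rule DERIV_nonneg_imp_increasing_open[where f="?g", OF t])
    show "continuous_on {T..t} ?g"
      by (intro continuous_intros continuous_on_subset[OF m_continuous]) auto
    fix r assume r: "T < r" "r < t"
    have "(?g has_real_derivative exp ((\<eta> + k) * (r - T)) * (k * m r - trig r)) (at r)"
      using m_deriv[OF r(1)] by (auto intro!: derivative_eq_intros simp: algebra_simps)
    then show "\<exists>y. (?g has_real_derivative y) (at r) \<and> 0 \<le> y"
      using le[OF r] by (intro exI[of _ "exp ((\<eta> + k) * (r - T)) * (k * m r - trig r)"]) auto
  qed
  then show ?thesis using m_T by (simp add: zero_le_mult_iff)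
qed

text \<open>In the sum of \<open>N\<^sup>2 / 2\<close> and \<open>m\<close> the terms
  \<open>trig\<close> cancel, and the lower bound on \<open>\<eta>\<close> makes \<open>m\<close>,
  being nonnegative, decay at least as fast as the energy.\<close>

lemma decay:
  assumes t: "T \<le> t" and le: "\<And>r. T < r \<Longrightarrow> r < t \<Longrightarrow> trig r \<le> 1 / \<theta> * m r"
  shows "norm2 (v t) \<le> \<kappa>\<^sup>2 * exp (- \<mu> * (1 - R) * (t - T)) * norm2 (v T)"
proof (cases "t = T")
  case True
  have "1 * norm2 (v T) \<le> \<kappa>\<^sup>2 * norm2 (v T)" using \<kappa>_ge_1 by (intro mult_right_mono norm2_nonneg) (simp add: one_le_power)
  then show ?thesis using True by simp
next
  case False
  then have t': "T < t" using t by simp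
  define a where "a = \<mu> * (1 - R)"
  let ?E = "\<lambda>r. - (exp (2 * a * (r - T)) * ((N r)\<^sup>2 / 2 + m r))"
  have mn: "0 \<le> m r" if "T \<le> r" "r \<le> t" for r
    by (rule m_nonneg[OF that(1), where k="1 / \<theta>"]) (use le that in auto)
  have "?E T \<le> ?E t"
  proof (rule DERIV_nonneg_imp_increasing_open[where f="?E", OF t])
    show "continuous_on {T..t} ?E"
      by (intro continuous_intros continuous_on_subset[OF m_continuous] continuous_on_subset[OF N_continuous]) auto
    fix r assume r: "T < r" "r < t"
    obtain d where d: "((\<lambda>r. (N r)\<^sup>2) has_real_derivative d) (at r)" "d \<le> - 2 * \<mu> * (1 - R) * (N r)\<^sup>2 + 2 * trig r"
      using energy_derivative(1)[OF r(1)] by blast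
    have "(?E has_real_derivative - (2 * a * exp (2 * a * (r - T)) * ((N r)\<^sup>2 / 2 + m r) +
        (d / 2 + (- \<eta> * m r - trig r)) * exp (2 * a * (r - T)))) (at r)"
      by (intro DERIV_minus DERIV_mult DERIV_add DERIV_cdivide d(1) m_deriv[OF r(1)])
        (auto intro!: derivative_eq_intros)
    moreover have "0 \<le> - (2 * a * exp (2 * a * (r - T)) * ((N r)\<^sup>2 / 2 + m r) +
        (d / 2 + (- \<eta> * m r - trig r)) * exp (2 * a * (r - T)))"
    proof -
      have "2 * a * m r \<le> \<eta> * m r" using \<eta> mn[of r] r by (intro mult_right_mono) (auto simp: a_def mult_ac)
      moreover have "d / 2 \<le> - a * (N r)\<^sup>2 + trig r" using d(2) by (simp add: a_def algebra_simps)
      ultimately have "2 * a * ((N r)\<^sup>2 / 2 + m r) + (d / 2 + (- \<eta> * m r - trig r)) \<le> 0"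
        by (simp add: algebra_simps)
      then have "exp (2 * a * (r - T)) * (2 * a * ((N r)\<^sup>2 / 2 + m r) + (d / 2 + (- \<eta> * m r - trig r))) \<le> 0"
        by (intro mult_nonneg_nonpos) auto
      then show ?thesis by (simp add: algebra_simps)
    qed
    ultimately show "\<exists>y. (?E has_real_derivative y) (at r) \<and> 0 \<le> y" by blast
  qed
  then have "exp (2 * a * (t - T)) * ((N t)\<^sup>2 / 2 + m t) \<le> (N T)\<^sup>2 / 2" using m_T by simp
  moreover have "exp (2 * a * (t - T)) * ((N t)\<^sup>2 / 2) \<le> exp (2 * a * (t - T)) * ((N t)\<^sup>2 / 2 + m t)"
    using mn[of t] t by (intro mult_left_mono) auto
  ultimately have "exp (2 * a * (t - T)) * (N t)\<^sup>2 \<le> (N T)\<^sup>2" by argo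
  moreover have "exp (2 * a * (t - T)) = (exp (a * (t - T)))\<^sup>2" by (simp add: power2_eq_square algebra_simps flip: exp_add)
  ultimately have "(exp (a * (t - T)) * N t)\<^sup>2 \<le> (N T)\<^sup>2" by (simp add: power_mult_distrib)
  then have "exp (a * (t - T)) * N t \<le> N T" by (rule power2_le_imp_le) (rule N_nonneg)
  then have "exp (- a * (t - T)) * (exp (a * (t - T)) * N t) \<le> exp (- a * (t - T)) * N T" by (intro mult_left_mono) auto
  moreover have "exp (- a * (t - T)) * (exp (a * (t - T)) * N t) = N t" by (simp flip: exp_add mult.assoc)
  ultimately have Nt: "N t \<le> exp (- a * (t - T)) * N T" by (simp only:)
  \<comment> \<open>The inverse bound is used at \<open>t > T\<close>, where the profile is in
    \<open>H2\<close>; at \<open>T\<close> only the forward bound is needed.\<close>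
  have "norm2 (v t) \<le> \<kappa> * N t" by (rule energy_derivative(2)[OF t'])
  also have "\<dots> \<le> \<kappa> * (exp (- a * (t - T)) * N T)" using Nt \<kappa>_ge_1 by (intro mult_left_mono) auto
  also have "\<dots> \<le> \<kappa> * (exp (- a * (t - T)) * (\<kappa> * norm2 (v T)))"
    using K_norm[OF v_L2[OF order_refl]] \<kappa>_ge_1 by (intro mult_left_mono) (auto simp: N_def)
  finally show ?thesis by (simp add: a_def power2_eq_square mult_ac)
qed

text \<open>The perturbation is at most \<open>\<phi> * (r - T)\<close> times the profile. Passing
  from the profile to its transform and back costs \<open>\<kappa>\<close> each, so for short times
  Cauchy-Schwarz makes \<open>trig\<close> nonpositive; then \<open>m\<close> is nonnegative and the
  trigger stays silent.\<close>

lemma dwell: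
  assumes t: "T < t" and short: "\<phi> * \<kappa>\<^sup>2 * (t - T) \<le> \<mu> * R"
  shows "trig t \<le> 1 / \<theta> * m t"
proof -
  have neg: "trig r \<le> 0" if r: "T < r" "r \<le> t" for r
  proof -
    define f where "f = (\<lambda>x. (lam r x - lam T x) * v r x)"
    have fL: "f \<in> L2" unfolding f_def by (rule perturbation_L2) (use r in simp)
    have vL: "v r \<in> L2" by (rule v_L2) (use r in simp)
    have "norm2 f \<le> (\<phi> * (r - T)) * norm2 (v r)"
    proof (rule norm2_mono[OF fL vL])
      show "\<bar>f x\<bar> \<le> \<phi> * (r - T) * \<bar>v r x\<bar>" if "x \<in> {0..1}" for x
        unfolding f_def abs_mult by (intro mult_right_mono lam_lipschitz that) (use r in auto)
    qed (use r \<phi> in simp)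
    also have "\<dots> \<le> (\<phi> * (r - T)) * (\<kappa> * N r)"
      using energy_derivative(2)[OF r(1)] r \<phi> by (intro mult_left_mono) auto
    finally have f: "norm2 f \<le> (\<phi> * (r - T)) * (\<kappa> * N r)" .
    have "inner2 (backstep K (v r)) (backstep K f) \<le> N r * norm2 (backstep K f)"
      using Cauchy_Schwarz_L2[OF backstep_L2[OF KD(3) vL] backstep_L2[OF KD(3) fL]] by (simp add: N_def)
    also have "\<dots> \<le> N r * (\<kappa> * ((\<phi> * (r - T)) * (\<kappa> * N r)))"
      by (intro mult_left_mono[OF _ N_nonneg] order_trans[OF K_norm[OF fL] mult_left_mono[OF f]]) (use \<kappa>_ge_1 in simp)
    also have "\<dots> = (\<phi> * \<kappa>\<^sup>2 * (r - T)) * (N r)\<^sup>2" by (simp add: power2_eq_square)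
    also have "\<dots> \<le> (\<mu> * R) * (N r)\<^sup>2"
    proof (rule mult_right_mono)
      have "\<phi> * \<kappa>\<^sup>2 * (r - T) \<le> \<phi> * \<kappa>\<^sup>2 * (t - T)" using r \<phi> by (intro mult_left_mono) auto
      then show "\<phi> * \<kappa>\<^sup>2 * (r - T) \<le> \<mu> * R" using short by simp
    qed simp
    finally show ?thesis by (simp add: trigger_def f_def N_def)
  qed
  have "0 \<le> m t" by (rule m_nonneg[where k=0]) (use neg t in auto)
  then have "0 \<le> 1 / \<theta> * m t" using \<theta> by simp
  then show ?thesis using neg[of t] t by simp
qed

end

section \<open>Concatenation of the intervals between events\<close>

theorem theorem3p7:
  fixes \<epsilon> c lbar \<phi> \<mu>1 \<mu> G R \<eta> \<theta> :: real
    and q :: ereal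
    and act :: actuation
    and lam :: "real \<Rightarrow> real \<Rightarrow> real"
  assumes "\<epsilon> > 0"
    and "q > - \<infinity>"
    and lam_cont: "continuous_on ({0..} \<times> {0..1}) (\<lambda>(t, x). lam t x)"
    and lam_C1: "\<And>t. t \<ge> 0 \<Longrightarrow> \<exists>l'. continuous_on {0..1} l' \<and>
          (\<forall>x\<in>{0..1}. (lam t has_real_derivative l' x) (at x within {0..1}))"
    and "lbar > 0"
    and lam_bound: "\<And>t x. t \<ge> 0 \<Longrightarrow> x \<in> {0..1} \<Longrightarrow> \<bar>lam t x\<bar> \<le> lbar"
    and "\<phi> > 0"
    and lam_lipschitz: "\<And>x t s. x \<in> {0..1} \<Longrightarrow> t \<ge> 0 \<Longrightarrow> s \<ge> 0 \<Longrightarrow>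
          \<bar>lam t x - lam s x\<bar> \<le> \<phi> * \<bar>t - s\<bar>"
    and "c \<ge> min_c act \<epsilon> q"
    and "smallest_eigenvalue act q \<mu>1"
    and "\<mu> = c + \<epsilon> * \<mu>1"
    and "G = gainG \<epsilon> lbar c"
    and "0 < R" and "R < 1"
    and "\<eta> \<ge> 2 * \<mu> * (1 - R)"
    and "\<theta> > 0"
    and "\<phi> < \<mu>\<^sup>2 * R * (1 - R) / (G\<^sup>2 * ln G)"
  shows "\<exists>\<sigma>>0. \<forall>u0\<in>L2. \<forall>u. closed_loop_solution act \<epsilon> q lam c \<mu> R \<eta> \<theta> u0 u \<longrightarrow>
           (\<forall>t\<ge>0. norm2 (u t) \<le> G * exp (- \<sigma> * t) * norm2 (u 0))"
proof -
  have eps: "0 < \<epsilon>" and q: "q > - \<infinity>" and \<phi>0: "0 < \<phi>" and R: "0 < R" "R < 1" by fact+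
  have minc: "min_c act \<epsilon> q = \<epsilon> * min_c act 1 q" by (cases act) (simp_all add: min_c_def distrib_left)
  have qc: "\<epsilon> * (qbar q)\<^sup>2 \<le> c"
    using \<open>c \<ge> min_c act \<epsilon> q\<close> eps by (cases act) (auto simp: min_c_def)
  have c0: "0 \<le> c" using qc eps by (meson mult_nonneg_nonneg order_trans less_imp_le zero_le_power2)
  define M where "M = (lbar + c) / \<epsilon>"
  have M0: "0 < M" using c0 eps \<open>lbar > 0\<close> by (simp add: M_def)
  define s where "s = sqrt M"
  \<comment> \<open>This justifies \<open>s = sqrt M\<close>: the lower bound on \<open>c\<close>
    dominates the Robin parameter.\<close>
  have qs: "qbar q \<le> s"
  proof -
    have "(qbar q)\<^sup>2 \<le> c / \<epsilon>" using qc eps by (simp add: pos_le_divide_eq mult.commute)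
    also have "\<dots> \<le> M" using eps \<open>lbar > 0\<close> by (simp add: M_def divide_right_mono)
    finally show ?thesis unfolding s_def by (rule real_le_rsqrt)
  qed
  have s: "0 \<le> s" "q \<noteq> \<infinity> \<Longrightarrow> - s \<le> real_of_ereal q"
    using M0 qs qbar_ge[OF q] by (auto simp: s_def)
  define \<kappa>' where "\<kappa>' = 1 + M / 4 * exp (s + M / 3)"
  have \<kappa>'1: "1 \<le> \<kappa>'" using M0 by (simp add: \<kappa>'_def)
  have GM: "G = 1 + sqrt (M / 4 * (exp (4 * M) - 1))"
    by (simp add: \<open>G = gainG \<epsilon> lbar c\<close> gainG_def M_def mult.commute)
  have \<kappa>'G: "\<kappa>'\<^sup>2 \<le> G" unfolding GM \<kappa>'_def s_def by (rule gain_product[OF M0])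
  have G1: "1 < G" using M0 by (simp add: GM)
  have lnG: "0 < ln G" using G1 by simp
  have coercive: "coercive act q \<mu>1"
    by (rule smallest_eigenvalue_coercive[OF \<open>smallest_eigenvalue act q \<mu>1\<close> q])
  have \<mu>0: "0 < \<mu>"
  proof -
    have "- min_c act 1 q \<le> \<mu>1"
      using coercive_le_eigenvalue[OF coercive_min_c[OF q]] \<open>smallest_eigenvalue act q \<mu>1\<close>
      by (simp add: smallest_eigenvalue_def)
    then have "\<epsilon> * (- min_c act 1 q) \<le> \<epsilon> * \<mu>1" using eps by (intro mult_left_mono) auto
    then have "0 \<le> \<mu>" using \<open>c \<ge> min_c act \<epsilon> q\<close> \<open>\<mu> = c + \<epsilon> * \<mu>1\<close> minc by simp
    \<comment> \<open>For \<open>\<mu> = 0\<close> the strict upper bound on \<open>\<phi>\<close>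
      would be \<open>0\<close>.\<close>
    moreover have "\<mu> \<noteq> 0" using \<open>\<phi> < \<mu>\<^sup>2 * R * (1 - R) / (G\<^sup>2 * ln G)\<close> \<phi>0 by auto
    ultimately show ?thesis by simp
  qed
  define a where "a = \<mu> * (1 - R)"
  have a0: "0 < a" using \<mu>0 R by (simp add: a_def)
  \<comment> \<open>With \<open>\<kappa>'\<^sup>2 <= G\<close>, the smallness condition of
    \<open>dwell\<close> holds up to time \<open>T + \<delta>\<close>.\<close>
  define \<delta> where "\<delta> = \<mu> * R / (\<phi> * G)"
  have \<delta>0: "0 < \<delta>" using \<mu>0 R \<phi>0 G1 by (simp add: \<delta>_def)
  \<comment> \<open>The rate between events, minus the cost \<open>ln G\<close> of one event spread
    over the minimal dwell time.\<close>
  define \<sigma> where "\<sigma> = a - ln G / \<delta>"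
  have \<sigma>0: "0 < \<sigma>"
  proof -
    have "\<phi> * (G * G * ln G) < \<mu>\<^sup>2 * R * (1 - R)"
      using \<open>\<phi> < \<mu>\<^sup>2 * R * (1 - R) / (G\<^sup>2 * ln G)\<close> G1 lnG by (simp add: pos_less_divide_eq power2_eq_square)
    \<comment> \<open>Lowering \<open>G * G\<close> to \<open>1 * G\<close> leaves the quantity
      \<open>ln G * (\<phi> * G)\<close> that \<open>ln G < a * \<delta>\<close> requires.\<close>
    moreover have "\<phi> * (1 * G * ln G) \<le> \<phi> * (G * G * ln G)"
      using G1 lnG \<phi>0 by (intro mult_left_mono mult_right_mono) auto
    ultimately have "ln G * (\<phi> * G) < (a * (\<mu> * R))" by (simp add: a_def power2_eq_square mult_ac)
    then have "ln G < a * (\<mu> * R) / (\<phi> * G)" using \<phi>0 G1 by (simp add: pos_less_divide_eq)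
    then have "ln G < a * \<delta>" by (simp add: \<delta>_def)
    then show ?thesis using \<delta>0 by (simp add: \<sigma>_def pos_divide_less_eq)
  qed
  have lamc: "continuous_on {0..1} (lam t)" if "0 \<le> t" for t
    using lam_C1[OF that] by (meson DERIV_continuous_on)
  have "norm2 (u t) \<le> G * exp (- \<sigma> * t) * norm2 (u 0)"
    if cl: "closed_loop_solution act \<epsilon> q lam c \<mu> R \<eta> \<theta> u0 u" and t: "0 \<le> t" for u0 u t
  proof -
    obtain \<tau> K Kx where sch: "scheduled act \<epsilon> q lam c \<mu> R \<eta> \<theta> u \<tau> K Kx" and uC: "C0_L2 {0..} u"
      using cl unfolding closed_loop_solution_def by blast
    have uL: "u t \<in> L2" if "0 \<le> t" for t using uC that by (simp add: C0_L2_def)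
    have step: "(\<forall>t\<ge>T. ereal t \<le> \<tau> (Suc j) \<longrightarrow> norm2 (u t) \<le> G * exp (- a * (t - T)) * norm2 (u T)) \<and> ereal (T + \<delta>) \<le> \<tau> (Suc j)"
      if Tj: "\<tau> j = ereal T" and T0: "0 \<le> T" for j T
    proof -
      obtain v m where ker: "kernel \<epsilon> q c (lam T) (K j) (Kx j)"
        and sol: "fixed_gain_solution act \<epsilon> q lam (K j) (Kx j) T v"
        and st: "trigger_state lam \<mu> R \<eta> (K j) T v m"
        and next_event: "\<tau> (Suc j) = (INF t\<in>{t. t > T \<and> trigger lam \<mu> R (K j) T v t > 1 / \<theta> * m t}. ereal t)"
        and uv: "\<forall>t\<ge>T. ereal t \<le> \<tau> (Suc j) \<longrightarrow> (AE x in unitM. u t x = v t x)"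
        using sch Tj unfolding scheduled_def by blast
      obtain Ky Kxx Kxy Kyx Kyy where bs: "backstepping \<epsilon> c q (lam T) (K j) (Kx j) Ky Kxx Kxy Kyx Kyy"
        using kernel_backstepping[OF ker eps lamc[OF T0]] by blast
      interpret event_interval \<epsilon> c q lam T "K j" "Kx j" Ky Kxx Kxy Kyx Kyy M s \<phi> \<mu> \<mu>1 R \<eta> \<theta> act v m
      proof (rule event_interval.intro[where lam=lam and T=T, OF bs], rule event_interval_axioms.intro)
        fix y :: real assume "y \<in> {0..1}"
        then have "\<bar>lam T y + c\<bar> \<le> lbar + c" using lam_bound[OF T0] c0 by (smt (verit))
        then show "\<bar>backstepping.B \<epsilon> c (lam T) y\<bar> \<le> M"
          using eps by (simp add: backstepping.B_def[OF bs] M_def abs_divide divide_right_mono)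
      next
        show "\<bar>lam t x - lam T x\<bar> \<le> \<phi> * (t - T)" if "x \<in> {0..1}" "T \<le> t" for x t
          using lam_lipschitz[of x t T] that T0 by simp
      qed (use s T0 lamc \<phi>0 sol st coercive \<mu>0 R assms in auto)
      show ?thesis
      proof (intro conjI allI impI)
        fix t assume tT: "T \<le> t" and tn: "ereal t \<le> \<tau> (Suc j)"
        have "trig r \<le> 1 / \<theta> * m r" if r: "T < r" "r < t" for r
        proof (rule ccontr)
          assume "\<not> trig r \<le> 1 / \<theta> * m r"
          then have "\<tau> (Suc j) \<le> ereal r" unfolding next_event by (intro INF_lower) (use r in auto)
          then show False using tn r by (meson ereal_less_eq(3) not_less order_trans)
        qed
        from decay[OF tT this]
        have "norm2 (v t) \<le> \<kappa>'\<^sup>2 * exp (- \<mu> * (1 - R) * (t - T)) * norm2 (v T)"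
          by (simp add: \<kappa>'_def \<kappa>_def)
        also have "\<dots> \<le> G * exp (- a * (t - T)) * norm2 (v T)"
          using \<kappa>'G by (intro mult_right_mono norm2_nonneg) (auto simp: a_def)
        finally have "norm2 (v t) \<le> G * exp (- a * (t - T)) * norm2 (v T)" .
        moreover have "norm2 (u t) = norm2 (v t)"
          using uv tT tn T0 by (intro norm2_cong_AE uL v_L2) auto
        moreover have "norm2 (u T) = norm2 (v T)"
        proof (intro norm2_cong_AE uL v_L2 T0 order_refl)
          have "ereal T \<le> \<tau> (Suc j)" using tT tn by (meson ereal_less_eq(3) order_trans)
          then show "AE x in unitM. u T x = v T x" using uv by blast
        qed
        ultimately show "norm2 (u t) \<le> G * exp (- a * (t - T)) * norm2 (u T)" by simp
      next
        show "ereal (T + \<delta>) \<le> \<tau> (Suc j)"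
          unfolding next_event
        proof (rule INF_greatest)
          fix r assume "r \<in> {t. t > T \<and> trig t > 1 / \<theta> * m t}"
          then have r: "T < r" "\<not> trig r \<le> 1 / \<theta> * m r" by auto
          show "ereal (T + \<delta>) \<le> ereal r"
          proof (rule ccontr)
            assume "\<not> ereal (T + \<delta>) \<le> ereal r"
            then have rd: "r - T \<le> \<delta>" by simp
            have "\<phi> * \<kappa>'\<^sup>2 * (r - T) \<le> \<phi> * G * \<delta>"
              using rd r \<phi>0 \<kappa>'G G1 by (intro mult_mono mult_left_mono) auto
            also have "\<dots> = \<mu> * R" using \<phi>0 G1 by (simp add: \<delta>_def)
            finally have "trig r \<le> 1 / \<theta> * m r" by (intro dwell r(1)) (simp add: \<kappa>'_def \<kappa>_def)
            then show False using r(2) by simp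
          qed
        qed
      qed
    qed
    have \<tau>0: "\<tau> 0 = ereal 0" and \<tau>inf: "\<And>j. \<tau> j = \<infinity> \<Longrightarrow> \<tau> (Suc j) = \<infinity>"
      using sch unfolding scheduled_def by (auto simp: zero_ereal_def)
    \<comment> \<open>The bound at event times carries no factor \<open>G\<close>, as every
      completed interval is long enough to absorb it. The induction also gives
      \<open>real j * \<delta> <= T\<close>, which excludes accumulation of events.\<close>
    have events: "\<tau> j = \<infinity> \<or> (\<exists>T. \<tau> j = ereal T \<and> real j * \<delta> \<le> T \<and> norm2 (u T) \<le> exp (- \<sigma> * T) * norm2 (u 0))" for j
    proof (induction j)
      case 0
      then show ?case using \<tau>0 by auto
    next
      case (Suc j)
      show ?case
      proof (cases "\<tau> j = \<infinity>")
        case True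
        then show ?thesis using \<tau>inf by blast
      next
        case False
        then obtain T where Tj: "\<tau> j = ereal T" and jT: "real j * \<delta> \<le> T" and uT: "norm2 (u T) \<le> exp (- \<sigma> * T) * norm2 (u 0)"
          using Suc.IH by blast
        have T0: "0 \<le> T" using jT \<delta>0 by (meson mult_nonneg_nonneg of_nat_0_le_iff order_trans less_imp_le)
        note st = step[OF Tj T0]
        show ?thesis
        proof (cases "\<tau> (Suc j)")
          case (real T')
          then have T': "T + \<delta> \<le> T'" using st by simp
          have "norm2 (u T') \<le> G * exp (- a * (T' - T)) * norm2 (u T)" using st real T' \<delta>0 by simp
          also have "\<dots> \<le> exp (- \<sigma> * (T' - T)) * norm2 (u T)"
          proof (rule mult_right_mono[OF _ norm2_nonneg])
            have "ln G / \<delta> * \<delta> \<le> ln G / \<delta> * (T' - T)" using T' lnG \<delta>0 by (intro mult_left_mono) auto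
            then have "ln G - a * (T' - T) \<le> - \<sigma> * (T' - T)" using \<delta>0 by (simp add: \<sigma>_def algebra_simps)
            moreover have "G * exp (- a * (T' - T)) = exp (ln G - a * (T' - T))" using G1 by (simp add: exp_diff exp_minus divide_inverse)
            ultimately show "G * exp (- a * (T' - T)) \<le> exp (- \<sigma> * (T' - T))" by simp
          qed
          also have "\<dots> \<le> exp (- \<sigma> * (T' - T)) * (exp (- \<sigma> * T) * norm2 (u 0))" by (intro mult_left_mono uT) simp
          also have "\<dots> = exp (- \<sigma> * T') * norm2 (u 0)" by (simp add: algebra_simps flip: exp_add mult.assoc)
          finally show ?thesis using real jT T' by (auto simp: algebra_simps)
        next
          case MInf
          then show ?thesis using st by simp
        qed simp
      qed
    qed
    have "\<exists>j. ereal t < \<tau> j"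
    proof -
      obtain j where "t / \<delta> < real j" using reals_Archimedean2 by blast
      then have "t < real j * \<delta>" using \<delta>0 by (simp add: pos_divide_less_eq)
      then show ?thesis using events[of j] by (intro exI[of _ j]) auto
    qed
    \<comment> \<open>The predecessor of the least such index opens the interval containing
      \<open>t\<close>. The single factor \<open>G\<close> of the result comes from this last,
      possibly incomplete, interval.\<close>
    then obtain j where j: "ereal t < \<tau> j" "\<And>i. i < j \<Longrightarrow> \<not> ereal t < \<tau> i"
      using exists_least_iff[of "\<lambda>j. ereal t < \<tau> j"] by auto
    have "j \<noteq> 0" using j(1) \<tau>0 t by (metis ereal_less(2) ereal_less_eq(3) less_ereal.simps(1) not_less)
    then obtain i where i: "j = Suc i" by (cases j) auto
    have ti: "\<tau> i \<le> ereal t" using j(2)[of i] i by simp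
    then obtain T where Ti: "\<tau> i = ereal T" and iT: "real i * \<delta> \<le> T" and uT: "norm2 (u T) \<le> exp (- \<sigma> * T) * norm2 (u 0)"
      using events[of i] by auto
    have T0: "0 \<le> T" using iT \<delta>0 by (meson mult_nonneg_nonneg of_nat_0_le_iff order_trans less_imp_le)
    have Tt: "T \<le> t" using ti Ti by simp
    have "norm2 (u t) \<le> G * exp (- a * (t - T)) * norm2 (u T)"
      using step[OF Ti T0] Tt j(1) i by auto
    also have "\<dots> \<le> G * exp (- \<sigma> * (t - T)) * norm2 (u T)"
    proof (intro mult_right_mono mult_left_mono norm2_nonneg)
      have "\<sigma> \<le> a" using lnG \<delta>0 by (simp add: \<sigma>_def)
      then have "\<sigma> * (t - T) \<le> a * (t - T)" using Tt by (intro mult_right_mono) auto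
      then show "exp (- a * (t - T)) \<le> exp (- \<sigma> * (t - T))" by simp
    qed (use G1 in simp)
    also have "\<dots> \<le> G * exp (- \<sigma> * (t - T)) * (exp (- \<sigma> * T) * norm2 (u 0))"
      using G1 by (intro mult_left_mono uT) auto
    also have "\<dots> = G * exp (- \<sigma> * t) * norm2 (u 0)"
    proof -
      have "exp (- \<sigma> * (t - T)) * exp (- \<sigma> * T) = exp (- \<sigma> * t)" by (simp add: algebra_simps flip: exp_add)
      then show ?thesis by (metis mult.assoc)
    qed
    finally show ?thesis .
  qed
  then show ?thesis using \<sigma>0 by blast
qed

end
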